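(* Let $\mathcal{V}=(V_1,V_2,\ldots)$ and $\mathcal{W}=(W_1,W_2,\ldots)$ be independent, zero mean, strictly stationary, $\rho$-mixing sequences of real random variables with $E(V_1^4)<\infty$, $E(W_1^4)<\infty$, $\sigma_1^2=\mathrm{Var}(V_1)>0$, $\sigma_2^2=\mathrm{Var}(W_1)>0$, whose $\rho$-mixing coefficients $\rho_1(\cdot)$ and $\rho_2(\cdot)$ satisfy $\sum_{k=1}^\infty\rho_1(2^k)<\infty$ and $\sum_{k=1}^\infty\rho_2(2^k)<\infty$. For each $d\ge 1$ let $\mathbf{X}=\mu_1+\mathbf{V}$ and $\mathbf{Y}=\mu_2+\mathbf{W}$, where $\mu_1,\mu_2\in\mathbb{R}^d$ (depending on $d$), $\mathbf{V}=(V_1,\ldots,V_d)$ and $\mathbf{W}=(W_1,\ldots,W_d)$. Let $\mathbf{X}_1,\ldots,\mathbf{X}_m$ be i.i.d. copies of $\mathbf{X}$ and, independently, $\mathbf{Y}_1,\ldots,\mathbf{Y}_n$ be i.i.d. copies of $\mathbf{Y}$. Put $\mu=\mu_2-\mu_1$, $\Sigma_1=\mathrm{Disp}(\mathbf{X})$, $\Sigma_2=\mathrm{Disp}(\mathbf{Y})$, and $$\Gamma_1=\frac{2\,\mathrm{tr}(\Sigma_1^2)}{(m)_2}+\frac{2\,\mathrm{tr}(\Sigma_2^2)}{(n)_2}+\frac{4\,\mathrm{tr}(\Sigma_1\Sigma_2)}{mn}.$$ Assume that $\|\mu\|^2/d^{1/2+\epsilon}\to 0$ for some $\epsilon>0$,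 that $\mu'(\Sigma_1+\Sigma_2)\mu=o(\mathrm{tr}(\Sigma_1^2+\Sigma_2^2))$ as $d\to\infty$, and that $\lim_{d\to\infty}\|\mu\|^2/\Gamma_1^{1/2}=c$ for some $c\in[0,\infty]$. Let $\beta_{T_{WMW}}(\mu)$ and $\beta_{T_{CQ}^{(2)}}(\mu)$ be the powers of the tests of $H_0:\mu=\mathbf 0$ based on $T_{WMW}$ and $T_{CQ}^{(2)}$ at level of significance $\alpha\in(0,1)$. Then, for every fixed $m,n\ge 2$, $$\lim_{d\to\infty}\beta_{T_{WMW}}(\mu)=\lim_{d\to\infty}\beta_{T_{CQ}^{(2)}}(\mu)=\beta,$$ where $\beta=\alpha$ if $c=0$, $\beta=1$ if $c=\infty$, and $\beta\in(\alpha,1)$ if $c\in(0,\infty)$.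
   Context: Notation: $(p)_q=p(p-1)\cdots(p-q+1)$; $\|\cdot\|$ is the Euclidean norm on $\mathbb{R}^d$; $'$ denotes transpose; $\mathrm{Disp}$ denotes the dispersion (covariance) matrix; $S(\mathbf{x})=\mathbf{x}/\|\mathbf{x}\|$ is the spatial sign of $\mathbf{x}\neq\mathbf 0$. The two sample statistics are $$T_{CQ}^{(2)}=\frac{1}{(m)_2(n)_2}\sum_{\substack{i_1,i_2=1\\ i_1\ne i_2}}^m\ \sum_{\substack{j_1,j_2=1\\ j_1\ne j_2}}^n(\mathbf{X}_{i_1}-\mathbf{Y}_{j_1})'(\mathbf{X}_{i_2}-\mathbf{Y}_{j_2}),$$ $$T_{WMW}=\frac{1}{(m)_2(n)_2}\sum_{\substack{i_1,i_2=1\\ i_1\ne i_2}}^m\ \sum_{\substack{j_1,j_2=1\\ j_1\ne j_2}}^n S(\mathbf{Y}_{j_1}-\mathbf{X}_{i_1})'S(\mathbf{Y}_{j_2}-\mathbf{X}_{i_2}).$$ Tests and powers: let $\zeta_\alpha$ be the $(1-\alpha)$-quantile of the standard Gaussian distribution. The level-$\alpha$ test based on $T_{WMW}$ rejects $H_0$ when $d(\sigma_1^2+\sigma_2^2)T_{WMW}/\Gamma_1^{1/2}>\zeta_\alpha$, and the one based on $T_{CQ}^{(2)}$ rejects $H_0$ when $T_{CQ}^{(2)}/\Gamma_1^{1/2}>\zeta_\alpha$. The powers $\beta_{T_{WMW}}(\mu)$ and $\beta_{T_{CQ}^{(2)}}(\mu)$ are the probabilities of these rejection events when the mean difference is $\mu$.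 $\rho$-mixing: for an infinite sequence $(X_1,X_2,\ldots)$ of random variables, the $\rho$-mixing coefficient is $\rho(r)=\sup_{k\ge 1}\sup_{f,g}|\mathrm{Corr}(f,g)|$, where $f$ ranges over square integrable random variables measurable with respect to $\sigma(X_1,\ldots,X_k)$ and $g$ over square integrable random variables measurable with respect to $\sigma(X_{k+r},X_{k+r+1},\ldots)$. The sequence is $\rho$-mixing if $\rho(r)\to0$ as $r\to\infty$. *)

theory Defs
  imports "HOL-Probability.Probability" "HOL-Library.Landau_Symbols"
begin

(* The dimension d tends to infinity, so it cannot be a type. A vector of R^d is a function
   nat => real and a d x d matrix a function nat => nat => real, of which only the entries with
   indices in {1..d} are used. The Euclidean norm of x is L2_set x {1..d}. *)

definition dotp :: "nat \<Rightarrow> (nat \<Rightarrow> real) \<Rightarrow> (nat \<Rightarrow> real) \<Rightarrow> real" where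
  "dotp d x y = (\<Sum>k=1..d. x k * y k)"

definition mat_vec :: "nat \<Rightarrow> (nat \<Rightarrow> nat \<Rightarrow> real) \<Rightarrow> (nat \<Rightarrow> real) \<Rightarrow> nat \<Rightarrow> real" where
  "mat_vec d A x = (\<lambda>i. \<Sum>k=1..d. A i k * x k)"

definition mat_add :: "(nat \<Rightarrow> nat \<Rightarrow> real) \<Rightarrow> (nat \<Rightarrow> nat \<Rightarrow> real) \<Rightarrow> nat \<Rightarrow> nat \<Rightarrow> real" where
  "mat_add A B = (\<lambda>i j. A i j + B i j)"

definition mat_mul ::
    "nat \<Rightarrow> (nat \<Rightarrow> nat \<Rightarrow> real) \<Rightarrow> (nat \<Rightarrow> nat \<Rightarrow> real) \<Rightarrow> nat \<Rightarrow> nat \<Rightarrow> real" where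
  "mat_mul d A B = (\<lambda>i j. \<Sum>k=1..d. A i k * B k j)"

definition mat_trace :: "nat \<Rightarrow> (nat \<Rightarrow> nat \<Rightarrow> real) \<Rightarrow> real" where
  "mat_trace d A = (\<Sum>i=1..d. A i i)"

(* S(x) = x / ||x||; division by zero gives S(0) = 0. *)
definition spatial_sign :: "nat \<Rightarrow> (nat \<Rightarrow> real) \<Rightarrow> nat \<Rightarrow> real" where
  "spatial_sign d x = (\<lambda>k. x k / L2_set x {1..d})"

(* (p)_q = p (p - 1) ... (p - q + 1) *)
definition falling :: "nat \<Rightarrow> nat \<Rightarrow> real" where
  "falling p q = (\<Prod>k<q. real p - real k)"

definition cov :: "'a measure \<Rightarrow> ('a \<Rightarrow> real) \<Rightarrow> ('a \<Rightarrow> real) \<Rightarrow> real" where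
  "cov M f g = (\<integral>\<omega>. (f \<omega> - (\<integral>\<eta>. f \<eta> \<partial>M)) * (g \<omega> - (\<integral>\<eta>. g \<eta> \<partial>M)) \<partial>M)"

(* Equals 0 if f or g has zero variance. *)
definition corr :: "'a measure \<Rightarrow> ('a \<Rightarrow> real) \<Rightarrow> ('a \<Rightarrow> real) \<Rightarrow> real" where
  "corr M f g = cov M f g / sqrt (cov M f f * cov M g g)"

definition disp :: "'a measure \<Rightarrow> (nat \<Rightarrow> 'a \<Rightarrow> real) \<Rightarrow> nat \<Rightarrow> nat \<Rightarrow> real" where
  "disp M X = (\<lambda>k l. cov M (X k) (X l))"

definition generated_algebra :: "'a measure \<Rightarrow> (nat \<Rightarrow> 'a \<Rightarrow> real) \<Rightarrow> nat set \<Rightarrow> 'a measure" where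
  "generated_algebra M X I =
     sigma (space M) {X k -` B \<inter> space M | k B. k \<in> I \<and> B \<in> sets (borel :: real measure)}"

definition square_integrable_wrt :: "'a measure \<Rightarrow> 'a measure \<Rightarrow> ('a \<Rightarrow> real) set" where
  "square_integrable_wrt M F = {f. f \<in> borel_measurable F \<and> integrable M (\<lambda>\<omega>. (f \<omega>)\<^sup>2)}"

(* Sequences of random variables are indexed by 1, 2, ...; the value at 0 is never used.
   On a probability space the set below is nonempty and, by Cauchy-Schwarz, bounded by 1, so the
   supremum of reals is meaningful. *)
definition rho_coeff :: "'a measure \<Rightarrow> (nat \<Rightarrow> 'a \<Rightarrow> real) \<Rightarrow> nat \<Rightarrow> real" where
  "rho_coeff M X r =
     Sup {\<bar>corr M f g\<bar> | k f g. 1 \<le> k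
            \<and> f \<in> square_integrable_wrt M (generated_algebra M X {1..k})
            \<and> g \<in> square_integrable_wrt M (generated_algebra M X {k + r..})}"

definition rho_mixing :: "'a measure \<Rightarrow> (nat \<Rightarrow> 'a \<Rightarrow> real) \<Rightarrow> bool" where
  "rho_mixing M X \<longleftrightarrow> rho_coeff M X \<longlonglongrightarrow> 0"

definition strictly_stationary :: "'a measure \<Rightarrow> (nat \<Rightarrow> 'a \<Rightarrow> real) \<Rightarrow> bool" where
  "strictly_stationary M X \<longleftrightarrow>
     (\<forall>J h. finite J \<and> J \<subseteq> {1..} \<longrightarrow>
        distr M (PiM J (\<lambda>_. borel)) (\<lambda>\<omega>. \<lambda>k\<in>J. X (k + h) \<omega>) =
        distr M (PiM J (\<lambda>_. borel)) (\<lambda>\<omega>. \<lambda>k\<in>J. X k \<omega>))"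

(* x i and y j are the i-th and j-th observations, for i in {1..m} and j in {1..n}. *)
definition T_CQ :: "nat \<Rightarrow> nat \<Rightarrow> nat \<Rightarrow> (nat \<Rightarrow> nat \<Rightarrow> real) \<Rightarrow> (nat \<Rightarrow> nat \<Rightarrow> real) \<Rightarrow> real" where
  "T_CQ d m n x y = 1 / (falling m 2 * falling n 2) *
     (\<Sum>i1=1..m. \<Sum>i2\<in>{1..m} - {i1}. \<Sum>j1=1..n. \<Sum>j2\<in>{1..n} - {j1}.
        dotp d (\<lambda>k. x i1 k - y j1 k) (\<lambda>k. x i2 k - y j2 k))"

definition T_WMW :: "nat \<Rightarrow> nat \<Rightarrow> nat \<Rightarrow> (nat \<Rightarrow> nat \<Rightarrow> real) \<Rightarrow> (nat \<Rightarrow> nat \<Rightarrow> real) \<Rightarrow> real" where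
  "T_WMW d m n x y = 1 / (falling m 2 * falling n 2) *
     (\<Sum>i1=1..m. \<Sum>i2\<in>{1..m} - {i1}. \<Sum>j1=1..n. \<Sum>j2\<in>{1..n} - {j1}.
        dotp d (spatial_sign d (\<lambda>k. y j1 k - x i1 k)) (spatial_sign d (\<lambda>k. y j2 k - x i2 k)))"

definition Gamma1 ::
    "nat \<Rightarrow> nat \<Rightarrow> nat \<Rightarrow> (nat \<Rightarrow> nat \<Rightarrow> real) \<Rightarrow> (nat \<Rightarrow> nat \<Rightarrow> real) \<Rightarrow> real" where
  "Gamma1 d m n \<Sigma>1 \<Sigma>2 =
     2 * mat_trace d (mat_mul d \<Sigma>1 \<Sigma>1) / falling m 2
     + 2 * mat_trace d (mat_mul d \<Sigma>2 \<Sigma>2) / falling n 2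
     + 4 * mat_trace d (mat_mul d \<Sigma>1 \<Sigma>2) / (real m * real n)"

definition quantile :: "real measure \<Rightarrow> real \<Rightarrow> real" where
  "quantile D p = Inf {x. p \<le> cdf D x}"

definition gauss_crit :: "real \<Rightarrow> real" where
  "gauss_crit \<alpha> = quantile std_normal_distribution (1 - \<alpha>)"

(* P is the probability space carrying the samples X 1, ..., X m and Y 1, ..., Y n, which take
   values in R^d; G stands for Gamma_1, and s1, s2 for the variances sigma_1^2, sigma_2^2. *)
definition power_CQ ::
    "'b measure \<Rightarrow> nat \<Rightarrow> nat \<Rightarrow> nat \<Rightarrow> (nat \<Rightarrow> 'b \<Rightarrow> nat \<Rightarrow> real) \<Rightarrow> (nat \<Rightarrow> 'b \<Rightarrow> nat \<Rightarrow> real)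
      \<Rightarrow> real \<Rightarrow> real \<Rightarrow> real" where
  "power_CQ P d m n X Y G \<alpha> =
     measure P {\<omega> \<in> space P. T_CQ d m n (\<lambda>i. X i \<omega>) (\<lambda>j. Y j \<omega>) / sqrt G > gauss_crit \<alpha>}"

definition power_WMW ::
    "'b measure \<Rightarrow> nat \<Rightarrow> nat \<Rightarrow> nat \<Rightarrow> (nat \<Rightarrow> 'b \<Rightarrow> nat \<Rightarrow> real) \<Rightarrow> (nat \<Rightarrow> 'b \<Rightarrow> nat \<Rightarrow> real)
      \<Rightarrow> real \<Rightarrow> real \<Rightarrow> real \<Rightarrow> real \<Rightarrow> real" where
  "power_WMW P d m n X Y s1 s2 G \<alpha> =
     measure P {\<omega> \<in> space P.
       real d * (s1 + s2) * T_WMW d m n (\<lambda>i. X i \<omega>) (\<lambda>j. Y j \<omega>) / sqrt G > gauss_crit \<alpha>}"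

end

theory Submission
  imports Defs
begin

text \<open>
  Write \<open>e = W - V\<close> for the noise in a difference \<open>Y - X = \<mu> + e\<close>. The statistic \<open>T_CQ\<close> is then
  \<open>\<parallel>\<mu>\<parallel>\<^sup>2\<close>, plus terms linear in \<open>\<mu>\<close>, plus a pure noise part \<open>Z 1 + \<dots> + Z d\<close>, where \<open>Z k\<close> is a quadratic
  form without diagonal in the \<open>k\<close>-th coordinates of the \<open>m + n\<close> independent observations. The
  linear terms have variance \<open>o(d)\<close> by the assumption on \<open>\<mu>'(\<Sigma>1 + \<Sigma>2)\<mu>\<close>, and \<open>\<Gamma>1\<close>
  is exactly the variance of the noise part, which grows like \<open>\<kappa> d\<close> with \<open>\<kappa> > 0\<close>. So everything
  rests on a central limit theorem for the stationary sequence \<open>Z\<close>.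

  This sequence lives on the product of \<open>m + n\<close> copies of the original probability space, and it
  inherits \<open>\<rho>\<close>-mixing: if past and future are nearly uncorrelated on each factor,
  they are on the product, and the coefficients add up
  (\<open>decorrelated_pair\<close>, \<open>decorrelated_PiM\<close>). The variance is linear because the autocovariances
  of \<open>V\<close> and \<open>W\<close> are square summable. This is the only place where the dyadic
  series \<open>\<Sum> \<rho>(2^k)\<close> enters: comparing two separated blocks of the sequence \<open>V k V' k\<close>,
  with \<open>V'\<close> an independent copy of \<open>V\<close>, bounds the sum of the squared autocovariances over one
  dyadic range of lags by \<open>\<rho>\<close> times the whole sum so far (\<open>autocov_square_summable\<close>).
  Linear variance and \<open>\<rho>(r) \<longlonglongrightarrow> 0\<close> give a fourth moment of the block sums of the order of the
  squared length (\<open>fourth_moment_quadratic\<close>), and then Bernstein's big blocks, separated by gaps of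
  fixed length, give the central limit theorem through characteristic functions (\<open>central_limit\<close>).

  For \<open>T_WMW\<close> each scalar product of two spatial signs is the corresponding scalar product of
  differences divided by two norms. By a law of large numbers for the squares of \<open>V\<close> and \<open>W\<close>,
  the squared norms are \<open>\<parallel>\<mu>\<parallel>\<^sup>2 + d (\<sigma>1\<^sup>2 + \<sigma>2\<^sup>2) (1 + o(1))\<close> in probability. If the limit \<open>c\<close> is finite,
  \<open>\<parallel>\<mu>\<parallel>\<^sup>2\<close> is \<open>O(\<surd>d)\<close>, the norms are asymptotically deterministic, and both statistics differ
  by \<open>o(\<surd>d)\<close>; both powers tend to \<open>1 - \<Phi>(\<zeta> - c)\<close>. If \<open>c = \<infinity>\<close>, every summand of
  either statistic, divided by \<open>\<surd>d\<close>, tends to infinity in probability. For \<open>T_WMW\<close> this holds even when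
  \<open>\<parallel>\<mu>\<parallel>\<^sup>2\<close> is of larger order than \<open>d\<close>, because then the signs align.
\<close>


section \<open>Decorrelated pairs of sub-\<sigma>-algebras\<close>

lemma cauchy_schwarz_integral:
  fixes f g :: "'a \<Rightarrow> real"
  assumes [measurable]: "f \<in> borel_measurable M" "g \<in> borel_measurable M"
    and f: "integrable M (\<lambda>x. (f x)\<^sup>2)" and g: "integrable M (\<lambda>x. (g x)\<^sup>2)"
  shows "integrable M (\<lambda>x. f x * g x)"
    and "\<bar>\<integral>x. f x * g x \<partial>M\<bar> \<le> sqrt (\<integral>x. (f x)\<^sup>2 \<partial>M) * sqrt (\<integral>x. (g x)\<^sup>2 \<partial>M)"
proof -
  define a b where "a = sqrt (\<integral>x. (f x)\<^sup>2 \<partial>M)" and "b = sqrt (\<integral>x. (g x)\<^sup>2 \<partial>M)"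
  have ab: "a \<ge> 0" "b \<ge> 0" "a\<^sup>2 = (\<integral>x. (f x)\<^sup>2 \<partial>M)" "b\<^sup>2 = (\<integral>x. (g x)\<^sup>2 \<partial>M)"
    unfolding a_def b_def by auto
  have pt: "\<bar>u * v\<bar> \<le> u\<^sup>2 + v\<^sup>2" for u v :: real
  proof -
    have "0 \<le> (\<bar>u\<bar> - \<bar>v\<bar>)\<^sup>2" by simp
    then have "2 * (\<bar>u\<bar> * \<bar>v\<bar>) \<le> u\<^sup>2 + v\<^sup>2" by (simp add: power2_diff)
    moreover have "0 \<le> \<bar>u\<bar> * \<bar>v\<bar>" by simp
    ultimately show ?thesis unfolding abs_mult by linarith
  qed
  show int: "integrable M (\<lambda>x. f x * g x)"
    by (rule Bochner_Integration.integrable_bound[OF Bochner_Integration.integrable_add[OF f g]])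
       (use pt in auto)
  have "(\<integral>x. \<bar>f x * g x\<bar> \<partial>M) \<le> a * b"
  proof (cases "a = 0 \<or> b = 0")
    case True
    have "AE x in M. f x * g x = 0"
    proof (cases "a = 0")
      case True
      then have "AE x in M. (f x)\<^sup>2 = 0"
        using integral_nonneg_eq_0_iff_AE[OF f] ab(3) by auto
      then show ?thesis by eventually_elim auto
    next
      case False
      then have "AE x in M. (g x)\<^sup>2 = 0"
        using integral_nonneg_eq_0_iff_AE[OF g] ab(4) True by auto
      then show ?thesis by eventually_elim auto
    qed
    then have "(\<integral>x. \<bar>f x * g x\<bar> \<partial>M) = (\<integral>x. 0 \<partial>M)"
      by (intro integral_cong_AE) auto
    then show ?thesis using True by auto
  next
    case False
    then have p: "0 < a" "0 < b" using ab by auto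
    have "(\<integral>x. 2 * a * b * \<bar>f x * g x\<bar> \<partial>M) \<le> (\<integral>x. b\<^sup>2 * (f x)\<^sup>2 + a\<^sup>2 * (g x)\<^sup>2 \<partial>M)"
    proof (rule integral_mono)
      fix x
      have "0 \<le> (b * \<bar>f x\<bar> - a * \<bar>g x\<bar>)\<^sup>2" by simp
      then show "2 * a * b * \<bar>f x * g x\<bar> \<le> b\<^sup>2 * (f x)\<^sup>2 + a\<^sup>2 * (g x)\<^sup>2"
        by (simp add: power2_diff power_mult_distrib abs_mult algebra_simps)
    qed (use int f g in auto)
    also have "\<dots> = b\<^sup>2 * a\<^sup>2 + a\<^sup>2 * b\<^sup>2" using f g ab by simp
    finally have "2 * a * b * (\<integral>x. \<bar>f x * g x\<bar> \<partial>M) \<le> 2 * a * b * (a * b)"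
      by (simp add: power2_eq_square algebra_simps)
    then show ?thesis using p by (simp add: mult_le_cancel_left)
  qed
  then have "(\<integral>x. \<bar>f x * g x\<bar> \<partial>M) \<le> sqrt (\<integral>x. (f x)\<^sup>2 \<partial>M) * sqrt (\<integral>x. (g x)\<^sup>2 \<partial>M)"
    by (simp add: a_def b_def)
  moreover have "\<bar>\<integral>x. f x * g x \<partial>M\<bar> \<le> (\<integral>x. \<bar>f x * g x\<bar> \<partial>M)" by (rule integral_abs_bound)
  ultimately show "\<bar>\<integral>x. f x * g x \<partial>M\<bar> \<le> sqrt (\<integral>x. (f x)\<^sup>2 \<partial>M) * sqrt (\<integral>x. (g x)\<^sup>2 \<partial>M)"
    by linarith
qed

lemma (in prob_space) square_integral_le:
  fixes f :: "'a \<Rightarrow> real"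
  assumes [measurable]: "f \<in> borel_measurable M" and f: "integrable M (\<lambda>x. (f x)\<^sup>2)"
  shows "(\<integral>x. f x \<partial>M)\<^sup>2 \<le> (\<integral>x. (f x)\<^sup>2 \<partial>M)"
proof -
  have "\<bar>\<integral>x. f x * 1 \<partial>M\<bar> \<le> sqrt (\<integral>x. (f x)\<^sup>2 \<partial>M) * sqrt (\<integral>x. 1\<^sup>2 \<partial>M)"
    by (rule cauchy_schwarz_integral) (use f in auto)
  then have "\<bar>\<integral>x. f x \<partial>M\<bar> \<le> sqrt (\<integral>x. (f x)\<^sup>2 \<partial>M)" by (simp add: prob_space)
  then have "\<bar>\<integral>x. f x \<partial>M\<bar>\<^sup>2 \<le> (sqrt (\<integral>x. (f x)\<^sup>2 \<partial>M))\<^sup>2" by (intro power_mono) auto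
  then show ?thesis by simp
qed

text \<open>
  Maximal correlation at most \<open>r\<close>. As covariances do not change when \<open>f\<close> and \<open>g\<close> are centered, second moments
  in the bound are as strong as variances, and they are easier to handle on products.
\<close>

definition decorrelated :: "'a measure \<Rightarrow> 'a measure \<Rightarrow> 'a measure \<Rightarrow> real \<Rightarrow> bool" where
  "decorrelated M A B r \<longleftrightarrow> (\<forall>f g. f \<in> square_integrable_wrt M A \<longrightarrow> g \<in> square_integrable_wrt M B \<longrightarrow>
     \<bar>(\<integral>x. f x * g x \<partial>M) - (\<integral>x. f x \<partial>M) * (\<integral>x. g x \<partial>M)\<bar>
       \<le> r * (sqrt (\<integral>x. (f x)\<^sup>2 \<partial>M) * sqrt (\<integral>x. (g x)\<^sup>2 \<partial>M)))"

lemma decorrelatedD: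
  assumes "decorrelated M A B r" "f \<in> borel_measurable A" "g \<in> borel_measurable B"
    "integrable M (\<lambda>x. (f x)\<^sup>2)" "integrable M (\<lambda>x. (g x)\<^sup>2)"
  shows "\<bar>(\<integral>x. f x * g x \<partial>M) - (\<integral>x. f x \<partial>M) * (\<integral>x. g x \<partial>M)\<bar>
       \<le> r * (sqrt (\<integral>x. (f x)\<^sup>2 \<partial>M) * sqrt (\<integral>x. (g x)\<^sup>2 \<partial>M))"
  using assms unfolding decorrelated_def square_integrable_wrt_def by auto

text \<open>
  The integral is taken over the full measure \<open>M1\<close>, while \<open>f\<close> is measurable only for the smaller
  \<open>\<sigma>\<close>-algebra; restricting \<open>M1\<close> to \<open>A1\<close> does not change the integral and makes Fubini applicable.
\<close>

lemma borel_measurable_integral_subalgebra: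
  fixes f :: "'a \<times> 'b \<Rightarrow> real"
  assumes M1: "prob_space M1" and s: "subalgebra M1 A1"
    and f: "f \<in> borel_measurable (A1 \<Otimes>\<^sub>M A2)"
  shows "(\<lambda>y. \<integral>x. f (x, y) \<partial>M1) \<in> borel_measurable A2"
proof -
  let ?R = "restr_to_subalg M1 A1"
  interpret R: prob_space ?R by (rule prob_space_restr_to_subalg[OF s M1])
  have eq: "sets ?R = sets A1" by (rule sets_restr_to_subalg[OF s])
  have f': "f \<in> borel_measurable (?R \<Otimes>\<^sub>M A2)"
    using f measurable_cong_sets[OF sets_pair_measure_cong[OF eq refl] refl] by blast
  have "(\<lambda>(y, x). f (x, y)) \<in> borel_measurable (A2 \<Otimes>\<^sub>M ?R)"
    using measurable_pair_swap[OF f'] by (simp add: case_prod_beta')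
  then have m: "(\<lambda>y. \<integral>x. f (x, y) \<partial>?R) \<in> borel_measurable A2"
    by (rule R.borel_measurable_lebesgue_integral)
  have "(\<integral>x. f (x, y) \<partial>?R) = (\<integral>x. f (x, y) \<partial>M1)" if "y \<in> space A2" for y
  proof (rule integral_subalgebra2[OF s])
    show "(\<lambda>x. f (x, y)) \<in> borel_measurable A1"
      using measurable_compose[OF measurable_Pair2'[of y A2 A1] f] that by simp
  qed
  then show ?thesis using m by (subst measurable_cong[where g="\<lambda>y. \<integral>x. f (x, y) \<partial>?R"]) auto
qed

lemma subalgebra_pair:
  assumes "subalgebra M1 A1" "subalgebra M2 A2"
  shows "subalgebra (M1 \<Otimes>\<^sub>M M2) (A1 \<Otimes>\<^sub>M A2)"
proof -
  have "(\<lambda>x. x) \<in> measurable (M1 \<Otimes>\<^sub>M M2) (A1 \<Otimes>\<^sub>M A2)"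
  proof -
    have "(\<lambda>x. x) \<in> measurable M1 A1" "(\<lambda>x. x) \<in> measurable M2 A2"
      using assms by (auto simp: measurable_def subalgebra_def dest: sets.sets_into_space)
    then have "(\<lambda>x. (fst x, snd x)) \<in> measurable (M1 \<Otimes>\<^sub>M M2) (A1 \<Otimes>\<^sub>M A2)"
      by (intro measurable_Pair measurable_compose[OF measurable_fst] measurable_compose[OF measurable_snd])
    then show ?thesis by simp
  qed
  moreover have "space (A1 \<Otimes>\<^sub>M A2) = space (M1 \<Otimes>\<^sub>M M2)"
    using assms by (simp add: space_pair_measure subalgebra_def)
  ultimately show ?thesis unfolding subalgebra_def
    by (auto dest!: measurable_sets simp: Int_absorb2 sets.sets_into_space dest: sets.sets_into_space)
qed

text \<open>
  With the second coordinate frozen, the sections of \<open>f\<close> and \<open>g\<close> are decorrelated at the cost of \<open>r1\<close>.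
  What remains are their means as functions of the second coordinate, which
  are decorrelated at the cost of \<open>r2\<close> and have smaller second moments than \<open>f\<close> and \<open>g\<close>.
\<close>

lemma decorrelated_pair:
  fixes M1 :: "'a measure" and M2 :: "'b measure"
  assumes M1: "prob_space M1" and M2: "prob_space M2"
    and sA1: "subalgebra M1 A1" and sB1: "subalgebra M1 B1"
    and sA2: "subalgebra M2 A2" and sB2: "subalgebra M2 B2"
    and d1: "decorrelated M1 A1 B1 r1" and d2: "decorrelated M2 A2 B2 r2"
    and r: "0 \<le> r1" "0 \<le> r2"
  shows "decorrelated (M1 \<Otimes>\<^sub>M M2) (A1 \<Otimes>\<^sub>M A2) (B1 \<Otimes>\<^sub>M B2) (r1 + r2)"
  unfolding decorrelated_def square_integrable_wrt_def
proof safe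
  fix f g :: "'a \<times> 'b \<Rightarrow> real"
  assume fA: "f \<in> borel_measurable (A1 \<Otimes>\<^sub>M A2)" and gB: "g \<in> borel_measurable (B1 \<Otimes>\<^sub>M B2)"
    and f2: "integrable (M1 \<Otimes>\<^sub>M M2) (\<lambda>x. (f x)\<^sup>2)" and g2: "integrable (M1 \<Otimes>\<^sub>M M2) (\<lambda>x. (g x)\<^sup>2)"
  interpret M1: prob_space M1 by fact
  interpret M2: prob_space M2 by fact
  interpret pair_sigma_finite M1 M2 ..
  interpret Pr: pair_prob_space M1 M2 ..
  let ?P = "M1 \<Otimes>\<^sub>M M2"
  have f[measurable]: "f \<in> borel_measurable ?P"
    by (rule measurable_from_subalg[OF subalgebra_pair[OF sA1 sA2] fA])
  have g[measurable]: "g \<in> borel_measurable ?P"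
    by (rule measurable_from_subalg[OF subalgebra_pair[OF sB1 sB2] gB])
  have if1: "integrable ?P f" using Pr.square_integrable_imp_integrable[OF f f2] .
  have ig1: "integrable ?P g" using Pr.square_integrable_imp_integrable[OF g g2] .
  have fg: "integrable ?P (\<lambda>x. f x * g x)" by (rule cauchy_schwarz_integral[OF f g f2 g2])
  define F where "F y = (\<integral>x. (f (x, y))\<^sup>2 \<partial>M1)" for y
  define G where "G y = (\<integral>x. (g (x, y))\<^sup>2 \<partial>M1)" for y
  define f' where "f' y = (\<integral>x. f (x, y) \<partial>M1)" for y
  define g' where "g' y = (\<integral>x. g (x, y) \<partial>M1)" for y
  have f'A: "f' \<in> borel_measurable A2" unfolding f'_def
    by (rule borel_measurable_integral_subalgebra[OF M1 sA1 fA])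
  have g'B: "g' \<in> borel_measurable B2" unfolding g'_def
    by (rule borel_measurable_integral_subalgebra[OF M1 sB1 gB])
  note [measurable] = measurable_from_subalg[OF sA2 f'A] measurable_from_subalg[OF sB2 g'B]
  have iF: "integrable M2 F" and eF: "(\<integral>y. F y \<partial>M2) = (\<integral>x. (f x)\<^sup>2 \<partial>?P)"
    using integrable_snd[of "\<lambda>x y. (f (x, y))\<^sup>2"] integral_snd[of "\<lambda>x y. (f (x, y))\<^sup>2"] f2
    unfolding F_def by (auto simp: case_prod_beta')
  have iG: "integrable M2 G" and eG: "(\<integral>y. G y \<partial>M2) = (\<integral>x. (g x)\<^sup>2 \<partial>?P)"
    using integrable_snd[of "\<lambda>x y. (g (x, y))\<^sup>2"] integral_snd[of "\<lambda>x y. (g (x, y))\<^sup>2"] g2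
    unfolding G_def by (auto simp: case_prod_beta')
  have ef': "(\<integral>y. f' y \<partial>M2) = (\<integral>x. f x \<partial>?P)"
    using integral_snd[of "\<lambda>x y. f (x, y)"] if1 unfolding f'_def by (auto simp: case_prod_beta')
  have eg': "(\<integral>y. g' y \<partial>M2) = (\<integral>x. g x \<partial>?P)"
    using integral_snd[of "\<lambda>x y. g (x, y)"] ig1 unfolding g'_def by (auto simp: case_prod_beta')
  have F0: "F y \<ge> 0" and G0: "G y \<ge> 0" for y by (auto simp: F_def G_def)
  have [measurable]: "F \<in> borel_measurable M2" "G \<in> borel_measurable M2" using iF iG by auto
  have AE1: "AE y in M2. integrable M1 (\<lambda>x. (f (x, y))\<^sup>2)"
    using AE_integrable_snd[of "\<lambda>x y. (f (x, y))\<^sup>2"] f2 by (auto simp: case_prod_beta')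
  have AE2: "AE y in M2. integrable M1 (\<lambda>x. (g (x, y))\<^sup>2)"
    using AE_integrable_snd[of "\<lambda>x y. (g (x, y))\<^sup>2"] g2 by (auto simp: case_prod_beta')
  have sec: "(\<lambda>x. h (x, y)) \<in> borel_measurable N1"
    if "h \<in> borel_measurable (N1 \<Otimes>\<^sub>M N2)" "space N2 = space M2" "y \<in> space M2" for h :: "_ \<Rightarrow> real" and N1 N2 y
    using measurable_compose[OF measurable_Pair2'[of y N2 N1] that(1)] that by simp
  have f'F: "AE y in M2. (f' y)\<^sup>2 \<le> F y"
    using AE1 AE_space
  proof eventually_elim
    case (elim y)
    show ?case unfolding f'_def F_def
      by (rule M1.square_integral_le) (use sec[OF f refl] elim in auto)
  qed
  have g'G: "AE y in M2. (g' y)\<^sup>2 \<le> G y"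
    using AE2 AE_space
  proof eventually_elim
    case (elim y)
    show ?case unfolding g'_def G_def
      by (rule M1.square_integral_le) (use sec[OF g refl] elim in auto)
  qed
  have if'2: "integrable M2 (\<lambda>y. (f' y)\<^sup>2)"
    by (rule Bochner_Integration.integrable_bound[OF iF]) (use f'F in auto)
  have ig'2: "integrable M2 (\<lambda>y. (g' y)\<^sup>2)"
    by (rule Bochner_Integration.integrable_bound[OF iG]) (use g'G in auto)
  have if'g': "integrable M2 (\<lambda>y. f' y * g' y)"
    by (rule cauchy_schwarz_integral[OF _ _ if'2 ig'2]) auto
  define h where "h y = (\<integral>x. f (x, y) * g (x, y) \<partial>M1)" for y
  have ih: "integrable M2 h" and eh: "(\<integral>y. h y \<partial>M2) = (\<integral>x. f x * g x \<partial>?P)"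
    using integrable_snd[of "\<lambda>x y. f (x, y) * g (x, y)"] integral_snd[of "\<lambda>x y. f (x, y) * g (x, y)"] fg
    unfolding h_def by (auto simp: case_prod_beta')
  have [simp]: "space A2 = space M2" "space B2 = space M2" using sA2 sB2 by (auto simp: subalgebra_def)
  \<comment> \<open>Freezing the second coordinate decorrelates the sections in the first one.\<close>
  have inner: "AE y in M2. \<bar>h y - f' y * g' y\<bar> \<le> r1 * (sqrt (F y) * sqrt (G y))"
    using AE1 AE2 AE_space
  proof eventually_elim
    case (elim y)
    show ?case unfolding h_def f'_def g'_def F_def G_def
      by (rule decorrelatedD[OF d1]) (use elim sec[OF fA] sec[OF gB] in auto)
  qed
  have sF: "integrable M2 (\<lambda>y. (sqrt (F y))\<^sup>2)" and sG: "integrable M2 (\<lambda>y. (sqrt (G y))\<^sup>2)"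
    using iF iG F0 G0 by auto
  have iFG: "integrable M2 (\<lambda>y. sqrt (F y) * sqrt (G y))"
    by (rule cauchy_schwarz_integral[OF _ _ sF sG]) auto
  have "\<bar>(\<integral>y. h y - f' y * g' y \<partial>M2)\<bar> \<le> (\<integral>y. \<bar>h y - f' y * g' y\<bar> \<partial>M2)"
    by (rule integral_abs_bound)
  also have "\<dots> \<le> (\<integral>y. r1 * (sqrt (F y) * sqrt (G y)) \<partial>M2)"
    by (rule integral_mono_AE) (use ih if'g' iFG inner in auto)
  also have "\<dots> = r1 * (\<integral>y. sqrt (F y) * sqrt (G y) \<partial>M2)" by simp
  also have "\<dots> \<le> r1 * (sqrt (\<integral>y. (sqrt (F y))\<^sup>2 \<partial>M2) * sqrt (\<integral>y. (sqrt (G y))\<^sup>2 \<partial>M2))"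
    using cauchy_schwarz_integral(2)[OF _ _ sF sG] r by (intro mult_left_mono) auto
  also have "\<dots> = r1 * (sqrt (\<integral>x. (f x)\<^sup>2 \<partial>?P) * sqrt (\<integral>x. (g x)\<^sup>2 \<partial>?P))"
    using F0 G0 eF eG by simp
  finally have 1: "\<bar>(\<integral>x. f x * g x \<partial>?P) - (\<integral>y. f' y * g' y \<partial>M2)\<bar>
      \<le> r1 * (sqrt (\<integral>x. (f x)\<^sup>2 \<partial>?P) * sqrt (\<integral>x. (g x)\<^sup>2 \<partial>?P))"
    using ih if'g' eh by simp
  have "\<bar>(\<integral>y. f' y * g' y \<partial>M2) - (\<integral>y. f' y \<partial>M2) * (\<integral>y. g' y \<partial>M2)\<bar>
      \<le> r2 * (sqrt (\<integral>y. (f' y)\<^sup>2 \<partial>M2) * sqrt (\<integral>y. (g' y)\<^sup>2 \<partial>M2))"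
    by (rule decorrelatedD[OF d2 f'A g'B if'2 ig'2])
  also have "\<dots> \<le> r2 * (sqrt (\<integral>y. F y \<partial>M2) * sqrt (\<integral>y. G y \<partial>M2))"
    using r f'F g'G iF iG if'2 ig'2 F0 G0
    by (intro mult_left_mono mult_mono real_sqrt_le_mono integral_mono_AE) (auto intro!: Bochner_Integration.integral_nonneg)
  finally have 2: "\<bar>(\<integral>y. f' y * g' y \<partial>M2) - (\<integral>x. f x \<partial>?P) * (\<integral>x. g x \<partial>?P)\<bar>
      \<le> r2 * (sqrt (\<integral>x. (f x)\<^sup>2 \<partial>?P) * sqrt (\<integral>x. (g x)\<^sup>2 \<partial>?P))"
    using ef' eg' eF eG by simp
  show "\<bar>(\<integral>x. f x * g x \<partial>?P) - (\<integral>x. f x \<partial>?P) * (\<integral>x. g x \<partial>?P)\<bar>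
      \<le> (r1 + r2) * (sqrt (\<integral>x. (f x)\<^sup>2 \<partial>?P) * sqrt (\<integral>x. (g x)\<^sup>2 \<partial>?P))"
    using 1 2 unfolding distrib_right by linarith
qed

lemma decorrelated_distr:
  fixes T :: "'a \<Rightarrow> 'b"
  assumes d: "decorrelated P A' B' r" and T[measurable]: "T \<in> measurable P Q"
    and TA: "T \<in> measurable A' A" and TB: "T \<in> measurable B' B"
    and sA: "subalgebra Q A" and sB: "subalgebra Q B"
  shows "decorrelated (distr P Q T) A B r"
  unfolding decorrelated_def square_integrable_wrt_def
proof safe
  fix f g :: "'b \<Rightarrow> real"
  assume fA: "f \<in> borel_measurable A" and gB: "g \<in> borel_measurable B"
    and f2: "integrable (distr P Q T) (\<lambda>x. (f x)\<^sup>2)" and g2: "integrable (distr P Q T) (\<lambda>x. (g x)\<^sup>2)"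
  have [measurable]: "f \<in> borel_measurable Q" "g \<in> borel_measurable Q"
    using measurable_from_subalg[OF sA fA] measurable_from_subalg[OF sB gB] by auto
  have "\<bar>(\<integral>x. f (T x) * g (T x) \<partial>P) - (\<integral>x. f (T x) \<partial>P) * (\<integral>x. g (T x) \<partial>P)\<bar>
       \<le> r * (sqrt (\<integral>x. (f (T x))\<^sup>2 \<partial>P) * sqrt (\<integral>x. (g (T x))\<^sup>2 \<partial>P))"
    by (rule decorrelatedD[OF d])
       (use f2 g2 measurable_compose[OF TA fA] measurable_compose[OF TB gB] in \<open>auto simp: integrable_distr_eq\<close>)
  then show "\<bar>(\<integral>x. f x * g x \<partial>distr P Q T) - (\<integral>x. f x \<partial>distr P Q T) * (\<integral>x. g x \<partial>distr P Q T)\<bar>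
       \<le> r * (sqrt (\<integral>x. (f x)\<^sup>2 \<partial>distr P Q T) * sqrt (\<integral>x. (g x)\<^sup>2 \<partial>distr P Q T))"
    by (simp add: integral_distr)
qed

lemma subalgebra_PiM:
  assumes "\<And>i. i \<in> I \<Longrightarrow> subalgebra (M i) (A i)"
  shows "subalgebra (PiM I M) (PiM I A)"
proof -
  have sp: "space (PiM I A) = space (PiM I M)"
    using assms by (auto simp: space_PiM subalgebra_def intro!: PiE_cong)
  have id: "(\<lambda>x. x) \<in> measurable (PiM I M) (PiM I A)"
  proof (rule measurable_PiM_single')
    fix i assume i: "i \<in> I"
    have "(\<lambda>x. x) \<in> measurable (M i) (A i)"
      using assms[OF i] by (auto simp: measurable_def subalgebra_def dest: sets.sets_into_space)
    then show "(\<lambda>x. x i) \<in> measurable (PiM I M) (A i)"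
      using measurable_compose[OF measurable_component_singleton[OF i]] by blast
  qed (use sp in \<open>auto simp: space_PiM\<close>)
  have "S \<inter> space (PiM I M) \<in> sets (PiM I M)" if "S \<in> sets (PiM I A)" for S
    using measurable_sets[OF id that] by (simp add: vimage_ident)
  moreover have "S \<inter> space (PiM I M) = S" if "S \<in> sets (PiM I A)" for S
    using sets.sets_into_space[OF that] sp by auto
  ultimately show ?thesis unfolding subalgebra_def using sp by auto
qed

lemma decorrelated_PiM:
  fixes M :: "'i \<Rightarrow> 'a measure"
  assumes "finite I"
    and "\<And>i. i \<in> I \<Longrightarrow> prob_space (M i)"
    and "\<And>i. i \<in> I \<Longrightarrow> subalgebra (M i) (A i)" "\<And>i. i \<in> I \<Longrightarrow> subalgebra (M i) (B i)"
    and "\<And>i. i \<in> I \<Longrightarrow> decorrelated (M i) (A i) (B i) (r i)" "\<And>i. i \<in> I \<Longrightarrow> 0 \<le> r i"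
  shows "decorrelated (PiM I M) (PiM I A) (PiM I B) (\<Sum>i\<in>I. r i)"
  using assms
proof (induction I rule: finite_induct)
  case empty
  show ?case unfolding decorrelated_def
  proof (intro allI impI)
    fix f g :: "('i \<Rightarrow> 'a) \<Rightarrow> real"
    interpret prob_space "PiM {} M" by (rule prob_space_PiM) auto
    have eq: "(\<integral>x. h x \<partial>PiM {} M) = h (\<lambda>_. undefined)" for h :: "('i \<Rightarrow> 'a) \<Rightarrow> real"
    proof -
      have "(\<integral>x. h x \<partial>PiM {} M) = (\<integral>x. h (\<lambda>_. undefined) \<partial>PiM {} M)"
        by (intro Bochner_Integration.integral_cong) (auto simp: space_PiM)
      then show ?thesis by (simp add: prob_space)
    qed
    show "\<bar>(\<integral>x. f x * g x \<partial>PiM {} M) - (\<integral>x. f x \<partial>PiM {} M) * (\<integral>x. g x \<partial>PiM {} M)\<bar>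
      \<le> (\<Sum>i\<in>{}. r i) * (sqrt (\<integral>x. (f x)\<^sup>2 \<partial>PiM {} M) * sqrt (\<integral>x. (g x)\<^sup>2 \<partial>PiM {} M))"
      unfolding eq by simp
  qed
next
  case (insert j I)
  let ?P = "M j \<Otimes>\<^sub>M PiM I M"
  let ?T = "\<lambda>(x, X). X(j := x)"
  have meas: "?T \<in> measurable (N j \<Otimes>\<^sub>M PiM I N) (PiM (insert j I) N)" for N :: "'i \<Rightarrow> 'a measure"
    by measurable
  have IH: "decorrelated (PiM I M) (PiM I A) (PiM I B) (\<Sum>i\<in>I. r i)"
    using insert by auto
  have "decorrelated ?P (A j \<Otimes>\<^sub>M PiM I A) (B j \<Otimes>\<^sub>M PiM I B) (r j + (\<Sum>i\<in>I. r i))"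
    using insert by (intro decorrelated_pair IH prob_space_PiM subalgebra_PiM sum_nonneg) auto
  then have "decorrelated (distr ?P (PiM (insert j I) M) ?T) (PiM (insert j I) A) (PiM (insert j I) B) (r j + (\<Sum>i\<in>I. r i))"
    using insert by (intro decorrelated_distr[where A'="A j \<Otimes>\<^sub>M PiM I A" and B'="B j \<Otimes>\<^sub>M PiM I B"] meas subalgebra_PiM) auto
  then show ?case using insert by (simp add: distr_pair_PiM_eq_PiM)
qed

lemma measurable_generated_algebra:
  "k \<in> I \<Longrightarrow> X k \<in> borel_measurable (generated_algebra M X I)"
proof (rule measurableI)
  fix B :: "real set" assume k: "k \<in> I" and B: "B \<in> sets borel"
  have "X k -` B \<inter> space M \<in> {X k -` B \<inter> space M | k B. k \<in> I \<and> B \<in> sets (borel :: real measure)}"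
    using k B by blast
  then show "X k -` B \<inter> space (generated_algebra M X I) \<in> sets (generated_algebra M X I)"
    unfolding generated_algebra_def by (subst space_measure_of, blast, subst sets_measure_of) auto
qed auto

lemma subalgebra_generated_algebra:
  assumes "\<And>k. k \<in> I \<Longrightarrow> X k \<in> borel_measurable M"
  shows "subalgebra M (generated_algebra M X I)"
proof -
  have sub: "{X k -` B \<inter> space M | k B. k \<in> I \<and> B \<in> sets (borel :: real measure)} \<subseteq> Pow (space M)" by auto
  have "sigma_sets (space M) {X k -` B \<inter> space M | k B. k \<in> I \<and> B \<in> sets (borel :: real measure)} \<subseteq> sets M"
    by (rule sets.sigma_sets_subset) (use assms in \<open>auto simp: measurable_sets\<close>)
  then show ?thesis
    unfolding subalgebra_def generated_algebra_def using sub by (simp add: space_measure_of sets_measure_of)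
qed

lemma (in prob_space) cov_eq:
  assumes f: "f \<in> borel_measurable M" "integrable M (\<lambda>x. (f x)\<^sup>2)"
    and g: "g \<in> borel_measurable M" "integrable M (\<lambda>x. (g x)\<^sup>2)"
  shows "cov M f g = (\<integral>x. f x * g x \<partial>M) - (\<integral>x. f x \<partial>M) * (\<integral>x. g x \<partial>M)"
proof -
  define a b where "a = (\<integral>x. f x \<partial>M)" and "b = (\<integral>x. g x \<partial>M)"
  have i: "integrable M f" "integrable M g" "integrable M (\<lambda>x. f x * g x)"
    using square_integrable_imp_integrable f g cauchy_schwarz_integral(1)[of f M g] by auto
  have "cov M f g = (\<integral>x. f x * g x - b * f x - a * g x + a * b \<partial>M)"
    unfolding cov_def a_def[symmetric] b_def[symmetric] by (simp add: algebra_simps)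
  also have "\<dots> = (\<integral>x. f x * g x \<partial>M) - b * a - a * b + a * b"
    using i by (simp add: prob_space a_def b_def)
  finally show ?thesis by (simp add: a_def b_def)
qed

lemma (in prob_space) abs_cov_le:
  assumes f: "f \<in> borel_measurable M" "integrable M (\<lambda>x. (f x)\<^sup>2)"
    and g: "g \<in> borel_measurable M" "integrable M (\<lambda>x. (g x)\<^sup>2)"
  shows "\<bar>cov M f g\<bar> \<le> sqrt (cov M f f * cov M g g)" "0 \<le> cov M f f" "cov M f f \<le> (\<integral>x. (f x)\<^sup>2 \<partial>M)"
proof -
  have sq: "integrable M (\<lambda>x. (h x - c)\<^sup>2)"
    if "h \<in> borel_measurable M" "integrable M (\<lambda>x. (h x)\<^sup>2)" for h and c :: real
    using square_integrable_imp_integrable[OF that] that by (simp add: power2_diff)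
  show "\<bar>cov M f g\<bar> \<le> sqrt (cov M f f * cov M g g)"
    using cauchy_schwarz_integral(2)[OF _ _ sq[OF f, of "\<integral>x. f x \<partial>M"] sq[OF g, of "\<integral>x. g x \<partial>M"]] f g
    unfolding cov_def by (simp add: power2_eq_square real_sqrt_mult)
  show "0 \<le> cov M f f" unfolding cov_def by simp
  show "cov M f f \<le> (\<integral>x. (f x)\<^sup>2 \<partial>M)"
    using cov_eq[OF f f] by (simp add: power2_eq_square[symmetric])
qed

text \<open>
  The supremum in the mixing coefficient is over a set of numbers in \<open>[0, 1]\<close> that contains the
  correlation of two constants, so it is nonnegative and bounds every correlation.
\<close>

lemma (in prob_space) rho_coeff_props:
  assumes rv: "\<And>k. 1 \<le> k \<Longrightarrow> X k \<in> borel_measurable M"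
  shows "0 \<le> rho_coeff M X r"
    and "1 \<le> k \<Longrightarrow> decorrelated M (generated_algebra M X {1..k}) (generated_algebra M X {k+r..}) (rho_coeff M X r)"
proof -
  let ?S = "{\<bar>corr M f g\<bar> | k f g. 1 \<le> k
            \<and> f \<in> square_integrable_wrt M (generated_algebra M X {1..k})
            \<and> g \<in> square_integrable_wrt M (generated_algebra M X {k + r..})}"
  have s: "subalgebra M (generated_algebra M X {1..k})" "subalgebra M (generated_algebra M X {k+r..})" if "1 \<le> k" for k
    using that by (intro subalgebra_generated_algebra rv; simp)+
  have rvf: "f \<in> borel_measurable M \<and> integrable M (\<lambda>x. (f x)\<^sup>2)"
    if "1 \<le> k" "f \<in> square_integrable_wrt M (generated_algebra M X {1..k})
      \<or> f \<in> square_integrable_wrt M (generated_algebra M X {k + r..})" for k f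
    using that(2) measurable_from_subalg[OF s(1)[OF that(1)], of f borel]
      measurable_from_subalg[OF s(2)[OF that(1)], of f borel]
    unfolding square_integrable_wrt_def mem_Collect_eq by blast
  have le1: "x \<le> 1" if xS: "x \<in> ?S" for x
  proof -
    obtain k f g where x: "x = \<bar>corr M f g\<bar>" "1 \<le> k" "f \<in> square_integrable_wrt M (generated_algebra M X {1..k})"
      "g \<in> square_integrable_wrt M (generated_algebra M X {k + r..})" using xS by blast
    have fg: "f \<in> borel_measurable M" "integrable M (\<lambda>x. (f x)\<^sup>2)" "g \<in> borel_measurable M" "integrable M (\<lambda>x. (g x)\<^sup>2)"
      using rvf[OF x(2)] x(3,4) by auto
    show ?thesis using abs_cov_le(1)[OF fg] unfolding x corr_def
      by (cases "sqrt (cov M f f * cov M g g) = 0") (auto simp: abs_le_iff divide_le_eq)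
  qed
  have bdd: "bdd_above ?S" using le1 by (intro bdd_aboveI) blast
  have z: "(\<lambda>_. 0) \<in> square_integrable_wrt M F" for F unfolding square_integrable_wrt_def by simp
  have "\<bar>corr M (\<lambda>_. 0) (\<lambda>_. 0)\<bar> \<in> ?S" using z by blast
  then have "\<bar>corr M (\<lambda>_. 0) (\<lambda>_. 0)\<bar> \<le> rho_coeff M X r"
    unfolding rho_coeff_def by (rule cSup_upper[OF _ bdd])
  then show nn: "0 \<le> rho_coeff M X r" by linarith
  assume k: "1 \<le> k"
  show "decorrelated M (generated_algebra M X {1..k}) (generated_algebra M X {k+r..}) (rho_coeff M X r)"
    unfolding decorrelated_def
  proof (intro allI impI)
    fix f g assume f: "f \<in> square_integrable_wrt M (generated_algebra M X {1..k})"
      and g: "g \<in> square_integrable_wrt M (generated_algebra M X {k + r..})"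
    have fg: "f \<in> borel_measurable M" "integrable M (\<lambda>x. (f x)\<^sup>2)" "g \<in> borel_measurable M" "integrable M (\<lambda>x. (g x)\<^sup>2)"
      using rvf[OF k] f g by auto
    have "\<bar>corr M f g\<bar> \<in> ?S" using k f g by blast
    then have c: "\<bar>corr M f g\<bar> \<le> rho_coeff M X r" unfolding rho_coeff_def by (rule cSup_upper[OF _ bdd])
    note ac = abs_cov_le[OF fg] abs_cov_le(2,3)[OF fg(3,4) fg(1,2)]
    have "\<bar>cov M f g\<bar> = \<bar>corr M f g\<bar> * sqrt (cov M f f * cov M g g)"
      unfolding corr_def using ac by (cases "sqrt (cov M f f * cov M g g) = 0") (auto simp: abs_mult)
    also have "\<dots> \<le> rho_coeff M X r * (sqrt (\<integral>x. (f x)\<^sup>2 \<partial>M) * sqrt (\<integral>x. (g x)\<^sup>2 \<partial>M))"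
      using c nn ac unfolding real_sqrt_mult by (intro mult_mono) auto
    finally show "\<bar>(\<integral>x. f x * g x \<partial>M) - (\<integral>x. f x \<partial>M) * (\<integral>x. g x \<partial>M)\<bar>
      \<le> rho_coeff M X r * (sqrt (\<integral>x. (f x)\<^sup>2 \<partial>M) * sqrt (\<integral>x. (g x)\<^sup>2 \<partial>M))"
      using cov_eq[OF fg] by simp
  qed
qed

section \<open>A central limit theorem for \<rho>-mixing sequences\<close>

text \<open>
  The mixed terms \<open>a^3 b\<close> are avoided on purpose: \<open>a^3\<close> need not be square integrable, whereas the
  expectation of \<open>a\<^sup>2 b\<^sup>2\<close> factorises approximately for decorrelated blocks.
\<close>

lemma pow4_add_le:
  fixes a b :: real
  shows "(a + b)^4 \<le> 11/10 * (a^4 + b^4) + 86 * (a\<^sup>2 * b\<^sup>2)"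
proof -
  have "11/10 * (a^4 + b^4) + 86 * (a\<^sup>2 * b\<^sup>2) - (a + b)^4
      = 1/10 * (a\<^sup>2 - 20 * a * b)\<^sup>2 + 1/10 * (b\<^sup>2 - 20 * a * b)\<^sup>2"
    by (simp add: power2_eq_square power4_eq_xxxx algebra_simps)
  also have "\<dots> \<ge> 0" by simp
  finally show ?thesis by simp
qed

text \<open>
  The first constant is chosen close to 1, for the main block; the second one, for a gap
  of bounded length, may be large.
\<close>

lemma pow4_add_le':
  fixes a b :: real
  shows "(a + b)^4 \<le> 12/10 * a^4 + 18492 * b^4"
proof -
  have "1/10 * a^4 + 18490 * b^4 - 86 * (a\<^sup>2 * b\<^sup>2) = 1/10 * (a\<^sup>2 - 430 * b\<^sup>2)\<^sup>2"
    by (simp add: power2_eq_square power4_eq_xxxx algebra_simps)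
  also have "\<dots> \<ge> 0" by simp
  finally have "86 * (a\<^sup>2 * b\<^sup>2) \<le> 1/10 * a^4 + 18490 * b^4" by simp
  moreover have "0 \<le> b^4" by simp
  ultimately show ?thesis using pow4_add_le[of a b] unfolding distrib_left by linarith
qed

text \<open>
  Real and imaginary parts are sums of four products of sines and cosines, each of them decorrelated.
\<close>

lemma decorrelated_iexp:
  assumes M: "prob_space M" and sA: "subalgebra M A" and sB: "subalgebra M B"
    and d: "decorrelated M A B r" and r: "0 \<le> r"
    and u: "u \<in> borel_measurable A" and w: "w \<in> borel_measurable B"
  shows "cmod ((\<integral>x. iexp (u x + w x) \<partial>M) - (\<integral>x. iexp (u x) \<partial>M) * (\<integral>x. iexp (w x) \<partial>M)) \<le> 4 * r"
proof -
  interpret prob_space M by fact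
  have [measurable]: "u \<in> borel_measurable M" "w \<in> borel_measurable M"
    using measurable_from_subalg sA sB u w by auto
  define D where "D f g = (\<integral>x. f (u x) * g (w x) \<partial>M) - (\<integral>x. f (u x) \<partial>M) * (\<integral>x. g (w x) \<partial>M)" for f g :: "real \<Rightarrow> real"
  have bd: "\<bar>D f g\<bar> \<le> r" if f: "f = cos \<or> f = sin" and g: "g = cos \<or> g = sin" for f g
  proof -
    have [measurable]: "f \<in> borel_measurable borel" "g \<in> borel_measurable borel" using f g by auto
    have le: "(f x)\<^sup>2 \<le> 1" "(g x)\<^sup>2 \<le> 1" for x
      using f g by (auto simp: abs_square_le_1)
    have i: "integrable M (\<lambda>x. (f (u x))\<^sup>2)" "integrable M (\<lambda>x. (g (w x))\<^sup>2)"
      by (rule integrable_const_bound[of _ 1]; use le in simp)+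
    have "(\<integral>x. (f (u x))\<^sup>2 \<partial>M) \<le> (\<integral>x. 1 \<partial>M)" "(\<integral>x. (g (w x))\<^sup>2 \<partial>M) \<le> (\<integral>x. 1 \<partial>M)"
      by (rule integral_mono; use i le in simp)+
    then have l: "(\<integral>x. (f (u x))\<^sup>2 \<partial>M) \<le> 1" "(\<integral>x. (g (w x))\<^sup>2 \<partial>M) \<le> 1" by (simp_all add: prob_space)
    have "\<bar>D f g\<bar> \<le> r * (sqrt (\<integral>x. (f (u x))\<^sup>2 \<partial>M) * sqrt (\<integral>x. (g (w x))\<^sup>2 \<partial>M))" unfolding D_def
      by (rule decorrelatedD[OF d]) (use measurable_compose[OF u, of f] measurable_compose[OF w, of g] i in auto)
    also have "\<dots> \<le> r * (1 * 1)" using l r by (intro mult_left_mono mult_mono) auto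
    finally show ?thesis by simp
  qed
  have int: "integrable M (\<lambda>x. f (u x) * g (w x))" "integrable M (\<lambda>x. f (u x))" "integrable M (\<lambda>x. g (w x))"
    if f: "f = cos \<or> f = sin" and g: "g = cos \<or> g = sin" for f g :: "real \<Rightarrow> real"
    using f g by (auto intro!: integrable_const_bound[of _ 1] simp: abs_mult mult_le_one)
  have e: "(\<integral>x. iexp (h x) \<partial>M) = Complex (\<integral>x. cos (h x) \<partial>M) (\<integral>x. sin (h x) \<partial>M)"
    if [measurable]: "h \<in> borel_measurable M" for h
  proof -
    have "integrable M (\<lambda>x. iexp (h x))" by (rule integrable_const_bound[of _ 1]) auto
    then show ?thesis
      by (simp add: complex_eq_iff integral_Re[symmetric] integral_Im[symmetric] Re_exp Im_exp
           flip: cis_conv_exp)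
  qed
  have eq: "(\<integral>x. iexp (u x + w x) \<partial>M) - (\<integral>x. iexp (u x) \<partial>M) * (\<integral>x. iexp (w x) \<partial>M)
      = Complex (D cos cos - D sin sin) (D sin cos + D cos sin)"
  proof -
    have "(\<integral>x. cos (u x + w x) \<partial>M) = (\<integral>x. cos (u x) * cos (w x) \<partial>M) - (\<integral>x. sin (u x) * sin (w x) \<partial>M)"
      unfolding cos_add by (intro Bochner_Integration.integral_diff int) auto
    moreover have "(\<integral>x. sin (u x + w x) \<partial>M) = (\<integral>x. sin (u x) * cos (w x) \<partial>M) + (\<integral>x. cos (u x) * sin (w x) \<partial>M)"
      unfolding sin_add by (intro Bochner_Integration.integral_add int) auto
    ultimately show ?thesis
      unfolding D_def e[OF \<open>u \<in> borel_measurable M\<close>] e[OF \<open>w \<in> borel_measurable M\<close>]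
        e[OF borel_measurable_add[OF \<open>u \<in> borel_measurable M\<close> \<open>w \<in> borel_measurable M\<close>]]
      by (intro complex_eqI) simp_all
  qed
  have "cmod (Complex (D cos cos - D sin sin) (D sin cos + D cos sin)) \<le> \<bar>D cos cos - D sin sin\<bar> + \<bar>D sin cos + D cos sin\<bar>"
    using cmod_le[of "Complex (D cos cos - D sin sin) (D sin cos + D cos sin)"] by (simp only: complex.sel)
  also have "\<dots> \<le> \<bar>D cos cos\<bar> + \<bar>D sin sin\<bar> + \<bar>D sin cos\<bar> + \<bar>D cos sin\<bar>"
    using abs_triangle_ineq4[of "D cos cos" "D sin sin"] abs_triangle_ineq[of "D sin cos" "D cos sin"] by simp
  also have "\<dots> \<le> r + r + r + r" by (intro add_mono bd) auto
  also have "\<dots> = 4 * r" by simp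
  finally show ?thesis unfolding eq .
qed

text \<open>
  The \<open>\<sigma>\<close>-algebras of the past and the future are parameters, because for functions of several independent
  sequences the natural choice is the product of the individual pasts and futures. Of
  stationarity only the laws of the block sums matter.
\<close>

locale mixing_sequence = prob_space M for M :: "'a measure" +
  fixes Z :: "nat \<Rightarrow> 'a \<Rightarrow> real" and A B :: "nat \<Rightarrow> 'a measure" and r :: "nat \<Rightarrow> real" and \<kappa> :: real
  assumes sub: "\<And>k. 1 \<le> k \<Longrightarrow> subalgebra M (A k)" "\<And>k. 1 \<le> k \<Longrightarrow> subalgebra M (B k)"
    and past: "\<And>j k. 1 \<le> j \<Longrightarrow> j \<le> k \<Longrightarrow> Z j \<in> borel_measurable (A k)"
    and future: "\<And>j k. 1 \<le> k \<Longrightarrow> k \<le> j \<Longrightarrow> Z j \<in> borel_measurable (B k)"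
    and decorr: "\<And>k g. 1 \<le> k \<Longrightarrow> decorrelated M (A k) (B (k + g)) (r g)"
    and r_nonneg: "\<And>g. 0 \<le> r g" and r_tendsto: "r \<longlonglongrightarrow> 0"
    and moment4: "\<And>k. 1 \<le> k \<Longrightarrow> integrable M (\<lambda>\<omega>. Z k \<omega> ^ 4)"
    and mean: "\<And>k. 1 \<le> k \<Longrightarrow> (\<integral>\<omega>. Z k \<omega> \<partial>M) = 0"
    and block_law: "\<And>h p. distr M borel (\<lambda>\<omega>. \<Sum>k\<in>{h<..h+p}. Z k \<omega>) = distr M borel (\<lambda>\<omega>. \<Sum>k\<in>{0<..p}. Z k \<omega>)"
    and var_lim: "(\<lambda>p. (\<integral>\<omega>. (\<Sum>k\<in>{0<..p}. Z k \<omega>)\<^sup>2 \<partial>M) / real p) \<longlonglongrightarrow> \<kappa>"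
begin

definition S :: "nat \<Rightarrow> nat \<Rightarrow> 'a \<Rightarrow> real" where
  "S h p \<omega> = (\<Sum>k\<in>{h<..h+p}. Z k \<omega>)"

lemma S_0 [simp]: "S h 0 \<omega> = 0" by (simp add: S_def)

lemma S_add: "S h (p + q) \<omega> = S h p \<omega> + S (h + p) q \<omega>"
proof -
  have "{h<..h+(p+q)} = {h<..h+p} \<union> {h+p<..h+p+q}" by auto
  then show ?thesis unfolding S_def by (simp add: sum.union_disjoint)
qed

lemma S_Suc: "S h (Suc p) \<omega> = S h p \<omega> + Z (Suc (h + p)) \<omega>"
  using S_add[of h p 1 \<omega>] by (simp add: S_def[of "h+p"] flip: atLeastSucAtMost_greaterThanAtMost)

lemma S_past: "1 \<le> k \<Longrightarrow> h + p \<le> k \<Longrightarrow> S h p \<in> borel_measurable (A k)"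
  unfolding S_def[abs_def] by (intro borel_measurable_sum past) auto

lemma S_future: "1 \<le> k \<Longrightarrow> k \<le> Suc h \<Longrightarrow> S h p \<in> borel_measurable (B k)"
  unfolding S_def[abs_def] by (intro borel_measurable_sum future) auto

lemma S_rv[measurable]: "S h p \<in> borel_measurable M"
  using measurable_from_subalg[OF sub(2) S_future[of 1 h p]] by simp

lemma Z_rv: "1 \<le> k \<Longrightarrow> Z k \<in> borel_measurable M"
  using measurable_from_subalg[OF sub(1) past[of k k]] by simp

lemma S_shift:
  fixes \<phi> :: "real \<Rightarrow> 'c::{banach, second_countable_topology}"
  assumes [measurable]: "\<phi> \<in> borel_measurable borel"
  shows "(\<integral>\<omega>. \<phi> (S h p \<omega>) \<partial>M) = (\<integral>\<omega>. \<phi> (S 0 p \<omega>) \<partial>M)"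
proof -
  have "(\<integral>x. \<phi> x \<partial>distr M borel (S h p)) = (\<integral>x. \<phi> x \<partial>distr M borel (S 0 p))"
    using block_law[of h p] by (simp add: S_def[abs_def])
  then show ?thesis by (simp add: integral_distr)
qed

lemma S_moment4: "integrable M (\<lambda>\<omega>. S h p \<omega> ^ 4)"
proof (induction p)
  case (Suc p)
  have [measurable]: "Z (Suc (h + p)) \<in> borel_measurable M" by (rule Z_rv) simp
  show ?case
  proof (rule Bochner_Integration.integrable_bound)
    show "integrable M (\<lambda>\<omega>. 12/10 * S h p \<omega> ^ 4 + 18492 * Z (Suc (h + p)) \<omega> ^ 4)"
      using Suc moment4[of "Suc (h + p)"] by simp
    show "AE \<omega> in M. norm (S h (Suc p) \<omega> ^ 4) \<le> norm (12/10 * S h p \<omega> ^ 4 + 18492 * Z (Suc (h + p)) \<omega> ^ 4)"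
      using pow4_add_le' by (auto simp: S_Suc)
  qed measurable
qed simp

lemma S_moment2: "integrable M (\<lambda>\<omega>. (S h p \<omega>)\<^sup>2)"
  by (rule square_integrable_imp_integrable) (use S_moment4 in \<open>auto simp flip: power_mult\<close>)

lemma S_integrable: "integrable M (S h p)"
  by (rule square_integrable_imp_integrable) (use S_moment2 in auto)

lemma S_mean: "(\<integral>\<omega>. S h p \<omega> \<partial>M) = 0"
proof (induction p)
  case (Suc p)
  have "integrable M (\<lambda>\<omega>. (Z (Suc (h + p)) \<omega>)\<^sup>2)"
    by (rule square_integrable_imp_integrable)
       (use moment4[of "Suc (h + p)"] Z_rv[of "Suc (h+p)"] in \<open>auto simp flip: power_mult\<close>)
  then have "integrable M (Z (Suc (h + p)))"
    by (rule square_integrable_imp_integrable[rotated]) (use Z_rv[of "Suc (h+p)"] in auto)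
  then show ?case using Suc mean[of "Suc (h + p)"] S_integrable by (simp add: S_Suc)
qed simp

definition block_var :: "nat \<Rightarrow> real" where "block_var p = (\<integral>\<omega>. (S 0 p \<omega>)\<^sup>2 \<partial>M)"

definition block_moment4 :: "nat \<Rightarrow> real" where "block_moment4 p = (\<integral>\<omega>. S 0 p \<omega> ^ 4 \<partial>M)"

lemma block_var_nonneg: "0 \<le> block_var p" and block_moment4_nonneg: "0 \<le> block_moment4 p" by (auto simp: block_var_def block_moment4_def)

lemma block_var_tendsto: "(\<lambda>p. block_var p / real p) \<longlonglongrightarrow> \<kappa>"
  using var_lim by (simp add: block_var_def S_def)

lemma variance_linear: obtains K where "0 < K" "\<And>p. block_var p \<le> K * real p"
proof -
  have "Bseq (\<lambda>p. block_var p / real p)" using block_var_tendsto by (rule convergentI[THEN convergent_imp_Bseq])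
  then obtain K where K: "0 < K" "\<And>p. norm (block_var p / real p) \<le> K" unfolding Bseq_def by blast
  have "block_var p \<le> K * real p" for p
  proof (cases "p = 0")
    case True then show ?thesis by (simp add: block_var_def)
  next
    case False then show ?thesis using K(2)[of p] block_var_nonneg[of p] by (simp add: divide_le_eq)
  qed
  then show ?thesis using that K by blast
qed

text \<open>
  Two blocks of length \<open>p\<close> separated by a gap of length \<open>q\<close>. If the mixing coefficient at the gap is
  small, the factor 3 stays below 4, which is the growth allowed for a quadratic bound. The threshold \<open>1/300\<close> is
  chosen so that \<open>12/10 * (22/10 + 86/300) < 3\<close>.
\<close>

lemma fourth_moment_doubling:
  assumes p: "1 \<le> p" and r: "r (Suc q) \<le> 1/300"
  shows "block_moment4 (2 * p + q) \<le> 3 * block_moment4 p + 104 * (block_var p)\<^sup>2 + 18492 * block_moment4 q"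
proof -
  let ?a = "S 0 p" and ?g = "S p q" and ?b = "S (p + q) p"
  have e: "S 0 (2 * p + q) \<omega> = (?a \<omega> + ?b \<omega>) + ?g \<omega>" for \<omega>
  proof -
    have eq: "2 * p + q = (p + q) + p" by simp
    show ?thesis unfolding eq using S_add[of 0 "p + q" p \<omega>] S_add[of 0 p q \<omega>] by simp
  qed
  have ex: "(\<integral>\<omega>. S h p' \<omega> ^ 4 \<partial>M) = block_moment4 p'" "(\<integral>\<omega>. (S h p' \<omega>)\<^sup>2 \<partial>M) = block_var p'" for h p'
    unfolding block_moment4_def block_var_def by (rule S_shift, simp)+
  have iab: "integrable M (\<lambda>\<omega>. (?a \<omega>)\<^sup>2 * (?b \<omega>)\<^sup>2)"
    by (rule cauchy_schwarz_integral) (use S_moment4 in \<open>auto simp flip: power_mult\<close>)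
  have iab4: "integrable M (\<lambda>\<omega>. (?a \<omega> + ?b \<omega>)^4)"
    by (rule Bochner_Integration.integrable_bound[of M "\<lambda>\<omega>. 11/10 * (?a \<omega>^4 + ?b \<omega>^4) + 86 * ((?a \<omega>)\<^sup>2 * (?b \<omega>)\<^sup>2)"])
       (use pow4_add_le iab S_moment4 in auto)
  have "\<bar>(\<integral>\<omega>. (?a \<omega>)\<^sup>2 * (?b \<omega>)\<^sup>2 \<partial>M) - (\<integral>\<omega>. (?a \<omega>)\<^sup>2 \<partial>M) * (\<integral>\<omega>. (?b \<omega>)\<^sup>2 \<partial>M)\<bar>
      \<le> r (Suc q) * (sqrt (\<integral>\<omega>. ((?a \<omega>)\<^sup>2)\<^sup>2 \<partial>M) * sqrt (\<integral>\<omega>. ((?b \<omega>)\<^sup>2)\<^sup>2 \<partial>M))"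
    by (rule decorrelatedD[OF decorr[OF p]])
       (use S_past[of p 0 p] S_future[of "p + Suc q" "p + q" p] p S_moment4 in \<open>auto simp flip: power_mult\<close>)
  also have "\<dots> = r (Suc q) * block_moment4 p" using ex block_moment4_nonneg[of p] by (simp flip: power_mult)
  also have "\<dots> \<le> 1/300 * block_moment4 p" using r block_moment4_nonneg by (rule mult_right_mono)
  finally have ab: "(\<integral>\<omega>. (?a \<omega>)\<^sup>2 * (?b \<omega>)\<^sup>2 \<partial>M) \<le> (block_var p)\<^sup>2 + 1/300 * block_moment4 p"
    unfolding ex power2_eq_square[of "block_var p"] by linarith
  have "(\<integral>\<omega>. (?a \<omega> + ?b \<omega>)^4 \<partial>M) \<le> (\<integral>\<omega>. 11/10 * (?a \<omega>^4 + ?b \<omega>^4) + 86 * ((?a \<omega>)\<^sup>2 * (?b \<omega>)\<^sup>2) \<partial>M)"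
    by (rule integral_mono) (use iab iab4 S_moment4 pow4_add_le in auto)
  also have "\<dots> = 11/10 * (block_moment4 p + block_moment4 p) + 86 * (\<integral>\<omega>. (?a \<omega>)\<^sup>2 * (?b \<omega>)\<^sup>2 \<partial>M)"
    using iab S_moment4 ex by simp
  finally have 1: "(\<integral>\<omega>. (?a \<omega> + ?b \<omega>)^4 \<partial>M) \<le> 5/2 * block_moment4 p + 86 * (block_var p)\<^sup>2"
    using ab block_moment4_nonneg[of p] by simp
  have "block_moment4 (2 * p + q) = (\<integral>\<omega>. ((?a \<omega> + ?b \<omega>) + ?g \<omega>)^4 \<partial>M)" unfolding block_moment4_def e ..
  also have "\<dots> \<le> (\<integral>\<omega>. 12/10 * (?a \<omega> + ?b \<omega>)^4 + 18492 * ?g \<omega>^4 \<partial>M)"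
  proof (rule integral_mono)
    show "integrable M (\<lambda>\<omega>. ((?a \<omega> + ?b \<omega>) + ?g \<omega>)^4)"
      using S_moment4[of 0 "2 * p + q"] unfolding e .
  qed (use iab4 S_moment4 pow4_add_le' in auto)
  also have "\<dots> = 12/10 * (\<integral>\<omega>. (?a \<omega> + ?b \<omega>)^4 \<partial>M) + 18492 * block_moment4 q"
    using iab4 S_moment4 ex by simp
  finally show ?thesis using 1 zero_le_power2[of "block_var p"] by linarith
qed

text \<open>
  Doubling the length multiplies the bound by 4 but the fourth moment only by 3, up to
  terms that are quadratic in the length because the variance is linear. The gap is fixed once and for all.
\<close>

lemma fourth_moment_quadratic: obtains C where "0 < C" "\<And>p. block_moment4 p \<le> C * (real p)\<^sup>2"
proof -
  obtain K where K: "0 < K" "\<And>p. block_var p \<le> K * real p" using variance_linear by blast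
  have "\<forall>\<^sub>F g in sequentially. r g < 1/300" by (rule order_tendstoD(2)[OF r_tendsto]) simp
  then obtain g where g: "\<And>q. q \<ge> g \<Longrightarrow> r q < 1/300" unfolding eventually_sequentially by blast
  define X where "X = (\<Sum>q\<le>g+3. block_moment4 q)"
  have X: "block_moment4 q \<le> X" if "q \<le> g + 3" for q
    unfolding X_def by (rule member_le_sum) (use that block_moment4_nonneg in auto)
  have X0: "0 \<le> X" unfolding X_def by (intro sum_nonneg block_moment4_nonneg)
  define C where "C = 104 * K\<^sup>2 + 18492 * X"
  have C0: "0 < C" using K X0 unfolding C_def by (simp add: add_pos_nonneg)
  have CX: "X \<le> C" using X0 zero_le_power2[of K] unfolding C_def by linarith
  have "block_moment4 n \<le> C * (real n)\<^sup>2" for n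
  proof (induction n rule: less_induct)
    case (less n)
    show ?case
    proof (cases "n \<le> g + 3")
      case True
      show ?thesis
      proof (cases "n = 0")
        case True then show ?thesis by (simp add: block_moment4_def)
      next
        case False
        have "C * 1 \<le> C * (real n)\<^sup>2" using C0 False by (intro mult_left_mono) (auto simp: one_le_power)
        then show ?thesis using X[OF True] CX by linarith
      qed
    next
      case False
      \<comment> \<open>The two halves are separated by a gap of length \<open>g\<close> or \<open>g + 1\<close>, according to parity.\<close>
      define p where "p = (n - g) div 2"
      define q where "q = n - 2 * p"
      have p: "1 \<le> p" "p < n" "n = 2 * p + q" "g \<le> q" "q \<le> g + 1" using False unfolding p_def q_def by auto
      have "block_moment4 n \<le> 3 * block_moment4 p + 104 * (block_var p)\<^sup>2 + 18492 * block_moment4 q"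
        unfolding p(3) using fourth_moment_doubling[of p q] p(1) less_imp_le[OF g[of "Suc q"]] p(4) by auto
      also have "\<dots> \<le> 3 * (C * (real p)\<^sup>2) + 104 * (K * real p)\<^sup>2 + 18492 * X"
        using less[OF p(2)] K(2)[of p] block_var_nonneg[of p] X[of q] p(5)
        by (intro add_mono mult_left_mono power_mono) auto
      also have "\<dots> \<le> 3 * (C * (real p)\<^sup>2) + 104 * (K\<^sup>2 * (real p)\<^sup>2) + 18492 * (X * (real p)\<^sup>2)"
        using p(1) mult_left_mono[of 1 "(real p)\<^sup>2" X] X0 by (simp add: power_mult_distrib one_le_power)
      also have "\<dots> = C * (2 * real p)\<^sup>2" unfolding C_def by (simp add: algebra_simps power2_eq_square)
      also have "\<dots> \<le> C * (real n)\<^sup>2" using C0 p by (intro mult_left_mono power_mono) auto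
      finally show ?thesis .
    qed
  qed
  then show ?thesis using that C0 by blast
qed

text \<open>
  Cauchy-Schwarz between the second and the fourth moment.
\<close>

lemma third_moment: obtains K where "0 < K" "\<And>p. (\<integral>\<omega>. \<bar>S 0 p \<omega>\<bar>^3 \<partial>M) \<le> K * (real p * sqrt (real p))"
    "\<And>p. integrable M (\<lambda>\<omega>. \<bar>S 0 p \<omega>\<bar>^3)"
proof -
  obtain K where K: "0 < K" "\<And>p. block_var p \<le> K * real p" using variance_linear by blast
  obtain C where C: "0 < C" "\<And>p. block_moment4 p \<le> C * (real p)\<^sup>2" using fourth_moment_quadratic by blast
  have eq: "\<bar>S 0 p \<omega>\<bar>^3 = \<bar>S 0 p \<omega>\<bar> * (S 0 p \<omega>)\<^sup>2" for p \<omega>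
    by (simp add: power3_eq_cube power2_eq_square)
  have i: "integrable M (\<lambda>\<omega>. \<bar>S 0 p \<omega>\<bar>^3)" for p
    unfolding eq by (rule cauchy_schwarz_integral) (use S_moment2 S_moment4 in \<open>auto simp flip: power_mult\<close>)
  have "(\<integral>\<omega>. \<bar>S 0 p \<omega>\<bar>^3 \<partial>M) \<le> sqrt (K * C) * (real p * sqrt (real p))" for p
  proof -
    have "(\<integral>\<omega>. \<bar>S 0 p \<omega>\<bar>^3 \<partial>M) \<le> sqrt (\<integral>\<omega>. \<bar>S 0 p \<omega>\<bar>\<^sup>2 \<partial>M) * sqrt (\<integral>\<omega>. ((S 0 p \<omega>)\<^sup>2)\<^sup>2 \<partial>M)"
      using cauchy_schwarz_integral(2)[of "\<lambda>\<omega>. \<bar>S 0 p \<omega>\<bar>" M "\<lambda>\<omega>. (S 0 p \<omega>)\<^sup>2"] S_moment2 S_moment4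
      unfolding eq by (auto simp flip: power_mult)
    also have "\<dots> = sqrt (block_var p) * sqrt (block_moment4 p)" by (simp add: block_var_def block_moment4_def flip: power_mult)
    also have "\<dots> \<le> sqrt (K * real p) * sqrt (C * (real p)\<^sup>2)"
      using K C block_var_nonneg block_moment4_nonneg by (intro mult_mono real_sqrt_le_mono) auto
    also have "\<dots> = sqrt (K * C) * (real p * sqrt (real p))"
      by (simp add: real_sqrt_mult)
    finally show ?thesis .
  qed
  moreover have "0 < sqrt (K * C)" using K C by simp
  ultimately show ?thesis using that i by blast
qed

definition \<phi> :: "nat \<Rightarrow> real \<Rightarrow> complex" where
  "\<phi> p s = (\<integral>\<omega>. iexp (s * S 0 p \<omega>) \<partial>M)"

lemma \<phi>_eq_char: "\<phi> p s = char (distr M borel (S 0 p)) s"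
  unfolding \<phi>_def char_def by (simp add: integral_distr)

lemma cmod_\<phi>: "cmod (\<phi> p s) \<le> 1"
  unfolding \<phi>_eq_char by (rule real_distribution.cmod_char_le_1[OF real_distribution_distr]) simp

text \<open>
  Second order expansion of the characteristic function at a block sum; the error is
  controlled by the third absolute moment, uniformly in the block length.
\<close>

lemma \<phi>_expansion: obtains K where "0 < K"
    "\<And>p s. cmod (\<phi> p s - (1 - s\<^sup>2 * block_var p / 2)) \<le> K * \<bar>s\<bar>^3 * (real p * sqrt (real p))"
proof -
  obtain K where K: "0 < K" "\<And>p. (\<integral>\<omega>. \<bar>S 0 p \<omega>\<bar>^3 \<partial>M) \<le> K * (real p * sqrt (real p))"
    "\<And>p. integrable M (\<lambda>\<omega>. \<bar>S 0 p \<omega>\<bar>^3)" using third_moment by blast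
  have "cmod (\<phi> p s - (1 - s\<^sup>2 * block_var p / 2)) \<le> K * \<bar>s\<bar>^3 * (real p * sqrt (real p))" for p s
  proof -
    have "cmod (\<phi> p s - (1 - s\<^sup>2 * block_var p / 2)) \<le> (s\<^sup>2 / 6) * expectation (\<lambda>x. min (6 * (S 0 p x)\<^sup>2) (\<bar>s\<bar> * \<bar>S 0 p x\<bar>^3))"
      unfolding \<phi>_eq_char
    proof (rule char_approx3'[OF S_rv S_integrable S_moment2 S_mean _ refl])
      show "variance (S 0 p) = block_var p" by (simp add: block_var_def S_mean)
    qed
    also have "\<dots> \<le> (s\<^sup>2 / 6) * expectation (\<lambda>x. \<bar>s\<bar> * \<bar>S 0 p x\<bar>^3)"
      by (intro mult_left_mono integral_mono integrable_min) (use K S_moment2 in auto)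
    also have "\<dots> = (s\<^sup>2 / 6) * (\<bar>s\<bar> * (\<integral>\<omega>. \<bar>S 0 p \<omega>\<bar>^3 \<partial>M))" by simp
    also have "\<dots> \<le> (s\<^sup>2 / 6) * (\<bar>s\<bar> * (K * (real p * sqrt (real p))))"
      using K by (intro mult_left_mono) auto
    also have "\<dots> = 1/6 * (K * \<bar>s\<bar>^3 * (real p * sqrt (real p)))"
      by (simp add: power3_eq_cube power2_eq_square[of s] algebra_simps flip: abs_mult)
    also have "\<dots> \<le> 1 * (K * \<bar>s\<bar>^3 * (real p * sqrt (real p)))"
      using K(1) by (intro mult_right_mono) auto
    finally show ?thesis by simp
  qed
  then show ?thesis using that K(1) by blast
qed

text \<open>
  The sum over \<open>J\<close> blocks of length \<open>p\<close>, each followed by an omitted gap of length \<open>g\<close>.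
\<close>

definition big :: "nat \<Rightarrow> nat \<Rightarrow> nat \<Rightarrow> 'a \<Rightarrow> real" where
  "big p g J \<omega> = (\<Sum>j<J. S (j * (p + g)) p \<omega>)"

lemma big_rv[measurable]: "big p g J \<in> borel_measurable M" unfolding big_def[abs_def] by measurable

lemma big_past:
  assumes "1 \<le> p" shows "big p g (Suc J) \<in> borel_measurable (A (J * (p + g) + p))"
  unfolding big_def[abs_def]
proof (intro borel_measurable_sum S_past)
  fix j assume "j \<in> {..<Suc J}"
  then show "j * (p + g) + p \<le> J * (p + g) + p" by (auto intro!: mult_right_mono)
qed (use assms in simp)

text \<open>
  Splitting off the blocks one at a time costs \<open>4 r (Suc g)\<close> each: the last index of the past and the first index of
  the next block differ by \<open>g + 1\<close>.
\<close>

lemma big_blocks: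
  assumes p: "1 \<le> p"
  shows "cmod ((\<integral>\<omega>. iexp (s * big p g J \<omega>) \<partial>M) - \<phi> p s ^ J) \<le> real J * (4 * r (Suc g))"
proof (induction J)
  case 0
  then show ?case by (simp add: big_def prob_space)
next
  case (Suc J)
  let ?F = "\<integral>\<omega>. iexp (s * big p g J \<omega>) \<partial>M"
  have sh: "(\<integral>\<omega>. iexp (s * S h p \<omega>) \<partial>M) = \<phi> p s" for h
    unfolding \<phi>_def by (rule S_shift) simp
  have "cmod ((\<integral>\<omega>. iexp (s * big p g (Suc J) \<omega>) \<partial>M) - ?F * \<phi> p s) \<le> 4 * r (Suc g)"
  proof (cases J)
    case 0
    then show ?thesis using r_nonneg[of "Suc g"] by (simp add: big_def prob_space \<phi>_def)
  next
    case (Suc J')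
    let ?k = "J' * (p + g) + p"
    have k: "1 \<le> ?k" using p by simp
    have e: "s * big p g (Suc J) \<omega> = s * big p g J \<omega> + s * S (J * (p + g)) p \<omega>" for \<omega>
      by (simp add: big_def algebra_simps)
    have "cmod ((\<integral>\<omega>. iexp (s * big p g J \<omega> + s * S (J * (p + g)) p \<omega>) \<partial>M)
        - ?F * (\<integral>\<omega>. iexp (s * S (J * (p + g)) p \<omega>) \<partial>M)) \<le> 4 * r (Suc g)"
    proof (rule decorrelated_iexp[OF prob_space_axioms sub(1)[OF k] sub(2) decorr[OF k] r_nonneg])
      show "(\<lambda>x. s * big p g J x) \<in> borel_measurable (A ?k)"
        using big_past[OF p, of g J'] Suc by simp
      show "(\<lambda>x. s * S (J * (p + g)) p x) \<in> borel_measurable (B (?k + Suc g))"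
        using S_future[of "?k + Suc g" "J * (p + g)" p] Suc by (simp add: algebra_simps)
    qed simp
    then show ?thesis unfolding e sh .
  qed
  moreover have "cmod (?F * \<phi> p s - \<phi> p s ^ Suc J) \<le> real J * (4 * r (Suc g))"
  proof -
    have "cmod (?F * \<phi> p s - \<phi> p s ^ Suc J) = cmod (?F - \<phi> p s ^ J) * cmod (\<phi> p s)"
      by (simp add: algebra_simps flip: norm_mult)
    also have "\<dots> \<le> cmod (?F - \<phi> p s ^ J) * 1" using cmod_\<phi> by (intro mult_left_mono) auto
    finally show ?thesis using Suc by simp
  qed
  ultimately show ?case
    using norm_triangle_ineq[of "(\<integral>\<omega>. iexp (s * big p g (Suc J) \<omega>) \<partial>M) - ?F * \<phi> p s" "?F * \<phi> p s - \<phi> p s ^ Suc J"]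
    by (simp add: algebra_simps)
qed

lemma S_eq_big: "S 0 (J * (p + g)) \<omega> = big p g J \<omega> + (\<Sum>j<J. S (j * (p + g) + p) g \<omega>)"
proof (induction J)
  case (Suc J)
  have "S 0 (Suc J * (p + g)) \<omega> = S 0 (J * (p + g)) \<omega> + S (J * (p + g)) (p + g) \<omega>"
    using S_add[of 0 "J * (p + g)" "p + g" \<omega>] by (simp add: add.commute)
  also have "S (J * (p + g)) (p + g) \<omega> = S (J * (p + g)) p \<omega> + S (J * (p + g) + p) g \<omega>" by (rule S_add)
  finally show ?case using Suc by (simp add: big_def)
qed (simp add: big_def)

lemma iexp_diff_le: "cmod (iexp a - iexp b) \<le> \<bar>a - b\<bar>"
proof -
  have "iexp a - iexp b = iexp b * (iexp (a - b) - 1)" by (simp add: algebra_simps flip: exp_add)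
  then have "cmod (iexp a - iexp b) = cmod (iexp (a - b) - 1)" by (simp add: norm_mult)
  also have "\<dots> \<le> \<bar>a - b\<bar>" using iexp_approx1[of "a - b" 0] by simp
  finally show ?thesis .
qed

text \<open>
  For a fixed number of blocks and a fixed gap, the omitted indices are bounded in number, uniformly in \<open>d\<close>,
  so the omitted part of the sum is bounded in mean.
\<close>

lemma small_blocks:
  assumes "0 < k"
  shows "\<exists>C. \<forall>d s. g \<le> d div k \<longrightarrow>
    cmod (\<phi> d s - (\<integral>\<omega>. iexp (s * big (d div k - g) g k \<omega>) \<partial>M)) \<le> \<bar>s\<bar> * C"
proof -
  define e where "e q = (\<integral>\<omega>. \<bar>S 0 q \<omega>\<bar> \<partial>M)" for q
  have e: "(\<integral>\<omega>. \<bar>S h q \<omega>\<bar> \<partial>M) = e q" for h q unfolding e_def by (rule S_shift) simp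
  define C where "C = real k * e g + (\<Sum>l<k. e l)"
  have "cmod (\<phi> d s - (\<integral>\<omega>. iexp (s * big (d div k - g) g k \<omega>) \<partial>M)) \<le> \<bar>s\<bar> * C" if kg: "g \<le> d div k" for d s
  proof -
    define p where "p = d div k - g"
    have pg: "k * (p + g) + d mod k = d" using kg assms unfolding p_def by simp
    define R where "R \<omega> = (\<Sum>j<k. S (j * (p + g) + p) g \<omega>) + S (k * (p + g)) (d mod k) \<omega>" for \<omega>
    have SR: "S 0 d \<omega> = big p g k \<omega> + R \<omega>" for \<omega>
      using S_add[of 0 "k * (p + g)" "d mod k" \<omega>] S_eq_big[of k p g \<omega>] unfolding pg R_def by simp
    have [measurable]: "R \<in> borel_measurable M" unfolding R_def[abs_def] by measurable
    have iR: "integrable M R" unfolding R_def[abs_def] by (intro Bochner_Integration.integrable_add Bochner_Integration.integrable_sum S_integrable)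
    have "(\<integral>\<omega>. \<bar>R \<omega>\<bar> \<partial>M) \<le> (\<integral>\<omega>. (\<Sum>j<k. \<bar>S (j * (p + g) + p) g \<omega>\<bar>) + \<bar>S (k * (p + g)) (d mod k) \<omega>\<bar> \<partial>M)"
    proof (rule integral_mono)
      fix \<omega> show "\<bar>R \<omega>\<bar> \<le> (\<Sum>j<k. \<bar>S (j * (p + g) + p) g \<omega>\<bar>) + \<bar>S (k * (p + g)) (d mod k) \<omega>\<bar>"
        unfolding R_def using sum_abs[of "\<lambda>j. S (j * (p + g) + p) g \<omega>" "{..<k}"] by linarith
    qed (use iR S_integrable in \<open>auto intro!: Bochner_Integration.integrable_add Bochner_Integration.integrable_sum\<close>)
    also have "\<dots> = real k * e g + e (d mod k)" using S_integrable by (simp add: e)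
    also have "e (d mod k) \<le> (\<Sum>l<k. e l)"
      by (rule member_le_sum) (use assms in \<open>auto simp: e_def\<close>)
    finally have RC: "(\<integral>\<omega>. \<bar>R \<omega>\<bar> \<partial>M) \<le> C" unfolding C_def by simp
    have ie: "integrable M (\<lambda>\<omega>. iexp (s * h \<omega>))" if "h \<in> borel_measurable M" for h
      by (rule integrable_const_bound[of _ 1]) (use that in auto)
    have "cmod (\<phi> d s - (\<integral>\<omega>. iexp (s * big p g k \<omega>) \<partial>M))
        = cmod (\<integral>\<omega>. iexp (s * S 0 d \<omega>) - iexp (s * big p g k \<omega>) \<partial>M)"
      unfolding \<phi>_def using ie by simp
    also have "\<dots> \<le> (\<integral>\<omega>. cmod (iexp (s * S 0 d \<omega>) - iexp (s * big p g k \<omega>)) \<partial>M)"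
      by (rule integral_norm_bound)
    also have "\<dots> \<le> (\<integral>\<omega>. \<bar>s\<bar> * \<bar>R \<omega>\<bar> \<partial>M)"
    proof (rule integral_mono)
      fix \<omega> show "cmod (iexp (s * S 0 d \<omega>) - iexp (s * big p g k \<omega>)) \<le> \<bar>s\<bar> * \<bar>R \<omega>\<bar>"
        using iexp_diff_le[of "s * S 0 d \<omega>" "s * big p g k \<omega>"] by (simp add: SR algebra_simps flip: abs_mult)
    qed (use ie iR in auto)
    also have "\<dots> = \<bar>s\<bar> * (\<integral>\<omega>. \<bar>R \<omega>\<bar> \<partial>M)" by simp
    also have "\<dots> \<le> \<bar>s\<bar> * C" using RC by (intro mult_left_mono) auto
    finally show ?thesis unfolding p_def .
  qed
  then show ?thesis by blast
qed

text \<open>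
  Bernstein's blocking argument with the limits in a convenient order: since the gaps do not grow with \<open>d\<close>, the
  mixing error only has to be small compared with the number of blocks.
\<close>

lemma \<phi>_tendsto: "(\<lambda>d. \<phi> d (t / sqrt (real d))) \<longlonglongrightarrow> exp (- (\<kappa> * t\<^sup>2 / 2))"
proof (rule LIMSEQ_I)
  fix \<epsilon> :: real assume \<epsilon>: "0 < \<epsilon>"
  obtain K where K: "0 < K" "\<And>p. block_var p \<le> K * real p" using variance_linear by blast
  obtain L where L: "0 < L"
    "\<And>p s. cmod (\<phi> p s - (1 - s\<^sup>2 * block_var p / 2)) \<le> L * \<bar>s\<bar>^3 * (real p * sqrt (real p))" using \<phi>_expansion by blast
  \<comment> \<open>First fix the number of blocks, then the gap between them, and let the block length grow last.\<close>
  have lim1: "(\<lambda>k. (1 + (- (\<kappa> * t\<^sup>2 / 2)) / real k) ^ k) \<longlonglongrightarrow> exp (- (\<kappa> * t\<^sup>2 / 2))"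
    by (rule tendsto_exp_limit_sequentially)
  have lim2: "(\<lambda>k. L * \<bar>t\<bar>^3 * inverse (sqrt (real k))) \<longlonglongrightarrow> L * \<bar>t\<bar>^3 * 0"
    by (intro tendsto_mult tendsto_const tendsto_inverse_0_at_top filterlim_compose[OF sqrt_at_top filterlim_real_sequentially])
  have "\<forall>\<^sub>F k in sequentially. \<bar>(1 + (- (\<kappa> * t\<^sup>2 / 2)) / real k) ^ k - exp (- (\<kappa> * t\<^sup>2 / 2))\<bar> < \<epsilon>/4
      \<and> L * \<bar>t\<bar>^3 * inverse (sqrt (real k)) < \<epsilon>/4 \<and> t\<^sup>2 * K \<le> real k \<and> 0 < k"
  proof -
    have "\<forall>\<^sub>F k in sequentially. \<bar>(1 + (- (\<kappa> * t\<^sup>2 / 2)) / real k) ^ k - exp (- (\<kappa> * t\<^sup>2 / 2))\<bar> < \<epsilon>/4"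
      using tendstoD[OF lim1, of "\<epsilon>/4"] \<epsilon> by (simp add: dist_real_def)
    moreover have "\<forall>\<^sub>F k in sequentially. L * \<bar>t\<bar>^3 * inverse (sqrt (real k)) < \<epsilon>/4"
      by (rule order_tendstoD(2)[OF lim2]) (use \<epsilon> in auto)
    ultimately show ?thesis
      using eventually_ge_at_top[of "nat \<lceil>t\<^sup>2 * K\<rceil>"] eventually_gt_at_top[of "0::nat"]
      by eventually_elim (auto simp: nat_le_iff ceiling_le_iff)
  qed
  then obtain k where k: "\<bar>(1 + (- (\<kappa> * t\<^sup>2 / 2)) / real k) ^ k - exp (- (\<kappa> * t\<^sup>2 / 2))\<bar> < \<epsilon>/4"
      "L * \<bar>t\<bar>^3 * inverse (sqrt (real k)) < \<epsilon>/4" "t\<^sup>2 * K \<le> real k" "0 < k"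
    using eventually_happens'[OF sequentially_bot] by blast
  \<comment> \<open>The \<open>k\<close> blocks cost at most \<open>4 k r (Suc g)\<close>, to be less than \<open>\<epsilon> / 4\<close>.\<close>
  have "\<forall>\<^sub>F g in sequentially. r g < \<epsilon> / (16 * real k)"
    by (rule order_tendstoD(2)[OF r_tendsto]) (use \<epsilon> k in auto)
  then obtain g0 where "\<And>g. g \<ge> g0 \<Longrightarrow> r g < \<epsilon> / (16 * real k)" unfolding eventually_sequentially by blast
  then obtain g where g: "r (Suc g) < \<epsilon> / (16 * real k)" by (meson le_SucI order_refl)
  from small_blocks[OF k(4), of g] obtain C where C: "\<forall>d s. g \<le> d div k \<longrightarrow>
    cmod (\<phi> d s - (\<integral>\<omega>. iexp (s * big (d div k - g) g k \<omega>) \<partial>M)) \<le> \<bar>s\<bar> * C" ..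
  let ?p = "\<lambda>d. d div k - g" and ?s = "\<lambda>d. t / sqrt (real d)"
  have p_inf: "filterlim ?p at_top sequentially"
    unfolding filterlim_at_top
  proof
    fix n
    show "\<forall>\<^sub>F d in sequentially. n \<le> d div k - g"
      using eventually_ge_at_top[of "k * (n + g)"]
    proof eventually_elim
      case (elim d)
      then have "n + g \<le> d div k" using k(4) by (simp add: less_eq_div_iff_mult_less_eq mult.commute)
      then show ?case by simp
    qed
  qed
  have div_le: "real (d div k) \<le> real d / real k" for d
  proof -
    have "real (d div k) * real k \<le> real d"
      using times_div_less_eq_dividend[of k d] by (metis mult.commute of_nat_le_iff of_nat_mult)
    then show ?thesis using k(4) by (simp add: le_divide_eq)
  qed
  have p_ratio: "(\<lambda>d. real (?p d) / real d) \<longlonglongrightarrow> 1 / real k"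
  proof (rule tendsto_sandwich)
    show "\<forall>\<^sub>F d in sequentially. 1 / real k - (real g + 1) / real d \<le> real (?p d) / real d"
      using eventually_gt_at_top[of 0]
    proof eventually_elim
      case (elim d)
      have "real d / real k \<le> real (d div k) + 1"
      proof -
        have "d \<le> (d div k + 1) * k"
          using dividend_less_div_times[of k d] k(4) by (simp add: algebra_simps)
        then have "real d \<le> (real (d div k) + 1) * real k"
          by (metis of_nat_1 of_nat_add of_nat_le_iff of_nat_mult)
        then show ?thesis using k(4) by (simp add: divide_le_eq)
      qed
      then have "real d / real k - (real g + 1) \<le> real (?p d)" by linarith
      then have "(real d / real k - (real g + 1)) / real d \<le> real (?p d) / real d" by (rule divide_right_mono) simp
      then show ?case using elim by (simp add: diff_divide_distrib)
    qed
    show "\<forall>\<^sub>F d in sequentially. real (?p d) / real d \<le> 1 / real k"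
      using eventually_gt_at_top[of 0]
    proof eventually_elim
      case (elim d)
      have "real (?p d) \<le> real d / real k" using div_le[of d] by linarith
      then have "real (?p d) / real d \<le> real d / real k / real d" by (rule divide_right_mono) simp
      then show ?case using elim by simp
    qed
    have "(\<lambda>d. 1 / real k - (real g + 1) / real d) \<longlonglongrightarrow> 1 / real k - 0"
      by (intro tendsto_diff tendsto_const lim_const_over_n)
    then show "(\<lambda>d. 1 / real k - (real g + 1) / real d) \<longlonglongrightarrow> 1 / real k" by simp
  qed simp
  have "(\<lambda>d. block_var (?p d) / real (?p d) * (real (?p d) / real d)) \<longlonglongrightarrow> \<kappa> * (1 / real k)"
    by (intro tendsto_mult p_ratio filterlim_compose[OF block_var_tendsto p_inf])
  then have "(\<lambda>d. block_var (?p d) / real d) \<longlonglongrightarrow> \<kappa> * (1 / real k)"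
    by (rule Lim_transform_eventually)
       (use eventually_compose_filterlim[OF eventually_gt_at_top[of 0] p_inf] in \<open>auto elim!: eventually_mono\<close>)
  then have "(\<lambda>d. (1 + (- (t\<^sup>2 * (block_var (?p d) / real d) / 2))) ^ k) \<longlonglongrightarrow> (1 + (- (t\<^sup>2 * (\<kappa> * (1 / real k)) / 2))) ^ k"
    by (intro tendsto_intros) auto
  then have lim3: "(\<lambda>d. (1 - (?s d)\<^sup>2 * block_var (?p d) / 2) ^ k) \<longlonglongrightarrow> (1 + (- (\<kappa> * t\<^sup>2 / 2)) / real k) ^ k"
    by (simp add: power_divide mult_ac)
  have "(\<lambda>d. \<bar>t\<bar> * C * inverse (sqrt (real d))) \<longlonglongrightarrow> \<bar>t\<bar> * C * 0"
    by (intro tendsto_mult tendsto_const tendsto_inverse_0_at_top filterlim_compose[OF sqrt_at_top filterlim_real_sequentially])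
  then have "\<forall>\<^sub>F d in sequentially. \<bar>t\<bar> * C * inverse (sqrt (real d)) < \<epsilon>/8"
    by (rule order_tendstoD(2)) (use \<epsilon> in auto)
  moreover have "\<forall>\<^sub>F d in sequentially. \<bar>(1 - (?s d)\<^sup>2 * block_var (?p d) / 2) ^ k - (1 + (- (\<kappa> * t\<^sup>2 / 2)) / real k) ^ k\<bar> < \<epsilon>/8"
    using tendstoD[OF lim3, of "\<epsilon>/8"] \<epsilon> by (simp add: dist_real_def)
  moreover have "\<forall>\<^sub>F d in sequentially. 1 \<le> ?p d"
    using eventually_compose_filterlim[OF eventually_ge_at_top p_inf] .
  ultimately have "\<forall>\<^sub>F d in sequentially. cmod (\<phi> d (?s d) - exp (- (\<kappa> * t\<^sup>2 / 2))) < \<epsilon>"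
    using eventually_gt_at_top[of 0]
  proof eventually_elim
    case (elim d)
    let ?P = "?p d" and ?u = "?s d"
    let ?E = "\<integral>\<omega>. iexp (?u * big ?P g k \<omega>) \<partial>M"
    let ?w = "1 - ?u\<^sup>2 * block_var ?P / 2"
    have d0: "0 < d" using elim by simp
    have Pd: "real ?P \<le> real d / real k" using div_le[of d] by linarith
    have 1: "cmod (\<phi> d ?u - ?E) < \<epsilon>/8"
    proof -
      have "cmod (\<phi> d ?u - ?E) \<le> \<bar>?u\<bar> * C" using C elim(3) by (metis diff_is_0_eq nat_le_linear not_one_le_zero)
      also have "\<dots> = \<bar>t\<bar> * C * inverse (sqrt (real d))" by (simp add: field_simps)
      finally show ?thesis using elim by simp
    qed
    have 2: "cmod (?E - \<phi> ?P ?u ^ k) < \<epsilon>/4"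
    proof -
      have "cmod (?E - \<phi> ?P ?u ^ k) \<le> real k * (4 * r (Suc g))" using big_blocks elim(3) by blast
      also have "\<dots> < real k * (4 * (\<epsilon> / (16 * real k)))" using g k(4) by (intro mult_strict_left_mono) auto
      also have "\<dots> = \<epsilon>/4" using k(4) by simp
      finally show ?thesis .
    qed
    have u2: "?u\<^sup>2 = t\<^sup>2 / real d" by (simp add: power_divide)
    have w: "\<bar>?w\<bar> \<le> 1"
    proof -
      have "?u\<^sup>2 * block_var ?P \<le> (t\<^sup>2 / real d) * (K * (real d / real k))"
        unfolding u2 using K Pd by (intro mult_left_mono order_trans[OF K(2)] mult_left_mono) auto
      also have "\<dots> = t\<^sup>2 * K / real k" using d0 by simp
      also have "\<dots> \<le> 1" using k by (simp add: divide_le_eq)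
      finally have "?u\<^sup>2 * block_var ?P \<le> 1" .
      moreover have "0 \<le> ?u\<^sup>2 * block_var ?P" using block_var_nonneg by simp
      ultimately show ?thesis by linarith
    qed
    have 3: "cmod (\<phi> ?P ?u ^ k - of_real ?w ^ k) < \<epsilon>/4"
    proof -
      have "cmod (\<phi> ?P ?u ^ k - of_real ?w ^ k) \<le> real k * cmod (\<phi> ?P ?u - of_real ?w)"
        by (rule norm_power_diff) (use cmod_\<phi> w in \<open>auto simp: norm_of_real simp del: of_real_diff\<close>)
      also have "\<dots> \<le> real k * (L * \<bar>?u\<bar>^3 * (real ?P * sqrt (real ?P)))"
        using L(2)[of ?P ?u] by (intro mult_left_mono) (auto simp: of_real_diff)
      also have "\<dots> \<le> real k * (L * \<bar>?u\<bar>^3 * ((real d / real k) * sqrt (real d / real k)))"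
        using Pd L(1) by (intro mult_left_mono mult_mono real_sqrt_le_mono) auto
      also have "\<dots> = L * \<bar>t\<bar>^3 * inverse (sqrt (real k))"
        using d0 k(4) by (simp add: power_divide real_sqrt_divide field_simps power3_eq_cube)
      finally show ?thesis using k(2) by simp
    qed
    have 4: "cmod (of_real ?w ^ k - of_real ((1 + (- (\<kappa> * t\<^sup>2 / 2)) / real k) ^ k)) < \<epsilon>/8"
      using elim(2) by (simp only: of_real_power[symmetric] of_real_diff[symmetric] norm_of_real)
    have 5: "cmod (of_real ((1 + (- (\<kappa> * t\<^sup>2 / 2)) / real k) ^ k) - of_real (exp (- (\<kappa> * t\<^sup>2 / 2)))) < \<epsilon>/4"
      using k(1) by (simp only: of_real_diff[symmetric] norm_of_real)
    have tri: "cmod (a - f) < \<epsilon>" if "cmod (a - b) < \<epsilon>/8" "cmod (b - c) < \<epsilon>/4" "cmod (c - d) < \<epsilon>/4"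
       "cmod (d - e) < \<epsilon>/8" "cmod (e - f) < \<epsilon>/4" for a b c d e f
      using norm_triangle_ineq[of "a - b" "b - f"] norm_triangle_ineq[of "b - c" "c - f"]
        norm_triangle_ineq[of "c - d" "d - f"] norm_triangle_ineq[of "d - e" "e - f"] that by simp
    show ?case using tri[OF 1 2 3 4 5] by (simp add: exp_of_real)
  qed
  then show "\<exists>no. \<forall>d\<ge>no. cmod (\<phi> d (t / sqrt (real d)) - exp (- (\<kappa> * t\<^sup>2 / 2))) < \<epsilon>"
    unfolding eventually_sequentially by blast
qed

theorem central_limit:
  assumes \<kappa>: "0 < \<kappa>"
  shows "weak_conv_m (\<lambda>d. distr M borel (\<lambda>\<omega>. (\<Sum>k\<in>{0<..d}. Z k \<omega>) / sqrt (\<kappa> * real d))) std_normal_distribution"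
proof (rule levy_continuity)
  have [measurable]: "(\<lambda>\<omega>. \<Sum>k\<in>{0<..d}. Z k \<omega>) \<in> borel_measurable M" for d
    using S_rv[of 0 d] by (simp add: S_def[abs_def])
  show "real_distribution (distr M borel (\<lambda>\<omega>. (\<Sum>k\<in>{0<..d}. Z k \<omega>) / sqrt (\<kappa> * real d)))" for d
    by (rule real_distribution_distr) measurable
  show "real_distribution std_normal_distribution" by (rule real_dist_normal_dist)
  fix t
  have "char (distr M borel (\<lambda>\<omega>. (\<Sum>k\<in>{0<..d}. Z k \<omega>) / sqrt (\<kappa> * real d))) t = \<phi> d (t / sqrt \<kappa> / sqrt (real d))" for d
    unfolding char_def \<phi>_def by (simp add: integral_distr S_def real_sqrt_mult)
  moreover have "(\<lambda>d. \<phi> d (t / sqrt \<kappa> / sqrt (real d))) \<longlonglongrightarrow> exp (- (\<kappa> * (t / sqrt \<kappa>)\<^sup>2 / 2))" by (rule \<phi>_tendsto)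
  moreover have "exp (- (\<kappa> * (t / sqrt \<kappa>)\<^sup>2 / 2)) = char std_normal_distribution t"
    using \<kappa> by (simp add: char_std_normal_distribution power_divide exp_of_real)
  ultimately show "(\<lambda>d. char (distr M borel (\<lambda>\<omega>. (\<Sum>k\<in>{0<..d}. Z k \<omega>) / sqrt (\<kappa> * real d))) t)
      \<longlonglongrightarrow> char std_normal_distribution t" by simp
qed

end

section \<open>Autocovariances of a stationary \<rho>-mixing sequence\<close>

lemma cesaro_mean:
  fixes x :: "nat \<Rightarrow> real"
  assumes "x \<longlonglongrightarrow> L"
  shows "(\<lambda>n. (\<Sum>j<n. x j) / real n) \<longlonglongrightarrow> L"
proof (rule LIMSEQ_I)
  fix e :: real assume e: "0 < e"
  obtain N where N: "\<And>j. j \<ge> N \<Longrightarrow> \<bar>x j - L\<bar> < e/2"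
    using LIMSEQ_D[OF assms, of "e/2"] e by auto
  define C where "C = (\<Sum>j<N. \<bar>x j - L\<bar>)"
  have C0: "0 \<le> C" unfolding C_def by (intro sum_nonneg) auto
  obtain N' where N': "2 * C / e < real N'" using reals_Archimedean2 by blast
  have "\<bar>(\<Sum>j<n. x j) / real n - L\<bar> < e" if n: "n \<ge> max 1 (max N N')" for n
  proof -
    have "\<bar>(\<Sum>j<n. x j) - real n * L\<bar> = \<bar>\<Sum>j<n. (x j - L)\<bar>" by (simp add: sum_subtractf)
    also have "\<dots> \<le> (\<Sum>j<n. \<bar>x j - L\<bar>)" by (rule sum_abs)
    also have "\<dots> = C + (\<Sum>j\<in>{N..<n}. \<bar>x j - L\<bar>)"
      unfolding C_def using n sum.atLeastLessThan_concat[of 0 N n "\<lambda>j. \<bar>x j - L\<bar>"] by (simp add: lessThan_atLeast0)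
    also have "(\<Sum>j\<in>{N..<n}. \<bar>x j - L\<bar>) \<le> (\<Sum>j\<in>{N..<n}. e/2)"
      by (intro sum_mono) (use N in \<open>auto simp: less_imp_le\<close>)
    also have "(\<Sum>j\<in>{N..<n}. e/2) \<le> real n * (e/2)" using e by simp
    also have "C < real n * (e/2)"
    proof -
      have "2 * C / e < real n" using N' n by linarith
      then show ?thesis using e by (simp add: divide_less_eq field_simps)
    qed
    finally have "\<bar>(\<Sum>j<n. x j) - real n * L\<bar> < e * real n" by (simp add: mult.commute)
    moreover have "(\<Sum>j<n. x j) / real n - L = ((\<Sum>j<n. x j) - real n * L) / real n"
      using n by (simp add: field_simps)
    ultimately show ?thesis using n by (simp add: abs_divide divide_less_eq)
  qed
  then show "\<exists>no. \<forall>n\<ge>no. norm ((\<Sum>j<n. x j) / real n - L) < e"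
    by (intro exI[of _ "max 1 (max N N')"]) simp
qed

definition lag :: "nat \<Rightarrow> nat \<Rightarrow> nat" where "lag i j = (if i \<le> j then j - i else i - j)"

lemma lag_commute: "lag i j = lag j i" by (simp add: lag_def)

lemma sum_lag_Suc: "(\<Sum>i=1..d. (c (lag i (Suc d)) :: real)) = (\<Sum>k=1..d. c k)"
  by (rule sum.reindex_bij_witness[where i="\<lambda>k. Suc d - k" and j="\<lambda>i. Suc d - i"]) (auto simp: lag_def)

text \<open>
  Enlarging the matrix from size \<open>e\<close> to \<open>e + 1\<close> adds one diagonal entry and two copies of the lags \<open>1, \<dots>, e\<close>;
  the average over the matrix thus becomes a Cesaro mean.
\<close>

lemma toeplitz_sum_eq:
  fixes c :: "nat \<Rightarrow> real"
  shows "(\<Sum>i=1..d. \<Sum>j=1..d. c (lag i j)) = (\<Sum>e<d. c 0 + 2 * (\<Sum>k=1..e. c k))"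
proof (induction d)
  case (Suc d)
  have "(\<Sum>i=1..Suc d. \<Sum>j=1..Suc d. c (lag i j))
     = (\<Sum>i=1..d. \<Sum>j=1..d. c (lag i j)) + (\<Sum>i=1..d. c (lag i (Suc d))) + (\<Sum>j=1..d. c (lag (Suc d) j)) + c 0"
    by (simp add: sum.distrib lag_def)
  also have "(\<Sum>j=1..d. c (lag (Suc d) j)) = (\<Sum>j=1..d. c (lag j (Suc d)))" by (simp only: lag_commute[of "Suc d"])
  finally show ?case using Suc sum_lag_Suc[of c d] by simp
qed simp

lemma sum_Icc_shift: "(\<Sum>k=1..n. (c k :: real)) = (\<Sum>k<n. c (Suc k))"
  by (rule sum.reindex_bij_witness[where i="Suc" and j="\<lambda>k. k - 1"]) auto

lemma toeplitz_mean:
  fixes c :: "nat \<Rightarrow> real"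
  assumes "summable (\<lambda>k. \<bar>c k\<bar>)"
  shows "(\<lambda>d. (\<Sum>i=1..d. \<Sum>j=1..d. c (lag i j)) / real d) \<longlonglongrightarrow> c 0 + 2 * (\<Sum>k. c (Suc k))"
proof -
  have s: "summable (\<lambda>k. c (Suc k))"
    using summable_rabs_cancel[OF assms] by (subst summable_Suc_iff)
  have "(\<lambda>e. c 0 + 2 * (\<Sum>k=1..e. c k)) \<longlonglongrightarrow> c 0 + 2 * (\<Sum>k. c (Suc k))"
    unfolding sum_Icc_shift by (intro tendsto_intros summable_LIMSEQ s)
  then show ?thesis unfolding toeplitz_sum_eq by (rule cesaro_mean)
qed

lemma toeplitz_vanishing_mean:
  fixes c :: "nat \<Rightarrow> real"
  assumes c: "c \<longlonglongrightarrow> 0"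
  shows "(\<lambda>d. (\<Sum>i=1..d. \<Sum>j=1..d. c (lag i j)) / (real d)\<^sup>2) \<longlonglongrightarrow> 0"
proof -
  have "(\<lambda>n. \<bar>c (Suc n)\<bar>) \<longlonglongrightarrow> 0" using LIMSEQ_Suc[OF tendsto_rabs_zero[OF c]] by simp
  from cesaro_mean[OF this] have z: "(\<lambda>d. (\<Sum>k<d. \<bar>c (Suc k)\<bar>) / real d) \<longlonglongrightarrow> 0" .
  have z': "(\<lambda>d. \<bar>c 0\<bar> / real d + 2 * ((\<Sum>k<d. \<bar>c (Suc k)\<bar>) / real d)) \<longlonglongrightarrow> 0 + 2 * 0"
    by (intro tendsto_intros lim_const_over_n z)
  show ?thesis
  proof (rule Lim_null_comparison)
    show "(\<lambda>d. \<bar>c 0\<bar> / real d + 2 * ((\<Sum>k<d. \<bar>c (Suc k)\<bar>) / real d)) \<longlonglongrightarrow> 0" using z' by simp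
    show "\<forall>\<^sub>F d in sequentially. norm ((\<Sum>i=1..d. \<Sum>j=1..d. c (lag i j)) / (real d)\<^sup>2)
       \<le> \<bar>c 0\<bar> / real d + 2 * ((\<Sum>k<d. \<bar>c (Suc k)\<bar>) / real d)"
    proof (intro always_eventually allI)
      fix d
      have "\<bar>\<Sum>i=1..d. \<Sum>j=1..d. c (lag i j)\<bar> \<le> (\<Sum>e<d. \<bar>c 0 + 2 * (\<Sum>k=1..e. c k)\<bar>)"
        unfolding toeplitz_sum_eq by (rule sum_abs)
      also have "\<dots> \<le> (\<Sum>e<d. \<bar>c 0\<bar> + 2 * (\<Sum>k<d. \<bar>c (Suc k)\<bar>))"
      proof (rule sum_mono)
        fix e assume e: "e \<in> {..<d}"
        have "\<bar>\<Sum>k=1..e. c k\<bar> \<le> (\<Sum>k<e. \<bar>c (Suc k)\<bar>)" unfolding sum_Icc_shift by (rule sum_abs)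
        also have "\<dots> \<le> (\<Sum>k<d. \<bar>c (Suc k)\<bar>)" by (rule sum_mono2) (use e in auto)
        finally show "\<bar>c 0 + 2 * (\<Sum>k=1..e. c k)\<bar> \<le> \<bar>c 0\<bar> + 2 * (\<Sum>k<d. \<bar>c (Suc k)\<bar>)" by linarith
      qed
      also have "\<dots> = real d * (\<bar>c 0\<bar> + 2 * (\<Sum>k<d. \<bar>c (Suc k)\<bar>))" by simp
      finally have "\<bar>\<Sum>i=1..d. \<Sum>j=1..d. c (lag i j)\<bar> / (real d)\<^sup>2 \<le> real d * (\<bar>c 0\<bar> + 2 * (\<Sum>k<d. \<bar>c (Suc k)\<bar>)) / (real d)\<^sup>2"
        by (rule divide_right_mono) simp
      also have "\<dots> = \<bar>c 0\<bar> / real d + 2 * ((\<Sum>k<d. \<bar>c (Suc k)\<bar>) / real d)"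
        by (cases "d = 0") (simp_all add: power2_eq_square add_divide_distrib)
      finally show "norm ((\<Sum>i=1..d. \<Sum>j=1..d. c (lag i j)) / (real d)\<^sup>2)
       \<le> \<bar>c 0\<bar> / real d + 2 * ((\<Sum>k<d. \<bar>c (Suc k)\<bar>) / real d)" by simp
    qed
  qed
qed

text \<open>
  Solving the recursion for \<open>H (4 n)\<close> shows that \<open>H\<close> grows over one dyadic step at most by a factor
  \<open>1 / (1 - q)\<close>, where \<open>q = C \<rho> n\<close>. This factor is at most \<open>exp (2 q)\<close> once \<open>q \<le> 1/2\<close>,
  and the product of these factors converges.
\<close>

lemma dyadic_bound:
  fixes H \<rho> :: "nat \<Rightarrow> real"
  assumes mono: "mono H" and H0: "\<And>n. 0 \<le> H n" and \<rho>0: "\<And>n. 0 \<le> \<rho> n"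
    and step: "\<And>n. 1 \<le> n \<Longrightarrow> H (4 * n) - H (2 * n) \<le> C * \<rho> n * H (4 * n)" and C: "0 < C"
    and sum: "summable (\<lambda>k. \<rho> (2 ^ Suc k))"
  shows "\<exists>K. \<forall>n. H n \<le> K"
proof -
  define q where "q k = C * \<rho> (2 ^ Suc k)" for k
  have q: "summable q" "\<And>k. 0 \<le> q k" unfolding q_def using sum C \<rho>0 by (auto intro: summable_mult)
  have "\<forall>\<^sub>F k in sequentially. q k < 1/2"
    by (rule order_tendstoD(2)[OF summable_LIMSEQ_zero[OF q(1)]]) simp
  then obtain J where J: "\<And>k. k \<ge> J \<Longrightarrow> q k < 1/2" unfolding eventually_sequentially by blast
  define a where "a k = H (2 ^ (k + 2))" for k
  have a_step: "a (Suc k) \<le> a k * exp (2 * q k)" if "k \<ge> J" for k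
  proof -
    have "a (Suc k) - a k \<le> q k * a (Suc k)"
      using step[of "2 ^ Suc k"] by (simp add: a_def q_def)
    then have 1: "a (Suc k) * (1 - q k) \<le> a k" by (simp add: algebra_simps)
    have "1 * 1 \<le> (1 - q k) * (1 + 2 * q k)"
    proof -
      have "q k * q k \<le> q k * (1/2)" using q(2)[of k] J[OF that] by (intro mult_left_mono) auto
      then show ?thesis by (simp add: algebra_simps)
    qed
    also have "\<dots> \<le> (1 - q k) * exp (2 * q k)"
      using exp_ge_add_one_self[of "2 * q k"] J[OF that] by (intro mult_left_mono) auto
    finally have "a (Suc k) * 1 \<le> a (Suc k) * ((1 - q k) * exp (2 * q k))"
      using H0 by (intro mult_left_mono) (auto simp: a_def)
    also have "\<dots> = (a (Suc k) * (1 - q k)) * exp (2 * q k)" by simp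
    also have "\<dots> \<le> a k * exp (2 * q k)" using 1 by (intro mult_right_mono) auto
    finally show ?thesis by simp
  qed
  have a_le: "a (J + k) \<le> a J * exp (2 * (\<Sum>i<k. q (J + i)))" for k
  proof (induction k)
    case (Suc k)
    have "a (J + Suc k) \<le> a (J + k) * exp (2 * q (J + k))" using a_step[of "J + k"] by simp
    also have "\<dots> \<le> a J * exp (2 * (\<Sum>i<k. q (J + i))) * exp (2 * q (J + k))"
      using Suc by (intro mult_right_mono) auto
    also have "\<dots> = a J * exp (2 * (\<Sum>i<Suc k. q (J + i)))" by (simp add: exp_add algebra_simps)
    finally show ?case .
  qed simp
  define K where "K = a J * exp (2 * (\<Sum>i. q (J + i)))"
  have sq: "summable (\<lambda>i. q (J + i))" using summable_ignore_initial_segment[OF q(1), of J] by (simp add: add.commute)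
  have "H n \<le> K" for n
  proof -
    have "n \<le> 2 ^ n" by (rule less_imp_le[OF less_exp])
    also have "(2::nat) ^ n \<le> 2 ^ (J + n + 2)" by (rule power_increasing) auto
    finally have "H n \<le> a (J + n)" unfolding a_def using mono by (rule monoD[rotated])
    also have "\<dots> \<le> a J * exp (2 * (\<Sum>i<n. q (J + i)))" by (rule a_le)
    also have "\<dots> \<le> K" unfolding K_def
      using sum_le_suminf[OF sq, of "{..<n}"] q(2) H0 by (intro mult_left_mono) (auto simp: a_def)
    finally show ?thesis .
  qed
  then show ?thesis by blast
qed

lemma integral_double_sum:
  fixes h :: "'i \<Rightarrow> 'j \<Rightarrow> 'a \<Rightarrow> real"
  assumes "\<And>i j. i \<in> F \<Longrightarrow> j \<in> G \<Longrightarrow> integrable M (h i j)"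
  shows "(\<integral>x. (\<Sum>i\<in>F. \<Sum>j\<in>G. h i j x) \<partial>M) = (\<Sum>i\<in>F. \<Sum>j\<in>G. \<integral>x. h i j x \<partial>M)"
  using assms by (subst Bochner_Integration.integral_sum)
    (auto intro!: sum.cong Bochner_Integration.integral_sum Bochner_Integration.integrable_sum)

lemma pair_integral_product:
  fixes f :: "'a \<Rightarrow> real" and g :: "'b \<Rightarrow> real"
  assumes "prob_space M" "prob_space N" and f: "integrable M f" and g: "integrable N g"
  shows "integrable (M \<Otimes>\<^sub>M N) (\<lambda>x. f (fst x) * g (snd x)) \<and>
    (\<integral>x. f (fst x) * g (snd x) \<partial>(M \<Otimes>\<^sub>M N)) = (\<integral>x. f x \<partial>M) * (\<integral>x. g x \<partial>N)"
proof -
  interpret M: prob_space M by fact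
  interpret N: prob_space N by fact
  interpret pair_prob_space M N ..
  have [measurable]: "f \<in> borel_measurable M" "g \<in> borel_measurable N" using f g by auto
  have i: "integrable (M \<Otimes>\<^sub>M N) (\<lambda>x. f (fst x) * g (snd x))"
    by (rule Fubini_integrable) (use f g in \<open>auto simp: abs_mult\<close>)
  show ?thesis using i integral_fst'[OF i] by simp
qed

locale stationary_mixing = prob_space M for M :: "'a measure" +
  fixes V :: "nat \<Rightarrow> 'a \<Rightarrow> real"
  assumes rv: "\<And>k. 1 \<le> k \<Longrightarrow> V k \<in> borel_measurable M"
    and mean: "\<And>k. 1 \<le> k \<Longrightarrow> (\<integral>\<omega>. V k \<omega> \<partial>M) = 0"
    and stat: "strictly_stationary M V"
    and moment: "integrable M (\<lambda>\<omega>. V 1 \<omega> ^ 4)"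
    and mixing: "rho_mixing M V"
    and rho_sum: "summable (\<lambda>k. rho_coeff M V (2 ^ Suc k))"
begin

lemma rho_nonneg: "0 \<le> rho_coeff M V g" by (rule rho_coeff_props(1)[OF rv])

lemma decor: "1 \<le> k \<Longrightarrow> decorrelated M (generated_algebra M V {1..k}) (generated_algebra M V {k+g..}) (rho_coeff M V g)"
  by (rule rho_coeff_props(2)[OF rv])

lemma sub_past: "subalgebra M (generated_algebra M V {1..k})"
  by (rule subalgebra_generated_algebra) (auto intro: rv)

lemma sub_future: "1 \<le> k \<Longrightarrow> subalgebra M (generated_algebra M V {k..})"
  by (rule subalgebra_generated_algebra) (auto intro: rv)

lemma stationary_law:
  assumes "finite J" "J \<subseteq> {1..}" and F: "F \<in> measurable (PiM J (\<lambda>_. borel)) N"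
  shows "distr M N (\<lambda>\<omega>. F (\<lambda>k\<in>J. V (k + h) \<omega>)) = distr M N (\<lambda>\<omega>. F (\<lambda>k\<in>J. V k \<omega>))"
proof -
  have m: "(\<lambda>\<omega>. \<lambda>k\<in>J. V (k + h) \<omega>) \<in> measurable M (PiM J (\<lambda>_. borel))" for h
    using assms(2) by (intro measurable_restrict rv) auto
  have "distr (distr M (PiM J (\<lambda>_. borel)) (\<lambda>\<omega>. \<lambda>k\<in>J. V (k + h) \<omega>)) N F
      = distr (distr M (PiM J (\<lambda>_. borel)) (\<lambda>\<omega>. \<lambda>k\<in>J. V k \<omega>)) N F"
    using stat assms(1,2) unfolding strictly_stationary_def by simp
  then show ?thesis using m[of h] m[of 0] F by (simp add: distr_distr comp_def)
qed

lemma law_single: "1 \<le> k \<Longrightarrow> distr M borel (V k) = distr M borel (V 1)"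
  using stationary_law[of "{1}" "\<lambda>f. f 1" borel "k - 1"] by simp

lemma law_pair:
  assumes "1 \<le> i" "i \<le> j"
  shows "distr M (borel \<Otimes>\<^sub>M borel) (\<lambda>\<omega>. (V i \<omega>, V j \<omega>)) = distr M (borel \<Otimes>\<^sub>M borel) (\<lambda>\<omega>. (V 1 \<omega>, V (1 + (j - i)) \<omega>))"
  using stationary_law[of "{1, 1 + (j - i)}" "\<lambda>f. (f 1, f (1 + (j - i)))" "borel \<Otimes>\<^sub>M borel" "i - 1"] assms by simp

lemma expectation_single:
  assumes "1 \<le> k" and [measurable]: "\<phi> \<in> borel_measurable borel"
  shows "(\<integral>\<omega>. \<phi> (V k \<omega>) \<partial>M) = (\<integral>\<omega>. \<phi> (V 1 \<omega>) \<partial>M :: real)"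
proof -
  have "(\<integral>x. \<phi> x \<partial>distr M borel (V k)) = (\<integral>x. \<phi> x \<partial>distr M borel (V 1))" using law_single[OF assms(1)] by simp
  then show ?thesis using rv[OF assms(1)] rv[of 1] by (simp add: integral_distr)
qed

lemma expectation_pair:
  assumes "1 \<le> i" "1 \<le> j" and [measurable]: "\<phi> \<in> borel_measurable borel"
  shows "(\<integral>\<omega>. \<phi> (V i \<omega>) * \<phi> (V j \<omega>) \<partial>M) = (\<integral>\<omega>. \<phi> (V 1 \<omega>) * \<phi> (V (1 + lag i j) \<omega>) \<partial>M :: real)"
proof -
  have *: "(\<integral>\<omega>. \<phi> (V i \<omega>) * \<phi> (V j \<omega>) \<partial>M) = (\<integral>\<omega>. \<phi> (V 1 \<omega>) * \<phi> (V (1 + (j - i)) \<omega>) \<partial>M)"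
    if "1 \<le> i" "i \<le> j" for i j
  proof -
    have [measurable]: "V i \<in> borel_measurable M" "V j \<in> borel_measurable M" "V 1 \<in> borel_measurable M"
      "V (1 + (j - i)) \<in> borel_measurable M" using that by (auto intro: rv)
    note this[simplified, measurable]
    have "(\<integral>x. \<phi> (fst x) * \<phi> (snd x) \<partial>distr M (borel \<Otimes>\<^sub>M borel) (\<lambda>\<omega>. (V i \<omega>, V j \<omega>)))
        = (\<integral>x. \<phi> (fst x) * \<phi> (snd x) \<partial>distr M (borel \<Otimes>\<^sub>M borel) (\<lambda>\<omega>. (V 1 \<omega>, V (1 + (j - i)) \<omega>)))"
      using law_pair[OF that] by simp
    then show ?thesis by (simp add: integral_distr)
  qed
  show ?thesis
  proof (cases "i \<le> j")
    case True then show ?thesis using *[OF assms(1) True] by (simp add: lag_def)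
  next
    case False then show ?thesis using *[of j i] assms by (simp add: lag_def mult.commute)
  qed
qed

lemma moment4: "1 \<le> k \<Longrightarrow> integrable M (\<lambda>\<omega>. V k \<omega> ^ 4)"
proof -
  assume k: "1 \<le> k"
  have "integrable (distr M borel (V 1)) (\<lambda>x. x ^ 4)" using moment rv[of 1] by (simp add: integrable_distr_eq)
  then have "integrable (distr M borel (V k)) (\<lambda>x. x ^ 4)" using law_single[OF k] by simp
  then show ?thesis using rv[OF k] by (simp add: integrable_distr_eq)
qed

lemma moment2: "1 \<le> k \<Longrightarrow> integrable M (\<lambda>\<omega>. (V k \<omega>)\<^sup>2)"
  by (rule square_integrable_imp_integrable) (use moment4[of k] rv[of k] in \<open>auto simp flip: power_mult\<close>)

lemma moment1: "1 \<le> k \<Longrightarrow> integrable M (V k)"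
  by (rule square_integrable_imp_integrable) (use moment2[of k] rv[of k] in auto)

definition \<gamma> :: "nat \<Rightarrow> real" where "\<gamma> k = (\<integral>\<omega>. V 1 \<omega> * V (1 + k) \<omega> \<partial>M)"

lemma integrable_mult: "1 \<le> i \<Longrightarrow> 1 \<le> j \<Longrightarrow> integrable M (\<lambda>\<omega>. V i \<omega> * V j \<omega>)"
  by (rule cauchy_schwarz_integral) (auto intro: rv moment2)

lemma autocov: "1 \<le> i \<Longrightarrow> 1 \<le> j \<Longrightarrow> (\<integral>\<omega>. V i \<omega> * V j \<omega> \<partial>M) = \<gamma> (lag i j)"
  using expectation_pair[of i j "\<lambda>x. x"] unfolding \<gamma>_def by simp

text \<open>
  Mixing makes the covariances of the squares vanish as the lag grows, hence also their average over a square of indices. The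
  fourth moment is needed for the squares to have a variance.
\<close>

lemma law_of_large_numbers_squares:
  "(\<lambda>d. (\<integral>\<omega>. ((\<Sum>k=1..d. (V k \<omega>)\<^sup>2) / real d - \<gamma> 0)\<^sup>2 \<partial>M)) \<longlonglongrightarrow> 0"
proof -
  let ?K = "\<integral>\<omega>. V 1 \<omega> ^ 4 \<partial>M"
  define c where "c k = (\<integral>\<omega>. ((V 1 \<omega>)\<^sup>2 - \<gamma> 0) * ((V (1 + k) \<omega>)\<^sup>2 - \<gamma> 0) \<partial>M)" for k
  have g0: "\<gamma> 0 = (\<integral>\<omega>. (V 1 \<omega>)\<^sup>2 \<partial>M)" by (simp add: \<gamma>_def power2_eq_square)
  have m2: "(\<integral>\<omega>. (V k \<omega>)\<^sup>2 \<partial>M) = \<gamma> 0" if "1 \<le> k" for k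
    using autocov[of k k] that by (simp add: lag_def power2_eq_square)
  have i2: "integrable M (\<lambda>\<omega>. (V i \<omega>)\<^sup>2 * (V j \<omega>)\<^sup>2)" if "1 \<le> i" "1 \<le> j" for i j
    by (rule cauchy_schwarz_integral) (use that moment4[of i] moment4[of j] rv[of i] rv[of j] in \<open>auto simp flip: power_mult\<close>)
  have ic: "integrable M (\<lambda>\<omega>. ((V i \<omega>)\<^sup>2 - \<gamma> 0) * ((V j \<omega>)\<^sup>2 - \<gamma> 0))" if "1 \<le> i" "1 \<le> j" for i j
    using i2[OF that] moment2[OF that(1)] moment2[OF that(2)] by (simp add: algebra_simps)
  have ec: "c k = (\<integral>\<omega>. (V 1 \<omega>)\<^sup>2 * (V (1 + k) \<omega>)\<^sup>2 \<partial>M) - \<gamma> 0 * \<gamma> 0" for k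
  proof -
    have "c k = (\<integral>\<omega>. (V 1 \<omega>)\<^sup>2 * (V (1 + k) \<omega>)\<^sup>2 - \<gamma> 0 * (V 1 \<omega>)\<^sup>2 - \<gamma> 0 * (V (1 + k) \<omega>)\<^sup>2 + \<gamma> 0 * \<gamma> 0 \<partial>M)"
      unfolding c_def by (simp add: algebra_simps)
    also have "\<dots> = (\<integral>\<omega>. (V 1 \<omega>)\<^sup>2 * (V (1 + k) \<omega>)\<^sup>2 \<partial>M) - \<gamma> 0 * \<gamma> 0 - \<gamma> 0 * \<gamma> 0 + \<gamma> 0 * \<gamma> 0"
      using i2[of 1 "1 + k"] moment2[of 1] moment2[of "1 + k"] m2[of 1] m2[of "1 + k"] by (simp add: prob_space)
    finally show ?thesis by simp
  qed
  have c_le: "\<bar>c k\<bar> \<le> rho_coeff M V k * ?K" for k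
  proof -
    have [measurable]: "V 1 \<in> borel_measurable (generated_algebra M V {1..1})"
      "V (1 + k) \<in> borel_measurable (generated_algebra M V {1 + k..})"
      by (auto intro: measurable_generated_algebra)
    note this[simplified, measurable]
    have "\<bar>(\<integral>\<omega>. (V 1 \<omega>)\<^sup>2 * (V (1 + k) \<omega>)\<^sup>2 \<partial>M) - (\<integral>\<omega>. (V 1 \<omega>)\<^sup>2 \<partial>M) * (\<integral>\<omega>. (V (1 + k) \<omega>)\<^sup>2 \<partial>M)\<bar>
      \<le> rho_coeff M V k * (sqrt (\<integral>\<omega>. ((V 1 \<omega>)\<^sup>2)\<^sup>2 \<partial>M) * sqrt (\<integral>\<omega>. ((V (1 + k) \<omega>)\<^sup>2)\<^sup>2 \<partial>M))"
      by (rule decorrelatedD[OF decor[of 1 k]]) (use moment4[of 1] moment4[of "1 + k"] in \<open>auto simp flip: power_mult\<close>)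
    also have "\<dots> = rho_coeff M V k * ?K"
      using expectation_single[of "1 + k" "\<lambda>x. x ^ 4"] by (simp flip: power_mult)
    finally show ?thesis using m2[of 1] m2[of "1 + k"] ec by simp
  qed
  have c0: "c \<longlonglongrightarrow> 0"
  proof (rule Lim_null_comparison)
    show "\<forall>\<^sub>F k in sequentially. norm (c k) \<le> rho_coeff M V k * ?K" using c_le by simp
    show "(\<lambda>k. rho_coeff M V k * ?K) \<longlonglongrightarrow> 0"
      using mixing unfolding rho_mixing_def by (rule tendsto_mult_left_zero)
  qed
  have "(\<integral>\<omega>. ((\<Sum>k=1..d. (V k \<omega>)\<^sup>2) / real d - \<gamma> 0)\<^sup>2 \<partial>M) = (\<Sum>i=1..d. \<Sum>j=1..d. c (lag i j)) / (real d)\<^sup>2" if "1 \<le> d" for d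
  proof -
    have e: "((\<Sum>k=1..d. (V k \<omega>)\<^sup>2) / real d - \<gamma> 0)\<^sup>2
        = (\<Sum>i=1..d. \<Sum>j=1..d. ((V i \<omega>)\<^sup>2 - \<gamma> 0) * ((V j \<omega>)\<^sup>2 - \<gamma> 0)) / (real d)\<^sup>2" for \<omega>
    proof -
      have "(\<Sum>k=1..d. (V k \<omega>)\<^sup>2) / real d - \<gamma> 0 = (\<Sum>k=1..d. (V k \<omega>)\<^sup>2 - \<gamma> 0) / real d"
        using that by (simp add: sum_subtractf field_simps)
      then show ?thesis by (simp add: power_divide power2_eq_square sum_product)
    qed
    have "(\<integral>\<omega>. ((V i \<omega>)\<^sup>2 - \<gamma> 0) * ((V j \<omega>)\<^sup>2 - \<gamma> 0) \<partial>M) = c (lag i j)" if "1 \<le> i" "1 \<le> j" for i j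
      unfolding c_def using expectation_pair[OF that, of "\<lambda>x. x\<^sup>2 - \<gamma> 0"] by simp
    moreover have "(\<integral>\<omega>. (\<Sum>i=1..d. \<Sum>j=1..d. ((V i \<omega>)\<^sup>2 - \<gamma> 0) * ((V j \<omega>)\<^sup>2 - \<gamma> 0)) \<partial>M)
      = (\<Sum>i=1..d. \<Sum>j=1..d. \<integral>\<omega>. ((V i \<omega>)\<^sup>2 - \<gamma> 0) * ((V j \<omega>)\<^sup>2 - \<gamma> 0) \<partial>M)"
      by (rule integral_double_sum) (use ic in auto)
    ultimately show ?thesis unfolding e by simp
  qed
  then have ev: "\<forall>\<^sub>F d in sequentially. (\<Sum>i=1..d. \<Sum>j=1..d. c (lag i j)) / (real d)\<^sup>2
      = (\<integral>\<omega>. ((\<Sum>k=1..d. (V k \<omega>)\<^sup>2) / real d - \<gamma> 0)\<^sup>2 \<partial>M)"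
    by (intro eventually_mono[OF eventually_ge_at_top[of 1]]) (rule sym, blast)
  show ?thesis by (rule Lim_transform_eventually[OF toeplitz_vanishing_mean[OF c0] ev])
qed

text \<open>
  Square summability does not follow from \<open>\<bar>\<gamma> k\<bar> \<le> \<gamma> 0 * \<rho> k\<close> alone, as \<open>\<rho>\<close> may decay very slowly. The products \<open>U k\<close> of
  \<open>V k\<close> with an independent copy have the nonnegative covariances \<open>(\<gamma> (lag i j))\<^sup>2\<close>, so the covariance of two
  separated blocks dominates the sum over all lags between \<open>2 n\<close> and \<open>4 n\<close>; decorrelation bounds the same
  covariance by \<open>\<rho> n\<close> times the size of the whole sum.
\<close>

lemma autocov_square_summable: "summable (\<lambda>k. (\<gamma> k)\<^sup>2)"
proof -
  let ?P = "M \<Otimes>\<^sub>M M"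
  interpret MM: pair_prob_space M M ..
  define U where "U k x = V k (fst x) * V k (snd x)" for k and x :: "'a \<times> 'a"
  define H where "H n = (\<Sum>k\<le>n. (\<gamma> k)\<^sup>2)" for n
  define q where "q F = (\<Sum>i\<in>F. \<Sum>j\<in>F. (\<gamma> (lag i j))\<^sup>2)" for F
  have prod: "integrable ?P (\<lambda>x. f (fst x) * g (snd x)) \<and> (\<integral>x. f (fst x) * g (snd x) \<partial>?P) = (\<integral>x. f x \<partial>M) * (\<integral>x. g x \<partial>M)"
    if "integrable M f" "integrable M g" for f g :: "'a \<Rightarrow> real"
    by (rule pair_integral_product[OF prob_space_axioms prob_space_axioms that])
  have UU: "integrable ?P (\<lambda>x. U i x * U j x)" "(\<integral>x. U i x * U j x \<partial>?P) = (\<gamma> (lag i j))\<^sup>2"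
    if "1 \<le> i" "1 \<le> j" for i j
    using prod[OF integrable_mult[OF that] integrable_mult[OF that]] autocov[OF that]
    by (simp_all add: U_def mult_ac power2_eq_square)
  have U1: "integrable ?P (U i)" "(\<integral>x. U i x \<partial>?P) = 0" if "1 \<le> i" for i
    using prod[OF moment1[OF that] moment1[OF that]] mean[OF that] by (simp_all add: U_def[abs_def])
  have sq: "(\<Sum>i\<in>F. U i x)\<^sup>2 = (\<Sum>i\<in>F. \<Sum>j\<in>F. U i x * U j x)" for F x
    by (simp add: power2_eq_square sum_product)
  have q: "integrable ?P (\<lambda>x. (\<Sum>i\<in>F. U i x)\<^sup>2)" "(\<integral>x. (\<Sum>i\<in>F. U i x)\<^sup>2 \<partial>?P) = q F"
    if F: "F \<subseteq> {1..}" for F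
  proof -
    have ge: "1 \<le> i" if "i \<in> F" for i using F that by auto
    show "integrable ?P (\<lambda>x. (\<Sum>i\<in>F. U i x)\<^sup>2)" "(\<integral>x. (\<Sum>i\<in>F. U i x)\<^sup>2 \<partial>?P) = q F"
      unfolding sq q_def using UU[OF ge ge] by (simp_all add: integral_double_sum)
  qed
  have H_mono: "mono H" unfolding H_def by (intro monoI sum_mono2) auto
  have H0: "0 \<le> H n" for n unfolding H_def by (intro sum_nonneg) auto
  \<comment> \<open>Each lag occurs at most twice in a row of the covariance matrix of a block.\<close>
  have q_le: "q {a..<a+l} \<le> real l * (2 * H l)" for a l
  proof -
    have "(\<Sum>j\<in>{a..<a+l}. (\<gamma> (lag i j))\<^sup>2) \<le> 2 * H l" if i: "i \<in> {a..<a+l}" for i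
    proof -
      have "{a..<a+l} = {a..<i} \<union> {i..<a+l}" using i by auto
      then have "(\<Sum>j\<in>{a..<a+l}. (\<gamma> (lag i j))\<^sup>2) = (\<Sum>j\<in>{a..<i}. (\<gamma> (lag i j))\<^sup>2) + (\<Sum>j\<in>{i..<a+l}. (\<gamma> (lag i j))\<^sup>2)"
        by (simp add: sum.union_disjoint ivl_disj_int)
      also have "(\<Sum>j\<in>{a..<i}. (\<gamma> (lag i j))\<^sup>2) = (\<Sum>k\<in>{1..i-a}. (\<gamma> k)\<^sup>2)"
        by (rule sum.reindex_bij_witness[where i="\<lambda>k. i - k" and j="\<lambda>j. i - j"]) (use i in \<open>auto simp: lag_def\<close>)
      also have "\<dots> \<le> H l" unfolding H_def by (rule sum_mono2) (use i in auto)
      also have "(\<Sum>j\<in>{i..<a+l}. (\<gamma> (lag i j))\<^sup>2) = (\<Sum>k<a+l-i. (\<gamma> k)\<^sup>2)"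
        by (rule sum.reindex_bij_witness[where i="\<lambda>k. i + k" and j="\<lambda>j. j - i"]) (use i in \<open>auto simp: lag_def\<close>)
      also have "\<dots> \<le> H l" unfolding H_def by (rule sum_mono2) (use i in auto)
      finally show ?thesis by simp
    qed
    then have "q {a..<a+l} \<le> (\<Sum>i\<in>{a..<a+l}. 2 * H l)" unfolding q_def by (intro sum_mono) auto
    then show ?thesis by simp
  qed
  have step: "H (4 * n) - H (2 * n) \<le> 8 * rho_coeff M V n * H (4 * n)" if n: "1 \<le> n" for n
  proof -
    let ?a = "{1..<1+n}" and ?b = "{2*n..<2*n + 4*n}"
    let ?f = "\<lambda>x. \<Sum>i\<in>?a. U i x" and ?g = "\<lambda>x. \<Sum>j\<in>?b. U j x"
    let ?A = "generated_algebra M V {1..n}" and ?B = "generated_algebra M V {n+n..}"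
    have ge: "1 \<le> i" if "i \<in> ?a" for i using that by auto
    have geb: "1 \<le> i" if "i \<in> ?b" for i using that n by auto
    have dec: "decorrelated ?P (?A \<Otimes>\<^sub>M ?A) (?B \<Otimes>\<^sub>M ?B) (rho_coeff M V n + rho_coeff M V n)"
      using n by (intro decorrelated_pair prob_space_axioms sub_past sub_future decor rho_nonneg) auto
    have mA: "?f \<in> borel_measurable (?A \<Otimes>\<^sub>M ?A)"
      unfolding U_def by (intro borel_measurable_sum borel_measurable_times measurable_compose[OF measurable_fst]
        measurable_compose[OF measurable_snd] measurable_generated_algebra) auto
    have mB: "?g \<in> borel_measurable (?B \<Otimes>\<^sub>M ?B)"
      unfolding U_def by (intro borel_measurable_sum borel_measurable_times measurable_compose[OF measurable_fst]
        measurable_compose[OF measurable_snd] measurable_generated_algebra) auto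
    have "(\<integral>x. ?f x \<partial>?P) = (\<Sum>i\<in>?a. \<integral>x. U i x \<partial>?P)" by (intro Bochner_Integration.integral_sum U1 ge)
    also have "\<dots> = 0" using U1(2)[OF ge] by (intro sum.neutral) blast
    finally have z: "(\<integral>x. ?f x \<partial>?P) = 0" .
    have fg: "(\<integral>x. ?f x * ?g x \<partial>?P) = (\<Sum>i\<in>?a. \<Sum>j\<in>?b. (\<gamma> (lag i j))\<^sup>2)"
      unfolding sum_product using UU[OF ge geb] by (subst integral_double_sum) (auto intro!: sum.cong)
    have "(\<integral>x. ?f x * ?g x \<partial>?P) \<le> (rho_coeff M V n + rho_coeff M V n) * (sqrt (q ?a) * sqrt (q ?b))"
    proof -
      have ab: "?a \<subseteq> {1..}" "?b \<subseteq> {1..}" using n by auto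
      show ?thesis
        using decorrelatedD[OF dec mA mB q(1)[OF ab(1)] q(1)[OF ab(2)]]
        unfolding z q(2)[OF ab(1)] q(2)[OF ab(2)] by linarith
    qed
    also have "sqrt (q ?a) * sqrt (q ?b) \<le> sqrt (real n * (2 * H (4 * n))) * sqrt (real (4*n) * (2 * H (4 * n)))"
    proof (intro mult_mono real_sqrt_le_mono)
      have "q ?a \<le> real n * (2 * H n)" by (rule q_le)
      also have "\<dots> \<le> real n * (2 * H (4 * n))" using monoD[OF H_mono, of n "4*n"] by (intro mult_left_mono) auto
      finally show "q ?a \<le> real n * (2 * H (4 * n))" .
      show "q ?b \<le> real (4*n) * (2 * H (4 * n))" by (rule q_le)
    qed (auto simp: q_def H0 intro!: sum_nonneg)
    also have "\<dots> = real n * (4 * H (4 * n))"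
    proof -
      have "sqrt (real n * (2 * H (4 * n))) * sqrt (real (4*n) * (2 * H (4 * n))) = sqrt ((real n * (4 * H (4 * n)))\<^sup>2)"
        by (simp add: power2_eq_square flip: real_sqrt_mult)
      then show ?thesis using H0 by simp
    qed
    finally have up: "(\<integral>x. ?f x * ?g x \<partial>?P) \<le> (rho_coeff M V n + rho_coeff M V n) * (real n * (4 * H (4 * n)))"
      using rho_nonneg by (simp add: mult_left_mono)
    \<comment> \<open>Each index of the first block has a partner in the second one at every lag between \<open>2 n\<close> and \<open>4 n\<close>.\<close>
    have "real n * (H (4 * n) - H (2 * n)) = (\<Sum>i\<in>?a. \<Sum>k\<in>{2*n<..4*n}. (\<gamma> k)\<^sup>2)"
    proof -
      have "{..4*n} = {..2*n} \<union> {2*n<..4*n}" by auto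
      then have "H (4 * n) = H (2 * n) + (\<Sum>k\<in>{2*n<..4*n}. (\<gamma> k)\<^sup>2)"
        unfolding H_def by (subst sum.union_disjoint[symmetric]) auto
      then show ?thesis by simp
    qed
    also have "\<dots> \<le> (\<Sum>i\<in>?a. \<Sum>j\<in>?b. (\<gamma> (lag i j))\<^sup>2)"
    proof (rule sum_mono)
      fix i assume i: "i \<in> ?a"
      have "(\<Sum>k\<in>{2*n<..4*n}. (\<gamma> k)\<^sup>2) = (\<Sum>j\<in>{i+2*n<..i+4*n}. (\<gamma> (lag i j))\<^sup>2)"
        by (rule sum.reindex_bij_witness[where i="\<lambda>j. j - i" and j="\<lambda>k. i + k"]) (auto simp: lag_def)
      also have "\<dots> \<le> (\<Sum>j\<in>?b. (\<gamma> (lag i j))\<^sup>2)" by (rule sum_mono2) (use i n in auto)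
      finally show "(\<Sum>k\<in>{2*n<..4*n}. (\<gamma> k)\<^sup>2) \<le> (\<Sum>j\<in>?b. (\<gamma> (lag i j))\<^sup>2)" .
    qed
    finally have "real n * (H (4 * n) - H (2 * n)) \<le> real n * (8 * rho_coeff M V n * H (4 * n))"
      using up fg by (simp add: algebra_simps)
    then show ?thesis using n by simp
  qed
  obtain K where K: "\<And>n. H n \<le> K"
    using dyadic_bound[OF H_mono H0 rho_nonneg step _ rho_sum] by auto
  show ?thesis
  proof (rule summableI_nonneg_bounded)
    fix n
    have "(\<Sum>k<n. (\<gamma> k)\<^sup>2) \<le> H n" unfolding H_def by (rule sum_mono2) auto
    then show "(\<Sum>k<n. (\<gamma> k)\<^sup>2) \<le> K" using K[of n] by linarith
  qed simp
qed

end

section \<open>Convergence in probability\<close>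

context prob_space begin

text \<open>
  The exceptional event is only required to exist. In this way the calculus needs no measurability
  of the property itself, and weakening a property is free.
\<close>

definition likely :: "real \<Rightarrow> (nat \<Rightarrow> 'a \<Rightarrow> bool) \<Rightarrow> bool" where
  "likely \<eta> E \<longleftrightarrow> (\<forall>\<^sub>F d in sequentially. \<exists>A\<in>events. prob A \<le> \<eta> \<and> (\<forall>\<omega>\<in>space M - A. E d \<omega>))"

definition tends_in_prob :: "(nat \<Rightarrow> 'a \<Rightarrow> real) \<Rightarrow> real \<Rightarrow> bool" where
  "tends_in_prob X x \<longleftrightarrow> (\<forall>\<epsilon>>0. \<forall>\<eta>>0. likely \<eta> (\<lambda>d \<omega>. \<bar>X d \<omega> - x\<bar> < \<epsilon>))"

definition tight_seq :: "(nat \<Rightarrow> 'a \<Rightarrow> real) \<Rightarrow> bool" where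
  "tight_seq X \<longleftrightarrow> (\<forall>\<eta>>0. \<exists>L>0. likely \<eta> (\<lambda>d \<omega>. \<bar>X d \<omega>\<bar> \<le> L))"

definition tends_to_infinity_in_prob :: "(nat \<Rightarrow> 'a \<Rightarrow> real) \<Rightarrow> bool" where
  "tends_to_infinity_in_prob X \<longleftrightarrow> (\<forall>L. \<forall>\<eta>>0. likely \<eta> (\<lambda>d \<omega>. L < X d \<omega>))"

lemma likely_mono:
  assumes "likely \<eta> E" "\<forall>\<^sub>F d in sequentially. \<forall>\<omega>\<in>space M. E d \<omega> \<longrightarrow> F d \<omega>"
  shows "likely \<eta> F"
  using assms unfolding likely_def by (rule eventually_elim2) (meson DiffE)

lemma likely_imp:
  assumes "likely \<eta> E" "\<And>d \<omega>. E d \<omega> \<Longrightarrow> F d \<omega>"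
  shows "likely \<eta> F"
  by (rule likely_mono[OF assms(1)]) (use assms(2) in auto)

lemma tends_in_probD: "tends_in_prob X x \<Longrightarrow> 0 < \<epsilon> \<Longrightarrow> 0 < \<eta> \<Longrightarrow> likely \<eta> (\<lambda>d \<omega>. \<bar>X d \<omega> - x\<bar> < \<epsilon>)"
  unfolding tends_in_prob_def by blast

lemma likely_conj:
  assumes "likely \<eta> E" "likely \<eta>' F"
  shows "likely (\<eta> + \<eta>') (\<lambda>d \<omega>. E d \<omega> \<and> F d \<omega>)"
  using assms unfolding likely_def
proof (rule eventually_elim2)
  fix d assume "\<exists>A\<in>events. prob A \<le> \<eta> \<and> (\<forall>\<omega>\<in>space M - A. E d \<omega>)" "\<exists>A\<in>events. prob A \<le> \<eta>' \<and> (\<forall>\<omega>\<in>space M - A. F d \<omega>)"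
  then obtain A B where A: "A \<in> events" "prob A \<le> \<eta>" "\<forall>\<omega>\<in>space M - A. E d \<omega>"
    and B: "B \<in> events" "prob B \<le> \<eta>'" "\<forall>\<omega>\<in>space M - B. F d \<omega>" by blast
  have "prob (A \<union> B) \<le> \<eta> + \<eta>'" using measure_Un_le[OF A(1) B(1)] A(2) B(2) by linarith
  then show "\<exists>C\<in>events. prob C \<le> \<eta> + \<eta>' \<and> (\<forall>\<omega>\<in>space M - C. E d \<omega> \<and> F d \<omega>)"
    using A B by (intro bexI[of _ "A \<union> B"]) auto
qed

lemma likely_prob_le:
  assumes "likely \<eta> E" "\<And>d. {\<omega>\<in>space M. \<not> E d \<omega>} \<in> events"
  shows "\<forall>\<^sub>F d in sequentially. prob {\<omega>\<in>space M. \<not> E d \<omega>} \<le> \<eta>"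
  using assms(1) unfolding likely_def
proof (rule eventually_mono)
  fix d assume "\<exists>A\<in>events. prob A \<le> \<eta> \<and> (\<forall>\<omega>\<in>space M - A. E d \<omega>)"
  then obtain A where A: "A \<in> events" "prob A \<le> \<eta>" "\<forall>\<omega>\<in>space M - A. E d \<omega>" by blast
  have "prob {\<omega>\<in>space M. \<not> E d \<omega>} \<le> prob A" using A by (intro finite_measure_mono) auto
  then show "prob {\<omega>\<in>space M. \<not> E d \<omega>} \<le> \<eta>" using A by simp
qed

lemma chebyshev_likely:
  assumes X: "\<And>d. X d \<in> borel_measurable M" "\<And>d. integrable M (\<lambda>\<omega>. (X d \<omega>)\<^sup>2)"
    and L: "0 < L" and b: "\<forall>\<^sub>F d in sequentially. (\<integral>\<omega>. (X d \<omega>)\<^sup>2 \<partial>M) \<le> \<eta> * L\<^sup>2"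
  shows "likely \<eta> (\<lambda>d \<omega>. \<bar>X d \<omega>\<bar> < (L :: real))"
  unfolding likely_def using b
proof (rule eventually_mono)
  fix d assume b: "(\<integral>\<omega>. (X d \<omega>)\<^sup>2 \<partial>M) \<le> \<eta> * L\<^sup>2"
  note [measurable] = X(1)
  have "prob {\<omega>\<in>space M. L\<^sup>2 \<le> (X d \<omega>)\<^sup>2} \<le> (\<integral>\<omega>. (X d \<omega>)\<^sup>2 \<partial>M) / L\<^sup>2"
    by (rule integral_Markov_inequality_measure[where A="space M - space M"]) (use X L in auto)
  also have "\<dots> \<le> \<eta>" using b L by (simp add: divide_le_eq)
  finally have "prob {\<omega>\<in>space M. L\<^sup>2 \<le> (X d \<omega>)\<^sup>2} \<le> \<eta>" .
  moreover have "\<bar>X d \<omega>\<bar> < L" if "\<not> L\<^sup>2 \<le> (X d \<omega>)\<^sup>2" for \<omega>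
  proof -
    have "\<bar>X d \<omega>\<bar>\<^sup>2 < L\<^sup>2" using that by simp
    then show ?thesis using L by (intro power_less_imp_less_base[of _ 2 L]) auto
  qed
  ultimately show "\<exists>A\<in>events. prob A \<le> \<eta> \<and> (\<forall>\<omega>\<in>space M - A. \<bar>X d \<omega>\<bar> < L)"
    by (intro bexI[of _ "{\<omega>\<in>space M. L\<^sup>2 \<le> (X d \<omega>)\<^sup>2}"]) auto
qed

lemma tends_in_prob_L2:
  assumes "\<And>d. X d \<in> borel_measurable M" "\<And>d. integrable M (\<lambda>\<omega>. (X d \<omega>)\<^sup>2)"
    and "(\<lambda>d. \<integral>\<omega>. (X d \<omega>)\<^sup>2 \<partial>M) \<longlonglongrightarrow> 0"
  shows "tends_in_prob X 0"
  unfolding tends_in_prob_def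
proof (intro allI impI)
  fix \<epsilon> \<eta> :: real assume e: "0 < \<epsilon>" "0 < \<eta>"
  have "\<forall>\<^sub>F d in sequentially. (\<integral>\<omega>. (X d \<omega>)\<^sup>2 \<partial>M) < \<eta> * \<epsilon>\<^sup>2"
    by (rule order_tendstoD(2)[OF assms(3)]) (use e in auto)
  then have "likely \<eta> (\<lambda>d \<omega>. \<bar>X d \<omega>\<bar> < \<epsilon>)"
    by (intro chebyshev_likely assms e) (auto elim: eventually_mono)
  then show "likely \<eta> (\<lambda>d \<omega>. \<bar>X d \<omega> - 0\<bar> < \<epsilon>)" by simp
qed

lemma tight_seq_L2:
  assumes "\<And>d. X d \<in> borel_measurable M" "\<And>d. integrable M (\<lambda>\<omega>. (X d \<omega>)\<^sup>2)"
    and "\<forall>\<^sub>F d in sequentially. (\<integral>\<omega>. (X d \<omega>)\<^sup>2 \<partial>M) \<le> C"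
  shows "tight_seq X"
  unfolding tight_seq_def
proof (intro allI impI)
  fix \<eta> :: real assume \<eta>: "0 < \<eta>"
  define L where "L = sqrt (\<bar>C\<bar> / \<eta>) + 1"
  have L: "0 < L" using \<eta> by (auto simp: L_def intro!: add_nonneg_pos)
  have "\<bar>C\<bar> / \<eta> = (sqrt (\<bar>C\<bar> / \<eta>))\<^sup>2" using \<eta> by simp
  also have "\<dots> \<le> L\<^sup>2" unfolding L_def using \<eta> by (intro power_mono) auto
  finally have "C \<le> \<eta> * L\<^sup>2" using \<eta> by (simp add: divide_le_eq mult.commute)
  then have "likely \<eta> (\<lambda>d \<omega>. \<bar>X d \<omega>\<bar> < L)"
    by (intro chebyshev_likely assms L eventually_mono[OF assms(3)]) simp
  then have "likely \<eta> (\<lambda>d \<omega>. \<bar>X d \<omega>\<bar> \<le> L)" by (rule likely_mono) auto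
  then show "\<exists>L>0. likely \<eta> (\<lambda>d \<omega>. \<bar>X d \<omega>\<bar> \<le> L)" using L by blast
qed

lemma tends_in_prob_const:
  assumes "c \<longlonglongrightarrow> x" shows "tends_in_prob (\<lambda>d _. c d) x"
  unfolding tends_in_prob_def
proof (intro allI impI)
  fix \<epsilon> \<eta> :: real assume e: "0 < \<epsilon>" "0 < \<eta>"
  show "likely \<eta> (\<lambda>d \<omega>. \<bar>c d - x\<bar> < \<epsilon>)" unfolding likely_def
    using tendstoD[OF assms e(1)] by (rule eventually_mono) (use e in \<open>auto intro!: bexI[of _ "{}"] simp: dist_real_def\<close>)
qed

text \<open>
  Stated for two arguments, so that sums, products and quotients are all instances.
\<close>

lemma tends_in_prob_continuous2:
  fixes f :: "real \<Rightarrow> real \<Rightarrow> real"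
  assumes X: "tends_in_prob X x" and Y: "tends_in_prob Y y"
    and f: "isCont (\<lambda>p. f (fst p) (snd p)) (x, y)"
  shows "tends_in_prob (\<lambda>d \<omega>. f (X d \<omega>) (Y d \<omega>)) (f x y)"
  unfolding tends_in_prob_def
proof (intro allI impI)
  fix \<epsilon> \<eta> :: real assume e: "0 < \<epsilon>" "0 < \<eta>"
  obtain \<delta> where \<delta>: "0 < \<delta>" "\<And>p. dist p (x, y) < \<delta> \<Longrightarrow> dist (f (fst p) (snd p)) (f x y) < \<epsilon>"
    using f e(1) unfolding continuous_at_eps_delta by (metis fst_conv snd_conv)
  have "likely (\<eta>/2 + \<eta>/2) (\<lambda>d \<omega>. \<bar>X d \<omega> - x\<bar> < \<delta>/2 \<and> \<bar>Y d \<omega> - y\<bar> < \<delta>/2)"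
    using \<delta>(1) e by (intro likely_conj tends_in_probD[OF X] tends_in_probD[OF Y]) auto
  then have "likely (\<eta>/2 + \<eta>/2) (\<lambda>d \<omega>. \<bar>f (X d \<omega>) (Y d \<omega>) - f x y\<bar> < \<epsilon>)"
  proof (rule likely_mono, intro always_eventually allI ballI impI)
    fix d \<omega> assume a: "\<bar>X d \<omega> - x\<bar> < \<delta>/2 \<and> \<bar>Y d \<omega> - y\<bar> < \<delta>/2"
    have "dist (X d \<omega>, Y d \<omega>) (x, y) \<le> \<bar>X d \<omega> - x\<bar> + \<bar>Y d \<omega> - y\<bar>"
      unfolding dist_prod_def using sqrt_sum_squares_le_sum_abs[of "X d \<omega> - x" "Y d \<omega> - y"] by (simp add: dist_real_def)
    also have "\<dots> < \<delta>" using a by linarith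
    finally show "\<bar>f (X d \<omega>) (Y d \<omega>) - f x y\<bar> < \<epsilon>" using \<delta>(2)[of "(X d \<omega>, Y d \<omega>)"] by (simp add: dist_real_def)
  qed
  then show "likely \<eta> (\<lambda>d \<omega>. \<bar>f (X d \<omega>) (Y d \<omega>) - f x y\<bar> < \<epsilon>)" by simp
qed

lemma tends_in_prob_add:
  assumes "tends_in_prob X x" "tends_in_prob Y y"
  shows "tends_in_prob (\<lambda>d \<omega>. X d \<omega> + Y d \<omega>) (x + y)"
  by (rule tends_in_prob_continuous2[OF assms, of "(+)"]) (intro continuous_intros)

lemma tends_in_prob_mult:
  assumes "tends_in_prob X x" "tends_in_prob Y y"
  shows "tends_in_prob (\<lambda>d \<omega>. X d \<omega> * Y d \<omega>) (x * y)"
  by (rule tends_in_prob_continuous2[OF assms, of "(*)"]) (intro continuous_intros)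

lemma tends_in_prob_sum:
  assumes "finite F" "\<And>i. i \<in> F \<Longrightarrow> tends_in_prob (X i) (x i)"
  shows "tends_in_prob (\<lambda>d \<omega>. \<Sum>i\<in>F. X i d \<omega>) (\<Sum>i\<in>F. x i)"
  using assms
proof (induction F rule: finite_induct)
  case empty
  then show ?case using tends_in_prob_const[of "\<lambda>_. 0" 0] by simp
qed (simp add: tends_in_prob_add)

lemma tends_in_prob_imp_tight:
  assumes "tends_in_prob X x" shows "tight_seq X"
  unfolding tight_seq_def
proof (intro allI impI)
  fix \<eta> :: real assume "0 < \<eta>"
  then have "likely \<eta> (\<lambda>d \<omega>. \<bar>X d \<omega> - x\<bar> < 1)" using assms unfolding tends_in_prob_def by simp
  then have "likely \<eta> (\<lambda>d \<omega>. \<bar>X d \<omega>\<bar> \<le> \<bar>x\<bar> + 1)" by (rule likely_imp) linarith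
  then show "\<exists>L>0. likely \<eta> (\<lambda>d \<omega>. \<bar>X d \<omega>\<bar> \<le> L)" by (intro exI[of _ "\<bar>x\<bar> + 1"]) auto
qed

lemma tight_seq_add:
  assumes "tight_seq X" "tight_seq Y" shows "tight_seq (\<lambda>d \<omega>. X d \<omega> + Y d \<omega>)"
  unfolding tight_seq_def
proof (intro allI impI)
  fix \<eta> :: real assume "0 < \<eta>"
  then have "0 < \<eta>/2" by simp
  then obtain L L' where L: "0 < L" "0 < L'" "likely (\<eta>/2) (\<lambda>d \<omega>. \<bar>X d \<omega>\<bar> \<le> L)" "likely (\<eta>/2) (\<lambda>d \<omega>. \<bar>Y d \<omega>\<bar> \<le> L')"
    using assms unfolding tight_seq_def by blast
  have "likely (\<eta>/2 + \<eta>/2) (\<lambda>d \<omega>. \<bar>X d \<omega> + Y d \<omega>\<bar> \<le> L + L')"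
    by (rule likely_imp[OF likely_conj[OF L(3,4)]]) linarith
  then show "\<exists>L>0. likely \<eta> (\<lambda>d \<omega>. \<bar>X d \<omega> + Y d \<omega>\<bar> \<le> L)" using L by (intro exI[of _ "L + L'"]) simp
qed

lemma tends_in_prob_mult_tight:
  assumes X: "tends_in_prob X 0" and T: "tight_seq T"
  shows "tends_in_prob (\<lambda>d \<omega>. X d \<omega> * T d \<omega>) 0"
  unfolding tends_in_prob_def
proof (intro allI impI)
  fix \<epsilon> \<eta> :: real assume e: "0 < \<epsilon>" "0 < \<eta>"
  then have "0 < \<eta>/2" by simp
  then obtain L where L: "0 < L" "likely (\<eta>/2) (\<lambda>d \<omega>. \<bar>T d \<omega>\<bar> \<le> L)" using T unfolding tight_seq_def by blast
  have "likely (\<eta>/2 + \<eta>/2) (\<lambda>d \<omega>. \<bar>X d \<omega> - 0\<bar> < \<epsilon> / L \<and> \<bar>T d \<omega>\<bar> \<le> L)"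
    using L e by (intro likely_conj tends_in_probD[OF X]) auto
  then have "likely (\<eta>/2 + \<eta>/2) (\<lambda>d \<omega>. \<bar>X d \<omega> * T d \<omega> - 0\<bar> < \<epsilon>)"
  proof (rule likely_mono, intro always_eventually allI ballI impI)
    fix d \<omega> assume a: "\<bar>X d \<omega> - 0\<bar> < \<epsilon> / L \<and> \<bar>T d \<omega>\<bar> \<le> L"
    have "\<bar>X d \<omega> * T d \<omega>\<bar> \<le> \<bar>X d \<omega>\<bar> * L" unfolding abs_mult using a by (intro mult_left_mono) auto
    also have "\<dots> < \<epsilon> / L * L" using a L by (intro mult_strict_right_mono) auto
    finally show "\<bar>X d \<omega> * T d \<omega> - 0\<bar> < \<epsilon>" using L by simp
  qed
  then show "likely \<eta> (\<lambda>d \<omega>. \<bar>X d \<omega> * T d \<omega> - 0\<bar> < \<epsilon>)" by simp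
qed

text \<open>
  Off the event that \<open>B - A\<close> deviates from \<open>c\<close> by more than \<open>\<delta>/2\<close>, the event \<open>B > x\<close> lies between the
  events \<open>A > x - c + \<delta>/2\<close> and \<open>A > x - c - \<delta>/2\<close>.
\<close>

lemma slutsky:
  assumes A: "\<And>d. A d \<in> borel_measurable M" and B: "\<And>d. B d \<in> borel_measurable M"
    and lim: "\<And>x. (\<lambda>d. prob {\<omega>\<in>space M. A d \<omega> > x}) \<longlonglongrightarrow> G x"
    and G: "isCont G (x - c)"
    and d: "tends_in_prob (\<lambda>d \<omega>. B d \<omega> - A d \<omega>) c"
  shows "(\<lambda>d. prob {\<omega>\<in>space M. B d \<omega> > x}) \<longlonglongrightarrow> G (x - c)"
proof (rule LIMSEQ_I)
  note [measurable] = A B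
  fix e :: real assume e: "0 < e"
  obtain \<delta> where \<delta>: "0 < \<delta>" "\<And>y. \<bar>y - (x - c)\<bar> < \<delta> \<Longrightarrow> \<bar>G y - G (x - c)\<bar> < e/4"
    using G e unfolding continuous_at_eps_delta dist_real_def by (metis zero_less_divide_iff zero_less_numeral)
  let ?lo = "x - c - \<delta>/2" and ?hi = "x - c + \<delta>/2"
  let ?bad = "\<lambda>d. {\<omega>\<in>space M. \<not> \<bar>B d \<omega> - A d \<omega> - c\<bar> < \<delta>/2}"
  have "likely (e/4) (\<lambda>d \<omega>. \<bar>B d \<omega> - A d \<omega> - c\<bar> < \<delta>/2)"
    by (rule tends_in_probD[OF d]) (use \<delta> e in auto)
  then have "\<forall>\<^sub>F d in sequentially. prob (?bad d) \<le> e/4"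
    by (rule likely_prob_le) measurable
  moreover have "\<forall>\<^sub>F d in sequentially. \<bar>prob {\<omega>\<in>space M. A d \<omega> > ?lo} - G ?lo\<bar> < e/4"
    using tendstoD[OF lim[of ?lo], of "e/4"] e by (simp add: dist_real_def)
  moreover have "\<forall>\<^sub>F d in sequentially. \<bar>prob {\<omega>\<in>space M. A d \<omega> > ?hi} - G ?hi\<bar> < e/4"
    using tendstoD[OF lim[of ?hi], of "e/4"] e by (simp add: dist_real_def)
  ultimately have "\<forall>\<^sub>F d in sequentially. norm (prob {\<omega>\<in>space M. B d \<omega> > x} - G (x - c)) < e"
  proof eventually_elim
    case (elim d)
    have "prob {\<omega>\<in>space M. B d \<omega> > x} \<le> prob ({\<omega>\<in>space M. A d \<omega> > ?lo} \<union> ?bad d)"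
      by (intro finite_measure_mono) (auto simp: abs_if split: if_splits)
    also have "\<dots> \<le> prob {\<omega>\<in>space M. A d \<omega> > ?lo} + prob (?bad d)" by (rule measure_Un_le) measurable
    finally have up: "prob {\<omega>\<in>space M. B d \<omega> > x} \<le> prob {\<omega>\<in>space M. A d \<omega> > ?lo} + prob (?bad d)" .
    have "prob {\<omega>\<in>space M. A d \<omega> > ?hi} \<le> prob ({\<omega>\<in>space M. B d \<omega> > x} \<union> ?bad d)"
      by (intro finite_measure_mono) (auto simp: abs_if split: if_splits)
    also have "\<dots> \<le> prob {\<omega>\<in>space M. B d \<omega> > x} + prob (?bad d)" by (rule measure_Un_le) measurable
    finally have lo: "prob {\<omega>\<in>space M. A d \<omega> > ?hi} \<le> prob {\<omega>\<in>space M. B d \<omega> > x} + prob (?bad d)" .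
    have "\<bar>G ?lo - G (x - c)\<bar> < e/4" "\<bar>G ?hi - G (x - c)\<bar> < e/4" using \<delta> by auto
    then show ?case using up lo elim unfolding real_norm_def by linarith
  qed
  then show "\<exists>no. \<forall>d\<ge>no. norm (prob {\<omega>\<in>space M. B d \<omega> > x} - G (x - c)) < e"
    unfolding eventually_sequentially .
qed

lemma tends_to_infinity_prob:
  assumes B: "\<And>d. B d \<in> borel_measurable M" and inf: "tends_to_infinity_in_prob B"
  shows "(\<lambda>d. prob {\<omega>\<in>space M. B d \<omega> > x}) \<longlonglongrightarrow> 1"
proof (rule LIMSEQ_I)
  note [measurable] = B
  fix e :: real assume e: "0 < e"
  have "likely (e/2) (\<lambda>d \<omega>. x < B d \<omega>)" using inf e unfolding tends_to_infinity_in_prob_def by simp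
  then have "\<forall>\<^sub>F d in sequentially. prob {\<omega>\<in>space M. \<not> x < B d \<omega>} \<le> e/2" by (rule likely_prob_le) measurable
  then have "\<forall>\<^sub>F d in sequentially. norm (prob {\<omega>\<in>space M. B d \<omega> > x} - 1) < e"
  proof eventually_elim
    case (elim d)
    have "prob {\<omega>\<in>space M. \<not> x < B d \<omega>} = 1 - prob {\<omega>\<in>space M. x < B d \<omega>}"
      by (rule prob_neg) measurable
    then show ?case using elim e by simp
  qed
  then show "\<exists>no. \<forall>d\<ge>no. norm (prob {\<omega>\<in>space M. B d \<omega> > x} - 1) < e"
    unfolding eventually_sequentially .
qed

end

context prob_space begin

lemma tends_in_prob_diff:
  assumes "tends_in_prob X x" "tends_in_prob Y y"
  shows "tends_in_prob (\<lambda>d \<omega>. X d \<omega> - Y d \<omega>) (x - y)"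
  by (rule tends_in_prob_continuous2[OF assms, of "(-)"]) (intro continuous_intros)

lemma tight_seq_diff:
  assumes "tight_seq X" "tight_seq Y" shows "tight_seq (\<lambda>d \<omega>. X d \<omega> - Y d \<omega>)"
proof -
  have "tight_seq (\<lambda>d \<omega>. - Y d \<omega>)" using assms(2) unfolding tight_seq_def by simp
  from tight_seq_add[OF assms(1) this] show ?thesis by simp
qed

lemma tends_in_prob_cong:
  assumes "tends_in_prob X x" "\<forall>\<^sub>F d in sequentially. \<forall>\<omega>\<in>space M. X d \<omega> = Y d \<omega>"
  shows "tends_in_prob Y x"
  unfolding tends_in_prob_def
proof (intro allI impI)
  fix \<epsilon> \<eta> :: real assume "0 < \<epsilon>" "0 < \<eta>"
  then have "likely \<eta> (\<lambda>d \<omega>. \<bar>X d \<omega> - x\<bar> < \<epsilon>)" by (rule tends_in_probD[OF assms(1)])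
  then show "likely \<eta> (\<lambda>d \<omega>. \<bar>Y d \<omega> - x\<bar> < \<epsilon>)"
    by (rule likely_mono) (use assms(2) in \<open>auto elim!: eventually_mono\<close>)
qed

lemma tends_to_infinityI:
  assumes r: "filterlim r at_top sequentially" and le: "\<And>\<eta>. 0 < \<eta> \<Longrightarrow> likely \<eta> (\<lambda>d \<omega>. r d \<le> X d \<omega>)"
  shows "tends_to_infinity_in_prob X"
  unfolding tends_to_infinity_in_prob_def
proof (intro allI impI)
  fix L \<eta> :: real assume "0 < \<eta>"
  then have "likely \<eta> (\<lambda>d \<omega>. r d \<le> X d \<omega>)" by (rule le)
  then show "likely \<eta> (\<lambda>d \<omega>. L < X d \<omega>)"
    by (rule likely_mono) (use r[unfolded filterlim_at_top_dense, rule_format, of L] in \<open>auto elim!: eventually_mono\<close>)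
qed

lemma tends_to_infinity_average:
  assumes F: "finite F" "F \<noteq> {}" and X: "\<And>i. i \<in> F \<Longrightarrow> tends_to_infinity_in_prob (X i)"
  shows "tends_to_infinity_in_prob (\<lambda>d \<omega>. 1 / real (card F) * (\<Sum>i\<in>F. X i d \<omega>))"
  unfolding tends_to_infinity_in_prob_def
proof (intro allI impI)
  fix L \<eta> :: real assume \<eta>: "0 < \<eta>"
  have "likely (real (card G) * \<eta>') (\<lambda>d \<omega>. \<forall>i\<in>G. L < X i d \<omega>)" if "finite G" "G \<subseteq> F" "0 < \<eta>'" for G \<eta>'
    using that
  proof (induction G rule: finite_induct)
    case empty
    then show ?case unfolding likely_def by (auto intro!: bexI[of _ "{}"])
  next
    case (insert i G)
    have "likely (\<eta>' + real (card G) * \<eta>') (\<lambda>d \<omega>. L < X i d \<omega> \<and> (\<forall>i\<in>G. L < X i d \<omega>))"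
      by (rule likely_conj) (use insert X in \<open>auto simp: tends_to_infinity_in_prob_def\<close>)
    then show ?case using insert by (simp add: algebra_simps)
  qed
  from this[of F "\<eta> / real (card F)"] have "likely \<eta> (\<lambda>d \<omega>. \<forall>i\<in>F. L < X i d \<omega>)"
    using F \<eta> by (simp add: card_gt_0_iff)
  then show "likely \<eta> (\<lambda>d \<omega>. L < 1 / real (card F) * (\<Sum>i\<in>F. X i d \<omega>))"
  proof (rule likely_imp)
    fix d \<omega> assume a: "\<forall>i\<in>F. L < X i d \<omega>"
    have "real (card F) * L < (\<Sum>i\<in>F. X i d \<omega>)"
      using sum_strict_mono[OF F, of "\<lambda>_. L" "\<lambda>i. X i d \<omega>"] a by simp
    then show "L < 1 / real (card F) * (\<Sum>i\<in>F. X i d \<omega>)"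
      using F by (simp add: card_gt_0_iff field_simps)
  qed
qed

lemma tends_to_infinity_scaled:
  assumes X: "tends_to_infinity_in_prob X" and c: "c \<longlonglongrightarrow> K" "0 < K"
  shows "tends_to_infinity_in_prob (\<lambda>d \<omega>. c d * X d \<omega>)"
  unfolding tends_to_infinity_in_prob_def
proof (intro allI impI)
  fix L \<eta> :: real assume "0 < \<eta>"
  then have "likely \<eta> (\<lambda>d \<omega>. \<bar>L\<bar> / (K/2) < X d \<omega>)" using X unfolding tends_to_infinity_in_prob_def by blast
  then show "likely \<eta> (\<lambda>d \<omega>. L < c d * X d \<omega>)"
  proof (rule likely_mono)
    have "\<forall>\<^sub>F d in sequentially. K/2 < c d" by (rule order_tendstoD(1)[OF c(1)]) (use c in simp)
    then show "\<forall>\<^sub>F d in sequentially. \<forall>\<omega>\<in>space M. \<bar>L\<bar> / (K/2) < X d \<omega> \<longrightarrow> L < c d * X d \<omega>"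
    proof (rule eventually_mono, intro ballI impI)
      fix d \<omega> assume a: "K/2 < c d" "\<bar>L\<bar> / (K/2) < X d \<omega>"
      have "0 \<le> \<bar>L\<bar> / (K/2)" using c by simp
      then have x: "0 < X d \<omega>" using a(2) by linarith
      have "\<bar>L\<bar> < K/2 * X d \<omega>" using a(2) c(2) by (simp add: divide_less_eq mult.commute)
      also have "\<dots> < c d * X d \<omega>" using a(1) x by (rule mult_strict_right_mono)
      finally show "L < c d * X d \<omega>" by simp
    qed
  qed
qed

end

section \<open>Quadratic forms in independent copies\<close>

text \<open>
  Both sides agree on finite-dimensional rectangles. The maps may differ from one coordinate to the next, as is needed for
  two samples with different laws.
\<close>

lemma distr_PiM_coordinatewise:
  assumes I: "finite I" and M: "\<And>i. i \<in> I \<Longrightarrow> prob_space (M i)"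
    and f: "\<And>i. i \<in> I \<Longrightarrow> f i \<in> measurable (M i) (N i)"
  shows "distr (PiM I M) (PiM I N) (\<lambda>\<omega>. \<lambda>i\<in>I. f i (\<omega> i)) = PiM I (\<lambda>i. distr (M i) (N i) (f i))"
proof (rule measure_eqI_PiM_infinite[where M=N and I=I])
  have m: "(\<lambda>\<omega>. \<lambda>i\<in>I. f i (\<omega> i)) \<in> measurable (PiM I M) (PiM I N)"
  proof (rule measurable_restrict)
    fix i assume i: "i \<in> I"
    show "(\<lambda>\<omega>. f i (\<omega> i)) \<in> measurable (PiM I M) (N i)"
      by (rule measurable_compose[OF measurable_component_singleton[OF i, of M] f[OF i]])
  qed
  interpret P: prob_space "PiM I M" by (rule prob_space_PiM[OF M])
  show "finite_measure (distr (PiM I M) (PiM I N) (\<lambda>\<omega>. \<lambda>i\<in>I. f i (\<omega> i)))"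
    using P.prob_space_distr[OF m] by (rule prob_space.finite_measure)
  show "sets (PiM I (\<lambda>i. distr (M i) (N i) (f i))) = sets (PiM I N)" by (intro sets_PiM_cong) auto
  fix A J assume J: "finite J" "J \<subseteq> I" and A: "\<And>i. i \<in> J \<Longrightarrow> A i \<in> sets (N i)"
  have pe: "prod_emb I (\<lambda>i. distr (M i) (N i) (f i)) J (Pi\<^sub>E J A) = prod_emb I N J (Pi\<^sub>E J A)"
    by (simp add: prod_emb_def)
  have "(\<lambda>\<omega>. \<lambda>i\<in>I. f i (\<omega> i)) -` prod_emb I N J (Pi\<^sub>E J A) \<inter> space (PiM I M)
      = prod_emb I M J (\<Pi>\<^sub>E j\<in>J. f j -` A j \<inter> space (M j))"
    using J measurable_space[OF f] by (auto simp: prod_emb_def space_PiM PiE_iff Pi_iff subset_eq)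
  then have "emeasure (distr (PiM I M) (PiM I N) (\<lambda>\<omega>. \<lambda>i\<in>I. f i (\<omega> i))) (prod_emb I N J (Pi\<^sub>E J A))
      = emeasure (PiM I M) (prod_emb I M J (\<Pi>\<^sub>E j\<in>J. f j -` A j \<inter> space (M j)))"
    using J A by (subst emeasure_distr[OF m]) (auto intro!: sets_PiM_I)
  also have "\<dots> = (\<Prod>j\<in>J. emeasure (M j) (f j -` A j \<inter> space (M j)))"
    using J A f by (intro emeasure_PiM_emb M measurable_sets) auto
  also have "\<dots> = (\<Prod>j\<in>J. emeasure (distr (M j) (N j) (f j)) (A j))"
    using J A f by (intro prod.cong) (auto simp: emeasure_distr)
  also have "\<dots> = emeasure (PiM I (\<lambda>i. distr (M i) (N i) (f i))) (prod_emb I N J (Pi\<^sub>E J A))"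
    unfolding pe[symmetric] using J A f M by (intro emeasure_PiM_emb[symmetric] prob_space.prob_space_distr) auto
  finally show "emeasure (distr (PiM I M) (PiM I N) (\<lambda>\<omega>. \<lambda>i\<in>I. f i (\<omega> i))) (prod_emb I N J (Pi\<^sub>E J A))
    = emeasure (PiM I (\<lambda>i. distr (M i) (N i) (f i))) (prod_emb I N J (Pi\<^sub>E J A))" .
qed simp

text \<open>
  The coordinate \<open>a\<close> of the product space carries an independent copy of the sequence \<open>U a\<close>.
\<close>

locale independent_samples =
  fixes M :: "'a measure" and I :: "'i set" and U :: "'i \<Rightarrow> nat \<Rightarrow> 'a \<Rightarrow> real"
  assumes finI: "finite I" and Mp: "prob_space M"
    and sm: "\<And>a. a \<in> I \<Longrightarrow> stationary_mixing M (U a)"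
begin

abbreviation P :: "('i \<Rightarrow> 'a) measure" where "P \<equiv> PiM I (\<lambda>_. M)"

sublocale P: prob_space P by (rule prob_space_PiM[OF Mp])

lemma product_sigma_finite_const: "product_sigma_finite (\<lambda>_ :: 'i. M)"
  using Mp by (simp add: product_sigma_finite_def prob_space_imp_sigma_finite)

definition u :: "'i \<Rightarrow> nat \<Rightarrow> ('i \<Rightarrow> 'a) \<Rightarrow> real" where "u a k \<omega> = U a k (\<omega> a)"

text \<open>
  The autocovariance function of the sequence at coordinate \<open>a\<close>.
\<close>

definition acov :: "'i \<Rightarrow> nat \<Rightarrow> real" where "acov a = stationary_mixing.\<gamma> M (U a)"

lemma U_rv: "a \<in> I \<Longrightarrow> 1 \<le> k \<Longrightarrow> U a k \<in> borel_measurable M"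
  using stationary_mixing.rv[OF sm] .

lemma component_rv: "a \<in> I \<Longrightarrow> f \<in> measurable M N \<Longrightarrow> (\<lambda>\<omega>. f (\<omega> a)) \<in> measurable P N"
  by (rule measurable_compose[OF measurable_component_singleton])

lemma u_rv: "a \<in> I \<Longrightarrow> 1 \<le> k \<Longrightarrow> u a k \<in> borel_measurable P"
  unfolding u_def by (intro component_rv U_rv)

lemma component_integral:
  fixes f :: "'a \<Rightarrow> real"
  assumes "a \<in> I" and f: "f \<in> borel_measurable M"
  shows "(\<integral>\<omega>. f (\<omega> a) \<partial>P) = (\<integral>x. f x \<partial>M)" "integrable P (\<lambda>\<omega>. f (\<omega> a)) \<longleftrightarrow> integrable M f"
proof -
  have d: "distr P M (\<lambda>\<omega>. \<omega> a) = M" by (rule distr_PiM_component[OF Mp assms(1)])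
  have m: "(\<lambda>\<omega>. \<omega> a) \<in> measurable P M" using assms by simp
  show "(\<integral>\<omega>. f (\<omega> a) \<partial>P) = (\<integral>x. f x \<partial>M)" using integral_distr[OF m f] unfolding d by simp
  show "integrable P (\<lambda>\<omega>. f (\<omega> a)) \<longleftrightarrow> integrable M f" using integrable_distr_eq[OF m f] unfolding d by simp
qed

lemma product_expectation:
  fixes f :: "'i \<Rightarrow> 'a \<Rightarrow> real"
  assumes S: "S \<subseteq> I" and f: "\<And>c. c \<in> S \<Longrightarrow> integrable M (f c)"
  shows "integrable P (\<lambda>\<omega>. \<Prod>c\<in>S. f c (\<omega> c))" "(\<integral>\<omega>. (\<Prod>c\<in>S. f c (\<omega> c)) \<partial>P) = (\<Prod>c\<in>S. \<integral>x. f c x \<partial>M)"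
proof -
  define h where "h c = (if c \<in> S then f c else (\<lambda>_. 1))" for c
  have h: "integrable M (h c)" for c
  proof (cases "c \<in> S")
    case False
    interpret prob_space M by (rule Mp)
    show ?thesis using False by (simp add: h_def)
  qed (simp add: h_def f)
  have eq: "(\<Prod>c\<in>I. h c (\<omega> c)) = (\<Prod>c\<in>S. f c (\<omega> c))" for \<omega>
    by (rule prod.mono_neutral_cong_right) (use finI S in \<open>auto simp: h_def\<close>)
  have eq2: "(\<Prod>c\<in>I. \<integral>x. h c x \<partial>M) = (\<Prod>c\<in>S. \<integral>x. f c x \<partial>M)"
    by (rule prod.mono_neutral_cong_right) (use finI S in \<open>auto simp: h_def prob_space.prob_space[OF Mp]\<close>)
  show "integrable P (\<lambda>\<omega>. \<Prod>c\<in>S. f c (\<omega> c))"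
    using product_sigma_finite.product_integrable_prod[OF product_sigma_finite_const finI, of h] h unfolding eq by simp
  show "(\<integral>\<omega>. (\<Prod>c\<in>S. f c (\<omega> c)) \<partial>P) = (\<Prod>c\<in>S. \<integral>x. f c x \<partial>M)"
    using product_sigma_finite.product_integral_prod[OF product_sigma_finite_const finI, of h] h unfolding eq eq2 by simp
qed

lemma pair_expectation:
  fixes f h :: "'a \<Rightarrow> real"
  assumes ab: "a \<in> I" "b \<in> I" "a \<noteq> b" and f: "integrable M f" and h: "integrable M h"
  shows "integrable P (\<lambda>\<omega>. f (\<omega> a) * h (\<omega> b))" "(\<integral>\<omega>. f (\<omega> a) * h (\<omega> b) \<partial>P) = (\<integral>x. f x \<partial>M) * (\<integral>x. h x \<partial>M)"
  using product_expectation[of "{a, b}" "\<lambda>c. if c = a then f else h"] ab f h by auto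

text \<open>
  By independence the expectation factorises over the coordinates in \<open>{a, b, a', b'}\<close>. A coordinate
  that belongs to only one of the two pairs contributes a mean, which is zero.
\<close>

lemma fourfold_expectation:
  assumes ab: "a \<in> I" "b \<in> I" "a \<noteq> b" and ab': "a' \<in> I" "b' \<in> I" "a' \<noteq> b'" and kl: "1 \<le> k" "1 \<le> l"
  shows "integrable P (\<lambda>\<omega>. (u a k \<omega> * u b k \<omega>) * (u a' l \<omega> * u b' l \<omega>))"
    and "(\<integral>\<omega>. (u a k \<omega> * u b k \<omega>) * (u a' l \<omega> * u b' l \<omega>) \<partial>P)
      = (if {a, b} = {a', b'} then acov a (lag k l) * acov b (lag k l) else 0)"
proof -
  define f where "f c = (\<lambda>x. (if c \<in> {a, b} then U c k x else 1) * (if c \<in> {a', b'} then U c l x else 1))" for c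
  let ?S = "{a, b} \<union> {a', b'}"
  have S: "?S \<subseteq> I" using ab ab' by auto
  have f: "integrable M (f c)" if "c \<in> ?S" for c
  proof -
    interpret stationary_mixing M "U c" using sm that S by blast
    show ?thesis unfolding f_def using that integrable_mult[OF kl] moment1[OF kl(1)] moment1[OF kl(2)]
      by (cases "c \<in> {a, b}"; cases "c \<in> {a', b'}") simp_all
  qed
  have eq: "(\<Prod>c\<in>?S. f c (\<omega> c)) = (u a k \<omega> * u b k \<omega>) * (u a' l \<omega> * u b' l \<omega>)" for \<omega>
  proof -
    have "(\<Prod>c\<in>?S. if c \<in> {a, b} then U c k (\<omega> c) else 1) = (\<Prod>c\<in>{a, b}. U c k (\<omega> c))"
      by (rule prod.mono_neutral_cong_right) auto
    moreover have "(\<Prod>c\<in>?S. if c \<in> {a', b'} then U c l (\<omega> c) else 1) = (\<Prod>c\<in>{a', b'}. U c l (\<omega> c))"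
      by (rule prod.mono_neutral_cong_right) auto
    ultimately show ?thesis unfolding f_def prod.distrib using ab(3) ab'(3) by (simp add: u_def)
  qed
  show "integrable P (\<lambda>\<omega>. (u a k \<omega> * u b k \<omega>) * (u a' l \<omega> * u b' l \<omega>))"
    using product_expectation(1)[of ?S f, OF S f] unfolding eq .
  have e: "(\<integral>\<omega>. (u a k \<omega> * u b k \<omega>) * (u a' l \<omega> * u b' l \<omega>) \<partial>P) = (\<Prod>c\<in>?S. \<integral>x. f c x \<partial>M)"
    using product_expectation(2)[of ?S f, OF S f] unfolding eq .
  show "(\<integral>\<omega>. (u a k \<omega> * u b k \<omega>) * (u a' l \<omega> * u b' l \<omega>) \<partial>P)
      = (if {a, b} = {a', b'} then acov a (lag k l) * acov b (lag k l) else 0)"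
  proof (cases "{a, b} = {a', b'}")
    case True
    have gc: "(\<integral>x. f c x \<partial>M) = acov c (lag k l)" if "c \<in> {a, b}" for c
    proof -
      interpret stationary_mixing M "U c" using sm that ab by blast
      show ?thesis using that True autocov[OF kl] by (auto simp: f_def acov_def)
    qed
    have "(\<Prod>c\<in>?S. \<integral>x. f c x \<partial>M) = (\<Prod>c\<in>{a, b}. acov c (lag k l))"
      by (rule prod.cong) (use True gc in auto)
    also have "\<dots> = acov a (lag k l) * acov b (lag k l)" using ab(3) by simp
    finally show ?thesis unfolding e using True by (simp only: if_True simp_thms)
  next
    case False
    then obtain c where c: "c \<in> ?S" "\<not> (c \<in> {a, b} \<and> c \<in> {a', b'})" using ab ab' by blast
    interpret stationary_mixing M "U c" using sm c S by blast
    have "(\<integral>x. f c x \<partial>M) = 0" using c mean[OF kl(1)] mean[OF kl(2)] by (auto simp: f_def)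
    then have "(\<Prod>c\<in>?S. \<integral>x. f c x \<partial>M) = 0" using c(1) by (intro prod_zero) auto
    then show ?thesis unfolding e using False by simp
  qed
qed

definition pairs :: "('i \<times> 'i) set" where "pairs = {p \<in> I \<times> I. fst p \<noteq> snd p}"

lemma finite_pairs: "finite pairs"
  unfolding pairs_def using finI by simp

lemma acov_square_summable: "a \<in> I \<Longrightarrow> summable (\<lambda>k. (acov a k)\<^sup>2)"
  unfolding acov_def by (rule stationary_mixing.autocov_square_summable[OF sm])

lemma acov_mult_summable:
  assumes "a \<in> I" "b \<in> I" shows "summable (\<lambda>k. \<bar>acov a k * acov b k\<bar>)"
proof (rule summable_comparison_test[OF _ summable_add[OF acov_square_summable[OF assms(1)] acov_square_summable[OF assms(2)]]], intro exI allI impI)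
  fix k
  have "0 \<le> (\<bar>acov a k\<bar> - \<bar>acov b k\<bar>)\<^sup>2" by simp
  then have "2 * \<bar>acov a k * acov b k\<bar> \<le> (acov a k)\<^sup>2 + (acov b k)\<^sup>2" by (simp add: power2_diff abs_mult)
  then show "norm \<bar>acov a k * acov b k\<bar> \<le> (acov a k)\<^sup>2 + (acov b k)\<^sup>2" by simp
qed

lemma inner_product_second_moment:
  assumes ab: "a \<in> I" "b \<in> I" "a \<noteq> b"
  shows "integrable P (\<lambda>\<omega>. (\<Sum>k=1..d. u a k \<omega> * u b k \<omega>)\<^sup>2)"
    and "(\<integral>\<omega>. (\<Sum>k=1..d. u a k \<omega> * u b k \<omega>)\<^sup>2 \<partial>P) = (\<Sum>k=1..d. \<Sum>l=1..d. acov a (lag k l) * acov b (lag k l))"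
proof -
  have sq: "(\<Sum>k=1..d. u a k \<omega> * u b k \<omega>)\<^sup>2 = (\<Sum>k=1..d. \<Sum>l=1..d. (u a k \<omega> * u b k \<omega>) * (u a l \<omega> * u b l \<omega>))" for \<omega>
    by (simp add: power2_eq_square sum_product)
  have *: "integrable P (\<lambda>\<omega>. (u a k \<omega> * u b k \<omega>) * (u a l \<omega> * u b l \<omega>))"
    "(\<integral>\<omega>. (u a k \<omega> * u b k \<omega>) * (u a l \<omega> * u b l \<omega>) \<partial>P) = acov a (lag k l) * acov b (lag k l)"
    if "k \<in> {1..d}" "l \<in> {1..d}" for k l
    using fourfold_expectation[OF ab ab, of k l] that by simp_all
  show "integrable P (\<lambda>\<omega>. (\<Sum>k=1..d. u a k \<omega> * u b k \<omega>)\<^sup>2)"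
    unfolding sq by (intro Bochner_Integration.integrable_sum *)
  show "(\<integral>\<omega>. (\<Sum>k=1..d. u a k \<omega> * u b k \<omega>)\<^sup>2 \<partial>P) = (\<Sum>k=1..d. \<Sum>l=1..d. acov a (lag k l) * acov b (lag k l))"
    unfolding sq by (subst integral_double_sum) (simp_all only: * cong: sum.cong)
qed

lemma inner_product_second_moment_linear:
  assumes ab: "a \<in> I" "b \<in> I" "a \<noteq> b"
  obtains C where "0 < C" "\<And>d. (\<integral>\<omega>. (\<Sum>k=1..d. u a k \<omega> * u b k \<omega>)\<^sup>2 \<partial>P) \<le> C * real d"
proof -
  have "Bseq (\<lambda>d. (\<Sum>k=1..d. \<Sum>l=1..d. acov a (lag k l) * acov b (lag k l)) / real d)"
    using toeplitz_mean[OF acov_mult_summable[OF ab(1,2)]] by (rule convergentI[THEN convergent_imp_Bseq])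
  then obtain C where C: "0 < C" "\<And>d. norm ((\<Sum>k=1..d. \<Sum>l=1..d. acov a (lag k l) * acov b (lag k l)) / real d) \<le> C"
    unfolding Bseq_def by blast
  have "(\<Sum>k=1..d. \<Sum>l=1..d. acov a (lag k l) * acov b (lag k l)) \<le> C * real d" for d
  proof (cases "d = 0")
    case False
    then show ?thesis using C(2)[of d] by (simp add: abs_divide divide_le_eq abs_le_iff)
  qed simp
  then show ?thesis using that C(1) unfolding inner_product_second_moment(2)[OF ab] by blast
qed

end

text \<open>
  An off-diagonal quadratic form in the \<open>k\<close>-th coordinates of all copies, with symmetric weights.
\<close>

locale weighted_pairs = independent_samples M I U
  for M :: "'a measure" and I :: "'i set" and U :: "'i \<Rightarrow> nat \<Rightarrow> 'a \<Rightarrow> real" +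
  fixes weight :: "'i \<Rightarrow> 'i \<Rightarrow> real"
  assumes weight_sym: "\<And>a b. weight a b = weight b a"
begin

definition Z :: "nat \<Rightarrow> ('i \<Rightarrow> 'a) \<Rightarrow> real" where
  "Z k \<omega> = (\<Sum>p\<in>pairs. weight (fst p) (snd p) * (u (fst p) k \<omega> * u (snd p) k \<omega>))"

text \<open>
  The autocovariance function of \<open>Z\<close>; the factor 2 counts the pair and its transpose.
\<close>

definition cov_Z :: "nat \<Rightarrow> real" where
  "cov_Z h = 2 * (\<Sum>p\<in>pairs. (weight (fst p) (snd p))\<^sup>2 * (acov (fst p) h * acov (snd p) h))"

lemma pairsD: "p \<in> pairs \<Longrightarrow> fst p \<in> I \<and> snd p \<in> I \<and> fst p \<noteq> snd p" unfolding pairs_def by auto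

lemma Z_product_expectation:
  assumes kl: "1 \<le> k" "1 \<le> l"
  shows "integrable P (\<lambda>\<omega>. Z k \<omega> * Z l \<omega>)" "(\<integral>\<omega>. Z k \<omega> * Z l \<omega> \<partial>P) = cov_Z (lag k l)"
proof -
  have e: "Z k \<omega> * Z l \<omega> = (\<Sum>p\<in>pairs. \<Sum>q\<in>pairs. (weight (fst p) (snd p) * weight (fst q) (snd q)) *
      ((u (fst p) k \<omega> * u (snd p) k \<omega>) * (u (fst q) l \<omega> * u (snd q) l \<omega>)))" for \<omega>
    unfolding Z_def sum_product by (intro sum.cong) (simp_all add: mult_ac)
  have i: "integrable P (\<lambda>\<omega>. (weight (fst p) (snd p) * weight (fst q) (snd q)) *
      ((u (fst p) k \<omega> * u (snd p) k \<omega>) * (u (fst q) l \<omega> * u (snd q) l \<omega>)))" if "p \<in> pairs" "q \<in> pairs" for p q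
    using pairsD[OF that(1)] pairsD[OF that(2)] kl by (intro integrable_mult_right fourfold_expectation) auto
  show "integrable P (\<lambda>\<omega>. Z k \<omega> * Z l \<omega>)" unfolding e by (intro Bochner_Integration.integrable_sum i)
  have inner: "(\<Sum>q\<in>pairs. \<integral>\<omega>. (weight (fst p) (snd p) * weight (fst q) (snd q)) *
      ((u (fst p) k \<omega> * u (snd p) k \<omega>) * (u (fst q) l \<omega> * u (snd q) l \<omega>)) \<partial>P)
      = 2 * ((weight (fst p) (snd p))\<^sup>2 * (acov (fst p) (lag k l) * acov (snd p) (lag k l)))" if p: "p \<in> pairs" for p
  proof -
    obtain a b where ab: "p = (a, b)" by (cases p)
    have abI: "a \<in> I" "b \<in> I" "a \<noteq> b" using pairsD[OF p] ab by auto
    let ?G = "acov a (lag k l) * acov b (lag k l)"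
    have "(\<Sum>q\<in>pairs. \<integral>\<omega>. (weight a b * weight (fst q) (snd q)) * ((u a k \<omega> * u b k \<omega>) * (u (fst q) l \<omega> * u (snd q) l \<omega>)) \<partial>P)
        = (\<Sum>q\<in>pairs. if {a, b} = {fst q, snd q} then (weight a b * weight (fst q) (snd q)) * ?G else 0)"
    proof (rule sum.cong[OF refl])
      fix q assume "q \<in> pairs"
      then have q: "fst q \<in> I" "snd q \<in> I" "fst q \<noteq> snd q" using pairsD by auto
      show "(\<integral>\<omega>. (weight a b * weight (fst q) (snd q)) * ((u a k \<omega> * u b k \<omega>) * (u (fst q) l \<omega> * u (snd q) l \<omega>)) \<partial>P)
        = (if {a, b} = {fst q, snd q} then (weight a b * weight (fst q) (snd q)) * ?G else 0)"
        using fourfold_expectation(2)[OF abI q kl] by simp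
    qed
    also have "\<dots> = (\<Sum>q\<in>{(a, b), (b, a)}. (weight a b * weight (fst q) (snd q)) * ?G)"
      by (rule sum.mono_neutral_cong_right) (use finite_pairs abI in \<open>auto simp: pairs_def doubleton_eq_iff\<close>)
    also have "\<dots> = 2 * ((weight a b)\<^sup>2 * ?G)" using abI(3) weight_sym[of b a] by (simp add: power2_eq_square algebra_simps)
    finally show ?thesis unfolding ab by simp
  qed
  have "(\<integral>\<omega>. Z k \<omega> * Z l \<omega> \<partial>P) = (\<Sum>p\<in>pairs. \<Sum>q\<in>pairs. \<integral>\<omega>. (weight (fst p) (snd p) * weight (fst q) (snd q)) *
      ((u (fst p) k \<omega> * u (snd p) k \<omega>) * (u (fst q) l \<omega> * u (snd q) l \<omega>)) \<partial>P)"
    unfolding e by (rule integral_double_sum) (rule i)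
  also have "\<dots> = cov_Z (lag k l)" unfolding cov_Z_def sum_distrib_left by (intro sum.cong refl inner)
  finally show "(\<integral>\<omega>. Z k \<omega> * Z l \<omega> \<partial>P) = cov_Z (lag k l)" .
qed

lemma Z_variance: "(\<integral>\<omega>. (\<Sum>k=1..d. Z k \<omega>)\<^sup>2 \<partial>P) = (\<Sum>k=1..d. \<Sum>l=1..d. cov_Z (lag k l))"
  unfolding power2_eq_square sum_product
  by (subst integral_double_sum) (use Z_product_expectation in \<open>auto intro!: sum.cong\<close>)

lemma cov_Z_summable: "summable (\<lambda>h. \<bar>cov_Z h\<bar>)"
proof (rule summable_comparison_test)
  show "\<exists>N. \<forall>h\<ge>N. norm \<bar>cov_Z h\<bar> \<le> 2 * (\<Sum>p\<in>pairs. (weight (fst p) (snd p))\<^sup>2 * \<bar>acov (fst p) h * acov (snd p) h\<bar>)"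
    unfolding cov_Z_def by (auto simp: abs_mult intro!: order_trans[OF sum_abs])
  show "summable (\<lambda>h. 2 * (\<Sum>p\<in>pairs. (weight (fst p) (snd p))\<^sup>2 * \<bar>acov (fst p) h * acov (snd p) h\<bar>))"
    by (intro summable_mult summable_sum acov_mult_summable) (use pairsD in auto)
qed

definition \<kappa> :: real where "\<kappa> = cov_Z 0 + 2 * (\<Sum>h. cov_Z (Suc h))"

lemma variance_rate: "(\<lambda>d. (\<Sum>k=1..d. \<Sum>l=1..d. cov_Z (lag k l)) / real d) \<longlonglongrightarrow> \<kappa>"
  unfolding \<kappa>_def by (rule toeplitz_mean[OF cov_Z_summable])

text \<open>
  Only fourth moments of the original sequences are needed, because the two factors of each summand are independent.
\<close>

lemma Z_moment4: "1 \<le> k \<Longrightarrow> integrable P (\<lambda>\<omega>. Z k \<omega> ^ 4)"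
proof -
  assume k: "1 \<le> k"
  have L4: "integrable P (\<lambda>\<omega>. (\<Sum>p\<in>F. weight (fst p) (snd p) * (u (fst p) k \<omega> * u (snd p) k \<omega>)) ^ 4)"
    if "finite F" "F \<subseteq> pairs" for F
    using that
  proof (induction F rule: finite_induct)
    case (insert p F)
    let ?t = "\<lambda>\<omega>. weight (fst p) (snd p) * (u (fst p) k \<omega> * u (snd p) k \<omega>)"
    let ?s = "\<lambda>\<omega>. \<Sum>p\<in>F. weight (fst p) (snd p) * (u (fst p) k \<omega> * u (snd p) k \<omega>)"
    have p: "fst p \<in> I" "snd p \<in> I" "fst p \<noteq> snd p" using insert pairsD[of p] by auto
    have tm: "(\<lambda>\<omega>. weight (fst q) (snd q) * (u (fst q) k \<omega> * u (snd q) k \<omega>)) \<in> borel_measurable P" if "q \<in> pairs" for q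
      by (intro borel_measurable_times borel_measurable_const u_rv k) (use pairsD[OF that] in auto)
    have m: "?t \<in> borel_measurable P" "?s \<in> borel_measurable P"
      using insert by (auto intro!: borel_measurable_sum tm)
    have "integrable P (\<lambda>\<omega>. (U (fst p) k (\<omega> (fst p)))^4 * (U (snd p) k (\<omega> (snd p)))^4)"
      by (rule pair_expectation(1)[OF p]) (use stationary_mixing.moment4[OF sm k] p in auto)
    then have t4: "integrable P (\<lambda>\<omega>. ?t \<omega> ^ 4)" by (simp add: power_mult_distrib u_def)
    have s4: "integrable P (\<lambda>\<omega>. ?s \<omega> ^ 4)" using insert by auto
    have "integrable P (\<lambda>\<omega>. (?t \<omega> + ?s \<omega>) ^ 4)"
    proof (rule Bochner_Integration.integrable_bound)
      show "integrable P (\<lambda>\<omega>. 12/10 * ?t \<omega> ^ 4 + 18492 * ?s \<omega> ^ 4)" using t4 s4 by simp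
      show "(\<lambda>\<omega>. (?t \<omega> + ?s \<omega>) ^ 4) \<in> borel_measurable P" using m by measurable
      show "AE \<omega> in P. norm ((?t \<omega> + ?s \<omega>) ^ 4) \<le> norm (12/10 * ?t \<omega> ^ 4 + 18492 * ?s \<omega> ^ 4)"
        using pow4_add_le' by (intro AE_I2) simp
    qed
    then show ?case using insert by simp
  qed simp
  show ?thesis unfolding Z_def by (rule L4[OF finite_pairs order_refl])
qed

lemma Z_mean: "1 \<le> k \<Longrightarrow> (\<integral>\<omega>. Z k \<omega> \<partial>P) = 0"
proof -
  assume k: "1 \<le> k"
  have *: "integrable P (\<lambda>\<omega>. weight (fst p) (snd p) * (u (fst p) k \<omega> * u (snd p) k \<omega>))"
    "(\<integral>\<omega>. weight (fst p) (snd p) * (u (fst p) k \<omega> * u (snd p) k \<omega>) \<partial>P) = 0" if "p \<in> pairs" for p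
  proof -
    have p: "fst p \<in> I" "snd p \<in> I" "fst p \<noteq> snd p" using that pairsD[of p] by auto
    have m1: "integrable M (U (fst p) k)" "integrable M (U (snd p) k)" "(\<integral>x. U (fst p) k x \<partial>M) = 0"
      using stationary_mixing.moment1[OF sm k] stationary_mixing.mean[OF sm k] p by auto
    show "integrable P (\<lambda>\<omega>. weight (fst p) (snd p) * (u (fst p) k \<omega> * u (snd p) k \<omega>))"
      "(\<integral>\<omega>. weight (fst p) (snd p) * (u (fst p) k \<omega> * u (snd p) k \<omega>) \<partial>P) = 0"
      using pair_expectation[OF p m1(1,2)] m1(3) by (simp_all add: u_def)
  qed
  have "(\<integral>\<omega>. Z k \<omega> \<partial>P) = (\<Sum>p\<in>pairs. \<integral>\<omega>. weight (fst p) (snd p) * (u (fst p) k \<omega> * u (snd p) k \<omega>) \<partial>P)"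
    unfolding Z_def by (intro Bochner_Integration.integral_sum *)
  also have "\<dots> = 0" using *(2) by (intro sum.neutral) blast
  finally show ?thesis .
qed

text \<open>
  The block sum is one fixed function of the joint law of the corresponding stretches of all
  copies, and this law is a product of shift invariant laws.
\<close>

lemma Z_block_law: "distr P borel (\<lambda>\<omega>. \<Sum>k\<in>{h<..h+p}. Z k \<omega>) = distr P borel (\<lambda>\<omega>. \<Sum>k\<in>{0<..p}. Z k \<omega>)"
proof -
  let ?B = "PiM {1..p} (\<lambda>_. borel :: real measure)"
  define G where "G x = (\<Sum>k\<in>{1..p}. \<Sum>q\<in>pairs. weight (fst q) (snd q) * (x (fst q) k * x (snd q) k))" for x :: "'i \<Rightarrow> nat \<Rightarrow> real"
  define T where "T h = (\<lambda>\<omega>. \<lambda>a\<in>I. \<lambda>k\<in>{1..p}. U a (k + h) (\<omega> a))" for h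
  have Um: "(\<lambda>x. \<lambda>k\<in>{1..p}. U a (k + h) x) \<in> measurable M ?B" if "a \<in> I" for a h
    using that by (intro measurable_restrict U_rv) auto
  have Tm: "T h \<in> measurable P (PiM I (\<lambda>_. ?B))" for h
    unfolding T_def by (intro measurable_restrict component_rv Um)
  have Gm: "G \<in> borel_measurable (PiM I (\<lambda>_. ?B))"
    unfolding G_def
  proof (intro borel_measurable_sum borel_measurable_times borel_measurable_const)
    fix k q assume k: "k \<in> {1..p}" and q: "q \<in> pairs"
    have q': "fst q \<in> I" "snd q \<in> I" using pairsD[OF q] by auto
    show "(\<lambda>x. x (fst q) k) \<in> borel_measurable (PiM I (\<lambda>_. ?B))" "(\<lambda>x. x (snd q) k) \<in> borel_measurable (PiM I (\<lambda>_. ?B))"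
      using measurable_compose[OF measurable_component_singleton[OF q'(1)] measurable_component_singleton[OF k]]
        measurable_compose[OF measurable_component_singleton[OF q'(2)] measurable_component_singleton[OF k]] by auto
  qed
  have law: "distr P (PiM I (\<lambda>_. ?B)) (T h) = distr P (PiM I (\<lambda>_. ?B)) (T 0)" for h
  proof -
    have "distr P (PiM I (\<lambda>_. ?B)) (T h) = PiM I (\<lambda>a. distr M ?B (\<lambda>x. \<lambda>k\<in>{1..p}. U a (k + h) x))" for h
      unfolding T_def by (rule distr_PiM_coordinatewise[OF finI Mp Um])
    moreover have "distr M ?B (\<lambda>x. \<lambda>k\<in>{1..p}. U a (k + h) x) = distr M ?B (\<lambda>x. \<lambda>k\<in>{1..p}. U a (k + 0) x)" if "a \<in> I" for a h
      using stationary_mixing.stat[OF sm[OF that]] unfolding strictly_stationary_def by simp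
    ultimately show ?thesis by (simp cong: PiM_cong)
  qed
  have eq: "(\<Sum>k\<in>{h<..h+p}. Z k \<omega>) = G (T h \<omega>)" for h \<omega>
  proof -
    have "(\<Sum>k\<in>{h<..h+p}. Z k \<omega>) = (\<Sum>k\<in>{1..p}. Z (k + h) \<omega>)"
      by (rule sum.reindex_bij_witness[where i="\<lambda>k. k + h" and j="\<lambda>k. k - h"]) auto
    also have "\<dots> = G (T h \<omega>)" unfolding G_def Z_def T_def u_def
      by (intro sum.cong refl) (use pairsD in auto)
    finally show ?thesis .
  qed
  have "distr P borel (\<lambda>\<omega>. G (T h \<omega>)) = distr P borel (\<lambda>\<omega>. G (T 0 \<omega>))"
    using arg_cong[OF law[of h], of "\<lambda>D. distr D borel G"] Tm[of h] Tm[of 0] Gm by (simp add: distr_distr comp_def)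
  moreover have "(\<Sum>k\<in>{0<..p}. Z k \<omega>) = G (T 0 \<omega>)" for \<omega> using eq[of \<omega> 0] by simp
  ultimately show ?thesis unfolding eq by simp
qed

lemma Z_mixing_sequence:
  "mixing_sequence P Z (\<lambda>k. PiM I (\<lambda>a. generated_algebra M (U a) {1..k})) (\<lambda>k. PiM I (\<lambda>a. generated_algebra M (U a) {k..}))
     (\<lambda>h. \<Sum>a\<in>I. rho_coeff M (U a) h) \<kappa>"
proof (intro mixing_sequence.intro mixing_sequence_axioms.intro)
  show "prob_space P" by (rule P.prob_space_axioms)
  fix k h p j :: nat
  show "subalgebra P (PiM I (\<lambda>a. generated_algebra M (U a) {1..k}))"
    by (intro subalgebra_PiM stationary_mixing.sub_past[OF sm])
  show "1 \<le> k \<Longrightarrow> subalgebra P (PiM I (\<lambda>a. generated_algebra M (U a) {k..}))"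
    by (intro subalgebra_PiM stationary_mixing.sub_future[OF sm])
  have Zm: "Z j \<in> borel_measurable (PiM I (\<lambda>a. generated_algebra M (U a) S))" if "j \<in> S" for S
  proof -
    have "(\<lambda>\<omega>. U a j (\<omega> a)) \<in> borel_measurable (PiM I (\<lambda>a. generated_algebra M (U a) S))" if a: "a \<in> I" for a
      using measurable_compose[OF measurable_component_singleton[OF a, of "\<lambda>a. generated_algebra M (U a) S"]
        measurable_generated_algebra[OF \<open>j \<in> S\<close>, of "U a" M]] .
    then show ?thesis unfolding Z_def u_def
      by (intro borel_measurable_sum borel_measurable_times borel_measurable_const) (use pairsD in blast)+
  qed
  show "1 \<le> j \<Longrightarrow> j \<le> k \<Longrightarrow> Z j \<in> borel_measurable (PiM I (\<lambda>a. generated_algebra M (U a) {1..k}))"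
    by (rule Zm) simp
  show "1 \<le> k \<Longrightarrow> k \<le> j \<Longrightarrow> Z j \<in> borel_measurable (PiM I (\<lambda>a. generated_algebra M (U a) {k..}))"
    by (rule Zm) simp
  show "1 \<le> k \<Longrightarrow> decorrelated P (PiM I (\<lambda>a. generated_algebra M (U a) {1..k}))
      (PiM I (\<lambda>a. generated_algebra M (U a) {k+h..})) (\<Sum>a\<in>I. rho_coeff M (U a) h)"
    using finI Mp by (intro decorrelated_PiM stationary_mixing.sub_past[OF sm] stationary_mixing.sub_future[OF sm]
      stationary_mixing.decor[OF sm] stationary_mixing.rho_nonneg[OF sm]) auto
  show "0 \<le> (\<Sum>a\<in>I. rho_coeff M (U a) h)"
    by (intro sum_nonneg stationary_mixing.rho_nonneg[OF sm])
  have "(\<lambda>h. \<Sum>a\<in>I. rho_coeff M (U a) h) \<longlonglongrightarrow> (\<Sum>a\<in>I. 0)"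
    by (intro tendsto_sum) (use stationary_mixing.mixing[OF sm] in \<open>auto simp: rho_mixing_def\<close>)
  then show "(\<lambda>h. \<Sum>a\<in>I. rho_coeff M (U a) h) \<longlonglongrightarrow> 0" by simp
  show "1 \<le> k \<Longrightarrow> integrable P (\<lambda>\<omega>. Z k \<omega> ^ 4)" by (rule Z_moment4)
  show "1 \<le> k \<Longrightarrow> (\<integral>\<omega>. Z k \<omega> \<partial>P) = 0" by (rule Z_mean)
  show "distr P borel (\<lambda>\<omega>. \<Sum>k\<in>{h<..h+p}. Z k \<omega>) = distr P borel (\<lambda>\<omega>. \<Sum>k\<in>{0<..p}. Z k \<omega>)" by (rule Z_block_law)
  have "{0<..d} = {1..d}" for d :: nat by auto
  then show "(\<lambda>p. (\<integral>\<omega>. (\<Sum>k\<in>{0<..p}. Z k \<omega>)\<^sup>2 \<partial>P) / real p) \<longlonglongrightarrow> \<kappa>"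
    using variance_rate by (simp only: Z_variance)
qed

theorem Z_central_limit:
  assumes "0 < \<kappa>"
  shows "weak_conv_m (\<lambda>d. distr P borel (\<lambda>\<omega>. (\<Sum>k=1..d. Z k \<omega>) / sqrt (\<kappa> * real d))) std_normal_distribution"
proof -
  have "{0<..d} = {1..d}" for d :: nat by auto
  then show ?thesis using mixing_sequence.central_limit[OF Z_mixing_sequence assms] by simp
qed

end

section \<open>Two samples: the pure noise statistic and its variance\<close>

lemma falling_2: "falling m 2 = real m * (real m - 1)"
  by (simp add: falling_def numeral_2_eq_2 lessThan_Suc)

lemma offdiagonal_sum:
  fixes f h :: "'a \<Rightarrow> real"
  assumes "finite F"
  shows "(\<Sum>j\<in>F. \<Sum>j'\<in>F - {j}. f j * h j') = (\<Sum>j\<in>F. f j) * (\<Sum>j\<in>F. h j) - (\<Sum>j\<in>F. f j * h j)"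
proof -
  have "(\<Sum>j'\<in>F - {j}. f j * h j') = f j * (\<Sum>j'\<in>F. h j') - f j * h j" if "j \<in> F" for j
    using sum.remove[OF assms that, of h] by (simp add: sum_distrib_left[symmetric] algebra_simps)
  then show ?thesis by (simp add: sum_subtractf sum_distrib_right)
qed

lemma offdiag_const: "(\<Sum>i=1..l. \<Sum>i'\<in>{1..l} - {i}. (K :: real)) = falling l 2 * K"
  using offdiagonal_sum[of "{1..l}" "\<lambda>_. K" "\<lambda>_. 1"] by (simp add: falling_2 algebra_simps)

lemma u_statistic_expansion:
  fixes v w :: "nat \<Rightarrow> real"
  shows "(\<Sum>i1=1..m. \<Sum>i2\<in>{1..m} - {i1}. \<Sum>j1=1..n. \<Sum>j2\<in>{1..n} - {j1}. (w j1 - v i1) * (w j2 - v i2))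
    = falling m 2 * (\<Sum>j=1..n. \<Sum>j'\<in>{1..n} - {j}. w j * w j')
      - 2 * (real m - 1) * (real n - 1) * ((\<Sum>i=1..m. v i) * (\<Sum>j=1..n. w j))
      + falling n 2 * (\<Sum>i=1..m. \<Sum>i'\<in>{1..m} - {i}. v i * v i')"
proof -
  define SW SV where "SW = (\<Sum>j=1..n. w j)" and "SV = (\<Sum>i=1..m. v i)"
  define QW QV where "QW = (\<Sum>j=1..n. w j * w j)" and "QV = (\<Sum>i=1..m. v i * v i)"
  have inner: "(\<Sum>j1=1..n. \<Sum>j2\<in>{1..n} - {j1}. (w j1 - a) * (w j2 - b))
      = (SW * SW - QW) + (- ((real n - 1) * SW)) * a + (- ((real n - 1) * SW)) * b + falling n 2 * (a * b)" for a b
  proof -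
    have "(w j - a) * (w j - b) = w j * w j - (a + b) * w j + a * b" for j by (simp add: algebra_simps)
    then have s3: "(\<Sum>j=1..n. (w j - a) * (w j - b)) = QW - (a + b) * SW + real n * (a * b)"
      unfolding QW_def SW_def by (simp add: sum.distrib sum_subtractf sum_distrib_left)
    have s1: "(\<Sum>j=1..n. w j - x) = SW - real n * x" for x by (simp add: sum_subtractf SW_def)
    show ?thesis
      unfolding offdiagonal_sum[OF finite_atLeastAtMost] falling_2 s1 s3 by (simp add: algebra_simps)
  qed
  have l: "(\<Sum>i1=1..m. \<Sum>i2\<in>{1..m} - {i1}. K * v i1) = (real m - 1) * K * SV"
    "(\<Sum>i1=1..m. \<Sum>i2\<in>{1..m} - {i1}. K * v i2) = (real m - 1) * K * SV"
    "(\<Sum>i1=1..m. \<Sum>i2\<in>{1..m} - {i1}. K) = falling m 2 * K"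
    "(\<Sum>i1=1..m. \<Sum>i2\<in>{1..m} - {i1}. K * (v i1 * v i2)) = K * (SV * SV - QV)" for K
    using offdiagonal_sum[of "{1..m}" "\<lambda>i. K * v i" "\<lambda>_. 1"] offdiagonal_sum[of "{1..m}" "\<lambda>i. K" v]
      offdiagonal_sum[of "{1..m}" "\<lambda>i. K" "\<lambda>_. 1"] offdiagonal_sum[of "{1..m}" "\<lambda>i. K * v i" v]
    by (simp_all add: SV_def QV_def falling_2 algebra_simps sum_distrib_left[symmetric] sum_distrib_right[symmetric] flip: sum_distrib_left)
  have main: "(\<Sum>i1=1..m. \<Sum>i2\<in>{1..m} - {i1}. \<Sum>j1=1..n. \<Sum>j2\<in>{1..n} - {j1}. (w j1 - v i1) * (w j2 - v i2))
    = falling m 2 * (SW * SW - QW) + (real m - 1) * (- ((real n - 1) * SW)) * SV + (real m - 1) * (- ((real n - 1) * SW)) * SV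
      + falling n 2 * (SV * SV - QV)"
    unfolding inner sum.distrib l ..
  have sq: "(\<Sum>j=1..n. \<Sum>j'\<in>{1..n} - {j}. w j * w j') = SW * SW - QW" "(\<Sum>i=1..m. \<Sum>i'\<in>{1..m} - {i}. v i * v i') = SV * SV - QV"
    using offdiagonal_sum[of "{1..n}" w w] offdiagonal_sum[of "{1..m}" v v] by (simp_all add: SW_def SV_def QW_def QV_def)
  show ?thesis unfolding main sq SW_def[symmetric] SV_def[symmetric] by (simp add: algebra_simps)
qed

text \<open>
  The index set of the two statistics, so that both become plain averages over a finite set.
\<close>

definition quads :: "nat \<Rightarrow> nat \<Rightarrow> (nat \<times> nat \<times> nat \<times> nat) set" where
  "quads m n = (SIGMA i1:{1..m}. SIGMA i2:{1..m} - {i1}. SIGMA j1:{1..n}. {1..n} - {j1})"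

lemma finite_quads: "finite (quads m n)" unfolding quads_def by auto

lemma sum_quads:
  "(\<Sum>i1=1..m. \<Sum>i2\<in>{1..m} - {i1}. \<Sum>j1=1..n. \<Sum>j2\<in>{1..n} - {j1}. (f i1 i2 j1 j2 :: real))
    = (\<Sum>(i1, i2, j1, j2)\<in>quads m n. f i1 i2 j1 j2)"
  unfolding quads_def by (simp add: sum.Sigma split_def)

lemma card_quads: "real (card (quads m n)) = falling m 2 * falling n 2"
proof -
  have "real (card (quads m n)) = (\<Sum>(i1, i2, j1, j2)\<in>quads m n. 1)" by (simp add: split_def)
  also have "\<dots> = (\<Sum>i1=1..m. \<Sum>i2\<in>{1..m} - {i1}. \<Sum>j1=1..n. \<Sum>j2\<in>{1..n} - {j1}. 1)" by (rule sum_quads[symmetric])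
  also have "\<dots> = falling m 2 * falling n 2"
    by (simp only: offdiag_const)
  finally show ?thesis .
qed

locale two_samples =
  fixes M :: "'a measure" and V W :: "nat \<Rightarrow> 'a \<Rightarrow> real" and m n :: nat
  assumes Vs: "stationary_mixing M V" and Ws: "stationary_mixing M W"
    and V_pos: "0 < stationary_mixing.\<gamma> M V 0" and W_pos: "0 < stationary_mixing.\<gamma> M W 0"
    and mn: "2 \<le> m" "2 \<le> n"
begin

definition I :: "(nat + nat) set" where "I = {1..m} <+> {1..n}"

lemma mem_I [simp]: "Inl i \<in> I \<longleftrightarrow> i \<in> {1..m}" "Inr j \<in> I \<longleftrightarrow> j \<in> {1..n}"
  by (auto simp: I_def)

definition U :: "nat + nat \<Rightarrow> nat \<Rightarrow> 'a \<Rightarrow> real" where "U = case_sum (\<lambda>_. V) (\<lambda>_. W)"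

text \<open>
  The coefficients that remain after averaging \<open>(w j1 - v i1) (w j2 - v i2)\<close> over all quadruples of indices.
\<close>

definition weight :: "nat + nat \<Rightarrow> nat + nat \<Rightarrow> real" where
  "weight a b = (case a of Inl _ \<Rightarrow> (case b of Inl _ \<Rightarrow> 1 / falling m 2 | Inr _ \<Rightarrow> - 1 / (real m * real n))
     | Inr _ \<Rightarrow> (case b of Inl _ \<Rightarrow> - 1 / (real m * real n) | Inr _ \<Rightarrow> 1 / falling n 2))"

lemma prob_M: "prob_space M" using Vs by (simp add: stationary_mixing_def)

sublocale weighted_pairs M I U weight
proof (intro weighted_pairs.intro independent_samples.intro weighted_pairs_axioms.intro)
  show "finite I" by (simp add: I_def)
  show "prob_space M" by (rule prob_M)
  show "\<And>a. a \<in> I \<Longrightarrow> stationary_mixing M (U a)" using Vs Ws by (auto simp: U_def I_def)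
  show "\<And>a b. weight a b = weight b a" by (simp add: weight_def split: sum.split)
qed

abbreviation g1 :: "nat \<Rightarrow> real" where "g1 \<equiv> stationary_mixing.\<gamma> M V"
abbreviation g2 :: "nat \<Rightarrow> real" where "g2 \<equiv> stationary_mixing.\<gamma> M W"

lemma acov_simps [simp]: "acov (Inl i) = g1" "acov (Inr j) = g2"
proof -
  have "acov (Inl i) = stationary_mixing.\<gamma> M (U (Inl i))" "acov (Inr j) = stationary_mixing.\<gamma> M (U (Inr j))" by (simp_all only: acov_def)
  moreover have "U (Inl i) = V" "U (Inr j) = W" by (simp_all add: U_def)
  ultimately show "acov (Inl i) = g1" "acov (Inr j) = g2" by simp_all
qed

lemma falling_pos: "0 < falling m 2" "0 < falling n 2" using mn by (simp_all add: falling_2)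

lemma sum_pairs:
  fixes F :: "nat + nat \<Rightarrow> nat + nat \<Rightarrow> real"
  shows "(\<Sum>p\<in>pairs. F (fst p) (snd p)) =
     (\<Sum>i=1..m. \<Sum>i'\<in>{1..m} - {i}. F (Inl i) (Inl i')) + (\<Sum>i=1..m. \<Sum>j=1..n. F (Inl i) (Inr j))
     + ((\<Sum>j=1..n. \<Sum>i=1..m. F (Inr j) (Inl i)) + (\<Sum>j=1..n. \<Sum>j'\<in>{1..n} - {j}. F (Inr j) (Inr j')))"
proof -
  have p: "pairs = (SIGMA a:I. I - {a})" unfolding pairs_def by auto
  have "(\<Sum>p\<in>pairs. F (fst p) (snd p)) = (\<Sum>a\<in>I. \<Sum>b\<in>I - {a}. F a b)"
    unfolding p by (subst sum.Sigma) (auto simp: split_def I_def)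
  also have "\<dots> = (\<Sum>i=1..m. \<Sum>b\<in>I - {Inl i}. F (Inl i) b) + (\<Sum>j=1..n. \<Sum>b\<in>I - {Inr j}. F (Inr j) b)"
    unfolding I_def by (subst sum.Plus) (auto simp: comp_def)
  also have "(\<Sum>i=1..m. \<Sum>b\<in>I - {Inl i}. F (Inl i) b) = (\<Sum>i=1..m. (\<Sum>i'\<in>{1..m} - {i}. F (Inl i) (Inl i')) + (\<Sum>j=1..n. F (Inl i) (Inr j)))"
  proof (rule sum.cong[OF refl])
    fix i
    have "I - {Inl i} = ({1..m} - {i}) <+> {1..n}" by (auto simp: I_def)
    then show "(\<Sum>b\<in>I - {Inl i}. F (Inl i) b) = (\<Sum>i'\<in>{1..m} - {i}. F (Inl i) (Inl i')) + (\<Sum>j=1..n. F (Inl i) (Inr j))"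
      by (simp add: sum.Plus comp_def)
  qed
  also have "(\<Sum>j=1..n. \<Sum>b\<in>I - {Inr j}. F (Inr j) b) = (\<Sum>j=1..n. (\<Sum>i=1..m. F (Inr j) (Inl i)) + (\<Sum>j'\<in>{1..n} - {j}. F (Inr j) (Inr j')))"
  proof (rule sum.cong[OF refl])
    fix j
    have "I - {Inr j} = {1..m} <+> ({1..n} - {j})" by (auto simp: I_def)
    then show "(\<Sum>b\<in>I - {Inr j}. F (Inr j) b) = (\<Sum>i=1..m. F (Inr j) (Inl i)) + (\<Sum>j'\<in>{1..n} - {j}. F (Inr j) (Inr j'))"
      by (simp add: sum.Plus comp_def)
  qed
  finally show ?thesis by (simp add: sum.distrib)
qed

lemma cov_Z_eq: "cov_Z h = 2 * (g1 h * g1 h) / falling m 2 + 2 * (g2 h * g2 h) / falling n 2 + 4 * (g1 h * g2 h) / (real m * real n)"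
proof -
  have "cov_Z h = 2 * (falling m 2 * ((1 / falling m 2)\<^sup>2 * (g1 h * g1 h))
     + real m * (real n * ((- 1 / (real m * real n))\<^sup>2 * (g1 h * g2 h)))
     + (real n * (real m * ((- 1 / (real m * real n))\<^sup>2 * (g2 h * g1 h)))
     + falling n 2 * ((1 / falling n 2)\<^sup>2 * (g2 h * g2 h))))"
    unfolding cov_Z_def sum_pairs[of "\<lambda>a b. (weight a b)\<^sup>2 * (acov a h * acov b h)"] by (simp add: weight_def offdiag_const falling_2)
  also have "\<dots> = 2 * (g1 h * g1 h) / falling m 2 + 2 * (g2 h * g2 h) / falling n 2 + 4 * (g1 h * g2 h) / (real m * real n)"
    using falling_pos mn by (simp add: field_simps power2_eq_square)
  finally show ?thesis .
qed

text \<open>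
  The mixed term is absorbed by completing the square, because \<open>1 / (m (m - 1))\<close> exceeds \<open>1 / m\<^sup>2\<close>.
\<close>

lemma cov_Z_nonneg: "0 \<le> cov_Z h"
proof -
  have le: "0 \<le> 1 / falling l 2 - 1 / (real l)\<^sup>2" if "2 \<le> l" for l
    using that by (simp add: falling_2 power2_eq_square field_simps)
  have "cov_Z h = 2 * (g1 h / real m + g2 h / real n)\<^sup>2
     + 2 * (g1 h)\<^sup>2 * (1 / falling m 2 - 1 / (real m)\<^sup>2) + 2 * (g2 h)\<^sup>2 * (1 / falling n 2 - 1 / (real n)\<^sup>2)"
    unfolding cov_Z_eq using falling_pos mn by (simp add: field_simps power2_eq_square)
  also have "\<dots> \<ge> 0" using le mn by simp
  finally show ?thesis .
qed

lemma \<kappa>_pos: "0 < \<kappa>"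
proof -
  have "0 < cov_Z 0" unfolding cov_Z_eq using V_pos W_pos falling_pos mn
    by (intro add_pos_pos divide_pos_pos mult_pos_pos) auto
  moreover have "summable (\<lambda>h. cov_Z (Suc h))" using summable_rabs_cancel[OF cov_Z_summable] by (subst summable_Suc_iff)
  then have "0 \<le> (\<Sum>h. cov_Z (Suc h))" using cov_Z_nonneg by (intro suminf_nonneg) auto
  ultimately show ?thesis unfolding \<kappa>_def by simp
qed

text \<open>
  Expanding the product, each of the four resulting sums decouples into a sum over one or two
  observations times a count of the free indices.
\<close>

lemma average_quads_eq_Z:
  "1 / (falling m 2 * falling n 2) * (\<Sum>i1=1..m. \<Sum>i2\<in>{1..m} - {i1}. \<Sum>j1=1..n. \<Sum>j2\<in>{1..n} - {j1}.
      (u (Inr j1) k \<omega> - u (Inl i1) k \<omega>) * (u (Inr j2) k \<omega> - u (Inl i2) k \<omega>)) = Z k \<omega>"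
proof -
  let ?v = "\<lambda>i. u (Inl i) k \<omega>" and ?w = "\<lambda>j. u (Inr j) k \<omega>"
  let ?VV = "\<Sum>i=1..m. \<Sum>i'\<in>{1..m} - {i}. ?v i * ?v i'" and ?WW = "\<Sum>j=1..n. \<Sum>j'\<in>{1..n} - {j}. ?w j * ?w j'"
  let ?VW = "(\<Sum>i=1..m. ?v i) * (\<Sum>j=1..n. ?w j)"
  have "Z k \<omega> = 1 / falling m 2 * ?VV + - 1 / (real m * real n) * ?VW + (- 1 / (real m * real n) * ?VW + 1 / falling n 2 * ?WW)"
    unfolding Z_def sum_pairs[of "\<lambda>a b. weight a b * (u a k \<omega> * u b k \<omega>)"]
    by (simp add: weight_def sum_product sum_distrib_left sum.swap[of _ "{Suc 0..n}"] mult_ac sum_negf sum_divide_distrib)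
  also have "\<dots> = 1 / (falling m 2 * falling n 2) *
      (falling m 2 * ?WW - 2 * (real m - 1) * (real n - 1) * ?VW + falling n 2 * ?VV)"
  proof -
    have frac: "1 / (a * p) * x + - 1 / (a * b) * y + (- 1 / (a * b) * y + 1 / (b * q) * z)
      = 1 / (a * p * (b * q)) * (a * p * z - 2 * p * q * y + b * q * x)"
      if "a \<noteq> 0" "b \<noteq> 0" "p \<noteq> 0" "q \<noteq> 0" for a b p q x y z :: real
      using that by (simp add: field_simps)
    show ?thesis unfolding falling_2 by (rule frac) (use mn in auto)
  qed
  also have "\<dots> = 1 / (falling m 2 * falling n 2) * (\<Sum>i1=1..m. \<Sum>i2\<in>{1..m} - {i1}. \<Sum>j1=1..n. \<Sum>j2\<in>{1..n} - {j1}.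
      (?w j1 - ?v i1) * (?w j2 - ?v i2))" by (simp only: u_statistic_expansion)
  finally show ?thesis by simp
qed

end

section \<open>Two samples with a mean shift\<close>

text \<open>
  The function that turns a scalar product of differences into one of spatial signs, at the limit of the
  normalised squared norms.
\<close>

lemma isCont_inverse_sqrt_product:
  fixes s :: real assumes "0 < s"
  shows "isCont (\<lambda>p. s / (sqrt (fst p) * sqrt (snd p))) (s, s)"
  using assms by (intro continuous_intros) auto

lemma dotp_spatial_sign:
  "dotp d (spatial_sign d x) (spatial_sign d y) = dotp d x y / (L2_set x {1..d} * L2_set y {1..d})"
  unfolding dotp_def spatial_sign_def sum_divide_distrib by (intro sum.cong) simp_all

context two_samples begin

lemma linear_form_second_moment:
  assumes a: "a \<in> I"
  shows "integrable P (\<lambda>\<omega>. (\<Sum>k=1..d. t k * u a k \<omega>)\<^sup>2)"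
    "(\<integral>\<omega>. (\<Sum>k=1..d. t k * u a k \<omega>)\<^sup>2 \<partial>P) = (\<Sum>k=1..d. \<Sum>l=1..d. t k * t l * acov a (lag k l))"
proof -
  interpret s: stationary_mixing M "U a" by (rule sm[OF a])
  have sq: "(\<Sum>k=1..d. t k * u a k \<omega>)\<^sup>2 = (\<Sum>k=1..d. \<Sum>l=1..d. t k * t l * (u a k \<omega> * u a l \<omega>))" for \<omega>
    unfolding power2_eq_square sum_product by (intro sum.cong) (simp_all add: mult_ac)
  have *: "integrable P (\<lambda>\<omega>. t k * t l * (u a k \<omega> * u a l \<omega>))"
    "(\<integral>\<omega>. t k * t l * (u a k \<omega> * u a l \<omega>) \<partial>P) = t k * t l * acov a (lag k l)" if "k \<in> {1..d}" "l \<in> {1..d}" for k l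
  proof -
    have kl: "1 \<le> k" "1 \<le> l" using that by auto
    have m: "(\<lambda>x. U a k x * U a l x) \<in> borel_measurable M" using kl by (intro borel_measurable_times s.rv)
    show "integrable P (\<lambda>\<omega>. t k * t l * (u a k \<omega> * u a l \<omega>))"
      unfolding u_def using component_integral(2)[OF a m] s.integrable_mult[OF kl] by (intro integrable_mult_right) simp
    show "(\<integral>\<omega>. t k * t l * (u a k \<omega> * u a l \<omega>) \<partial>P) = t k * t l * acov a (lag k l)"
      unfolding u_def using component_integral(1)[OF a m] s.autocov[OF kl] by (simp add: acov_def)
  qed
  show "integrable P (\<lambda>\<omega>. (\<Sum>k=1..d. t k * u a k \<omega>)\<^sup>2)" unfolding sq by (intro Bochner_Integration.integrable_sum *)
  show "(\<integral>\<omega>. (\<Sum>k=1..d. t k * u a k \<omega>)\<^sup>2 \<partial>P) = (\<Sum>k=1..d. \<Sum>l=1..d. t k * t l * acov a (lag k l))"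
    unfolding sq by (subst integral_double_sum) (simp_all only: * cong: sum.cong)
qed

lemma squares_average:
  assumes a: "a \<in> I"
  shows "P.tends_in_prob (\<lambda>d \<omega>. (\<Sum>k=1..d. (u a k \<omega>)\<^sup>2) / real d) (acov a 0)"
proof -
  interpret s: stationary_mixing M "U a" by (rule sm[OF a])
  have Um: "(\<lambda>x. (\<Sum>k=1..d. (U a k x)\<^sup>2) / real d - acov a 0) \<in> borel_measurable M" for d
    by (intro borel_measurable_diff borel_measurable_divide borel_measurable_sum borel_measurable_power s.rv) auto
  have U2m: "(\<lambda>x. ((\<Sum>k=1..d. (U a k x)\<^sup>2) / real d - acov a 0)\<^sup>2) \<in> borel_measurable M" for d
    by (intro borel_measurable_power Um)
  have i: "integrable M (\<lambda>x. ((\<Sum>k=1..d. (U a k x)\<^sup>2) / real d - acov a 0)\<^sup>2)" for d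
  proof -
    have s4: "integrable M (\<lambda>x. (\<Sum>k=1..d. (U a k x)\<^sup>2)\<^sup>2)"
    proof -
      have "integrable M (\<lambda>x. (U a k x)\<^sup>2 * (U a l x)\<^sup>2)" if "k \<in> {1..d}" "l \<in> {1..d}" for k l
        by (rule cauchy_schwarz_integral)
           (use that s.rv[of k] s.rv[of l] s.moment4[of k] s.moment4[of l] in \<open>auto simp flip: power_mult\<close>)
      then show ?thesis unfolding power2_eq_square[of "sum _ _"] sum_product
        by (intro Bochner_Integration.integrable_sum) 
    qed
    have s2: "integrable M (\<lambda>x. \<Sum>k=1..d. (U a k x)\<^sup>2)"
      by (intro Bochner_Integration.integrable_sum s.moment2) auto
    show ?thesis using s4 s2 by (simp add: power2_diff power_divide)
  qed
  have "P.tends_in_prob (\<lambda>d \<omega>. (\<Sum>k=1..d. (u a k \<omega>)\<^sup>2) / real d - acov a 0) 0"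
  proof (rule P.tends_in_prob_L2)
    show "(\<lambda>\<omega>. (\<Sum>k=1..d. (u a k \<omega>)\<^sup>2) / real d - acov a 0) \<in> borel_measurable P" for d
      unfolding u_def using component_rv[OF a Um] .
    show "integrable P (\<lambda>\<omega>. ((\<Sum>k=1..d. (u a k \<omega>)\<^sup>2) / real d - acov a 0)\<^sup>2)" for d
      unfolding u_def using component_integral(2)[OF a U2m] i by simp
    have "(\<integral>\<omega>. ((\<Sum>k=1..d. (u a k \<omega>)\<^sup>2) / real d - acov a 0)\<^sup>2 \<partial>P)
        = (\<integral>x. ((\<Sum>k=1..d. (U a k x)\<^sup>2) / real d - acov a 0)\<^sup>2 \<partial>M)" for d
      unfolding u_def by (rule component_integral(1)[OF a U2m])
    then show "(\<lambda>d. \<integral>\<omega>. ((\<Sum>k=1..d. (u a k \<omega>)\<^sup>2) / real d - acov a 0)\<^sup>2 \<partial>P) \<longlonglongrightarrow> 0"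
      using s.law_of_large_numbers_squares by (simp add: acov_def)
  qed
  from P.tends_in_prob_add[OF this P.tends_in_prob_const[OF tendsto_const, of "acov a 0"]]
  show ?thesis by simp
qed

lemma inner_product_rv:
  assumes "a \<in> I" "b \<in> I" shows "(\<lambda>\<omega>. \<Sum>k=1..d. u a k \<omega> * u b k \<omega>) \<in> borel_measurable P"
  using assms by (intro borel_measurable_sum borel_measurable_times u_rv) auto

text \<open>
  The second moment is a sum of products of autocovariances over a square of indices, hence of order \<open>d\<close>.
\<close>

lemma inner_product_tight:
  assumes ab: "a \<in> I" "b \<in> I" "a \<noteq> b"
  shows "P.tight_seq (\<lambda>d \<omega>. (\<Sum>k=1..d. u a k \<omega> * u b k \<omega>) / sqrt (real d))"
proof -
  obtain C where C: "0 < C" "\<And>d. (\<integral>\<omega>. (\<Sum>k=1..d. u a k \<omega> * u b k \<omega>)\<^sup>2 \<partial>P) \<le> C * real d"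
    using inner_product_second_moment_linear[OF ab] by blast
  show ?thesis
  proof (rule P.tight_seq_L2)
    show "(\<lambda>\<omega>. (\<Sum>k=1..d. u a k \<omega> * u b k \<omega>) / sqrt (real d)) \<in> borel_measurable P" for d
      by (intro borel_measurable_divide inner_product_rv ab) auto
    show "integrable P (\<lambda>\<omega>. ((\<Sum>k=1..d. u a k \<omega> * u b k \<omega>) / sqrt (real d))\<^sup>2)" for d
      using inner_product_second_moment(1)[OF ab, of d] by (simp add: power_divide)
    show "\<forall>\<^sub>F d in sequentially. (\<integral>\<omega>. ((\<Sum>k=1..d. u a k \<omega> * u b k \<omega>) / sqrt (real d))\<^sup>2 \<partial>P) \<le> C"
      using eventually_gt_at_top[of 0]
    proof (rule eventually_mono)
      fix d :: nat assume "0 < d"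
      then show "(\<integral>\<omega>. ((\<Sum>k=1..d. u a k \<omega> * u b k \<omega>) / sqrt (real d))\<^sup>2 \<partial>P) \<le> C"
        using C(2)[of d] by (simp add: power_divide divide_le_eq)
    qed
  qed
qed

lemma inverse_sqrt_tendsto: "(\<lambda>d. 1 / sqrt (real d)) \<longlonglongrightarrow> 0"
  by (intro tendsto_divide_0[OF tendsto_const] filterlim_at_top_imp_at_infinity
      filterlim_compose[OF sqrt_at_top filterlim_real_sequentially])

lemma inner_product_average:
  assumes ab: "a \<in> I" "b \<in> I" "a \<noteq> b"
  shows "P.tends_in_prob (\<lambda>d \<omega>. (\<Sum>k=1..d. u a k \<omega> * u b k \<omega>) / real d) 0"
proof -
  have "P.tends_in_prob (\<lambda>d \<omega>. 1 / sqrt (real d) * ((\<Sum>k=1..d. u a k \<omega> * u b k \<omega>) / sqrt (real d))) 0"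
    by (rule P.tends_in_prob_mult_tight[OF P.tends_in_prob_const[OF inverse_sqrt_tendsto] inner_product_tight[OF ab]])
  then show ?thesis by (simp add: mult.commute)
qed

definition noise :: "nat \<Rightarrow> nat \<Rightarrow> nat \<Rightarrow> (nat + nat \<Rightarrow> 'a) \<Rightarrow> real" where
  "noise i j k \<omega> = u (Inr j) k \<omega> - u (Inl i) k \<omega>"

definition \<sigma>2 :: real where "\<sigma>2 = g1 0 + g2 0"

lemma \<sigma>2_pos: "0 < \<sigma>2" unfolding \<sigma>2_def using V_pos W_pos by simp

lemma noise_inner_product_tight:
  assumes "(i1, i2, j1, j2) \<in> quads m n"
  shows "P.tight_seq (\<lambda>d \<omega>. (\<Sum>k=1..d. noise i1 j1 k \<omega> * noise i2 j2 k \<omega>) / sqrt (real d))"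
proof -
  have q: "Inl i1 \<in> I" "Inl i2 \<in> I" "Inr j1 \<in> I" "Inr j2 \<in> I" "i1 \<noteq> i2" "j1 \<noteq> j2"
    using assms by (auto simp: quads_def)
  have eq: "(\<Sum>k=1..d. noise i1 j1 k \<omega> * noise i2 j2 k \<omega>) / sqrt (real d) =
     ((\<Sum>k=1..d. u (Inr j1) k \<omega> * u (Inr j2) k \<omega>) / sqrt (real d) + (\<Sum>k=1..d. u (Inl i1) k \<omega> * u (Inl i2) k \<omega>) / sqrt (real d))
     - ((\<Sum>k=1..d. u (Inr j1) k \<omega> * u (Inl i2) k \<omega>) / sqrt (real d) + (\<Sum>k=1..d. u (Inl i1) k \<omega> * u (Inr j2) k \<omega>) / sqrt (real d))" for d \<omega>
    unfolding noise_def add_divide_distrib[symmetric] diff_divide_distrib[symmetric] sum.distrib[symmetric] sum_subtractf[symmetric]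
    by (simp add: algebra_simps)
  show ?thesis unfolding eq using q by (intro P.tight_seq_diff P.tight_seq_add inner_product_tight) auto
qed

lemma noise_norm_average:
  assumes "i \<in> {1..m}" "j \<in> {1..n}"
  shows "P.tends_in_prob (\<lambda>d \<omega>. (\<Sum>k=1..d. (noise i j k \<omega>)\<^sup>2) / real d) \<sigma>2"
proof -
  have q: "Inl i \<in> I" "Inr j \<in> I" using assms by auto
  have eq: "(\<Sum>k=1..d. u (Inl i) k \<omega> ^ 2) / real d + (\<Sum>k=1..d. u (Inr j) k \<omega> ^ 2) / real d
     - ((\<Sum>k=1..d. u (Inr j) k \<omega> * u (Inl i) k \<omega>) / real d + (\<Sum>k=1..d. u (Inr j) k \<omega> * u (Inl i) k \<omega>) / real d)
     = (\<Sum>k=1..d. (noise i j k \<omega>)\<^sup>2) / real d" for d \<omega>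
    unfolding noise_def add_divide_distrib[symmetric] diff_divide_distrib[symmetric] sum.distrib[symmetric] sum_subtractf[symmetric]
    by (simp add: algebra_simps power2_eq_square)
  have "P.tends_in_prob (\<lambda>d \<omega>. (\<Sum>k=1..d. u (Inl i) k \<omega> ^ 2) / real d + (\<Sum>k=1..d. u (Inr j) k \<omega> ^ 2) / real d
     - ((\<Sum>k=1..d. u (Inr j) k \<omega> * u (Inl i) k \<omega>) / real d + (\<Sum>k=1..d. u (Inr j) k \<omega> * u (Inl i) k \<omega>) / real d)) (acov (Inl i) 0 + acov (Inr j) 0 - (0 + 0))"
    using q by (intro P.tends_in_prob_diff P.tends_in_prob_add squares_average inner_product_average) auto
  then show ?thesis unfolding eq \<sigma>2_def by simp
qed

text \<open>
  The variance of the pure noise part, which will turn out to be \<open>\<Gamma>1\<close>.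
\<close>

definition Gam :: "nat \<Rightarrow> real" where "Gam d = (\<Sum>k=1..d. \<Sum>l=1..d. cov_Z (lag k l))"

lemma Gam_rate: "(\<lambda>d. Gam d / real d) \<longlonglongrightarrow> \<kappa>" unfolding Gam_def by (rule variance_rate)

lemma sqrt_Gam_rate: "(\<lambda>d. sqrt (real d) / sqrt (Gam d)) \<longlonglongrightarrow> 1 / sqrt \<kappa>"
proof -
  have "(\<lambda>d. 1 / sqrt (Gam d / real d)) \<longlonglongrightarrow> 1 / sqrt \<kappa>"
    using \<kappa>_pos by (intro tendsto_intros Gam_rate) auto
  then show ?thesis by (simp add: real_sqrt_divide)
qed

lemma Gam_pos: "\<forall>\<^sub>F d in sequentially. 0 < Gam d \<and> 0 < d"
  using order_tendstoD(1)[OF Gam_rate \<kappa>_pos] eventually_gt_at_top[of 0]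
  by eventually_elim (simp add: zero_less_divide_iff)

lemma Z_sum_tight: "P.tight_seq (\<lambda>d \<omega>. (\<Sum>k=1..d. Z k \<omega>) / sqrt (real d))"
proof (rule P.tight_seq_L2)
  have Zm: "Z k \<in> borel_measurable P" if "1 \<le> k" for k
    using mixing_sequence.Z_rv[OF Z_mixing_sequence that] .
  show "(\<lambda>\<omega>. (\<Sum>k=1..d. Z k \<omega>) / sqrt (real d)) \<in> borel_measurable P" for d
    by (intro borel_measurable_divide borel_measurable_sum Zm) auto
  show "integrable P (\<lambda>\<omega>. ((\<Sum>k=1..d. Z k \<omega>) / sqrt (real d))\<^sup>2)" for d
  proof -
    have "integrable P (\<lambda>\<omega>. (\<Sum>k=1..d. Z k \<omega>)\<^sup>2)"
      unfolding power2_eq_square sum_product by (intro Bochner_Integration.integrable_sum Z_product_expectation) auto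
    then show ?thesis by (simp add: power_divide)
  qed
  have "\<forall>\<^sub>F d in sequentially. Gam d / real d < \<kappa> + 1" by (rule order_tendstoD(2)[OF Gam_rate]) simp
  then show "\<forall>\<^sub>F d in sequentially. (\<integral>\<omega>. ((\<Sum>k=1..d. Z k \<omega>) / sqrt (real d))\<^sup>2 \<partial>P) \<le> \<kappa> + 1"
  proof (rule eventually_mono)
    fix d
    have "(\<integral>\<omega>. ((\<Sum>k=1..d. Z k \<omega>) / sqrt (real d))\<^sup>2 \<partial>P) = Gam d / real d"
      using Z_variance[of d] by (simp add: power_divide Gam_def)
    then show "Gam d / real d < \<kappa> + 1 \<Longrightarrow> (\<integral>\<omega>. ((\<Sum>k=1..d. Z k \<omega>) / sqrt (real d))\<^sup>2 \<partial>P) \<le> \<kappa> + 1" by simp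
  qed
qed

end

text \<open>
  Only the difference \<open>\<mu>\<close> of the means matters, as both statistics depend on the differences \<open>Y - X\<close> alone.
\<close>

locale shifted_samples = two_samples M V W m n for M :: "'a measure" and V W m n +
  fixes \<mu> :: "nat \<Rightarrow> nat \<Rightarrow> real"
  assumes mu_quad: "(\<lambda>d. (\<Sum>k=1..d. \<Sum>l=1..d. \<mu> d k * \<mu> d l * (g1 (lag k l) + g2 (lag k l))) / real d) \<longlonglongrightarrow> 0"
begin

definition shift_sq :: "nat \<Rightarrow> real" where "shift_sq d = (\<Sum>k=1..d. (\<mu> d k)\<^sup>2)"

definition obs_diff :: "nat \<Rightarrow> nat \<Rightarrow> nat \<Rightarrow> (nat + nat \<Rightarrow> 'a) \<Rightarrow> nat \<Rightarrow> real" where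
  "obs_diff d i j \<omega> k = \<mu> d k + noise i j k \<omega>"

definition cross :: "nat \<Rightarrow> nat \<Rightarrow> nat \<Rightarrow> (nat + nat \<Rightarrow> 'a) \<Rightarrow> real" where
  "cross d i j \<omega> = (\<Sum>k=1..d. \<mu> d k * noise i j k \<omega>)"

definition CQ_stat :: "nat \<Rightarrow> (nat + nat \<Rightarrow> 'a) \<Rightarrow> real" where
  "CQ_stat d \<omega> = 1 / real (card (quads m n)) * (\<Sum>(i1, i2, j1, j2)\<in>quads m n. dotp d (obs_diff d i1 j1 \<omega>) (obs_diff d i2 j2 \<omega>))"

definition WMW_stat :: "nat \<Rightarrow> (nat + nat \<Rightarrow> 'a) \<Rightarrow> real" where
  "WMW_stat d \<omega> = 1 / real (card (quads m n)) * (\<Sum>(i1, i2, j1, j2)\<in>quads m n.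
     dotp d (spatial_sign d (obs_diff d i1 j1 \<omega>)) (spatial_sign d (obs_diff d i2 j2 \<omega>)))"

lemma shift_sq_nonneg: "0 \<le> shift_sq d" unfolding shift_sq_def by (intro sum_nonneg) auto

lemma dotp_obs_diff: "dotp d (obs_diff d i1 j1 \<omega>) (obs_diff d i2 j2 \<omega>) = shift_sq d + cross d i1 j1 \<omega> + cross d i2 j2 \<omega> + (\<Sum>k=1..d. noise i1 j1 k \<omega> * noise i2 j2 k \<omega>)"
  unfolding dotp_def obs_diff_def shift_sq_def cross_def sum.distrib[symmetric] by (intro sum.cong) (simp_all add: algebra_simps power2_eq_square)

lemma L2_set_obs_diff: "L2_set (obs_diff d i j \<omega>) {1..d} = sqrt (shift_sq d + 2 * cross d i j \<omega> + (\<Sum>k=1..d. (noise i j k \<omega>)\<^sup>2))"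
  unfolding L2_set_def obs_diff_def shift_sq_def cross_def sum_distrib_left sum.distrib[symmetric]
  by (intro arg_cong[where f=sqrt] sum.cong) (simp_all add: algebra_simps power2_eq_square)

lemma obs_diff_rv: "i \<in> {1..m} \<Longrightarrow> j \<in> {1..n} \<Longrightarrow> 1 \<le> k \<Longrightarrow> (\<lambda>\<omega>. obs_diff d i j \<omega> k) \<in> borel_measurable P"
  unfolding obs_diff_def noise_def by (intro borel_measurable_add borel_measurable_diff u_rv) auto

lemma quadsD: "(i1, i2, j1, j2) \<in> quads m n \<Longrightarrow> i1 \<in> {1..m} \<and> i2 \<in> {1..m} \<and> j1 \<in> {1..n} \<and> j2 \<in> {1..n}"
  by (auto simp: quads_def)

lemma CQ_stat_rv: "CQ_stat d \<in> borel_measurable P"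
  unfolding CQ_stat_def[abs_def] dotp_def
proof (intro borel_measurable_times borel_measurable_const borel_measurable_sum)
  fix q assume "q \<in> quads m n"
  then show "(\<lambda>\<omega>. case q of (i1, i2, j1, j2) \<Rightarrow> \<Sum>k=1..d. obs_diff d i1 j1 \<omega> k * obs_diff d i2 j2 \<omega> k) \<in> borel_measurable P"
    using quadsD by (cases q) (auto intro!: borel_measurable_sum borel_measurable_times obs_diff_rv)
qed

lemma WMW_stat_rv: "WMW_stat d \<in> borel_measurable P"
  unfolding WMW_stat_def[abs_def] dotp_def spatial_sign_def L2_set_def
proof (intro borel_measurable_times borel_measurable_const borel_measurable_sum)
  fix q assume "q \<in> quads m n"
  then show "(\<lambda>\<omega>. case q of (i1, i2, j1, j2) \<Rightarrow> \<Sum>k=1..d. obs_diff d i1 j1 \<omega> k / sqrt (\<Sum>i=1..d. (obs_diff d i1 j1 \<omega> i)\<^sup>2)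
      * (obs_diff d i2 j2 \<omega> k / sqrt (\<Sum>i=1..d. (obs_diff d i2 j2 \<omega> i)\<^sup>2))) \<in> borel_measurable P"
    using quadsD by (cases q) (auto intro!: borel_measurable_sum borel_measurable_times borel_measurable_divide
      borel_measurable_power measurable_compose[OF _ borel_measurable_sqrt] obs_diff_rv)
qed

text \<open>
  The quadratic form in the assumption is the sum of the variances of the two parts of the linear
  term, both nonnegative, so that each part is controlled.
\<close>

lemma cross_vanishes:
  assumes "i \<in> {1..m}" "j \<in> {1..n}"
  shows "P.tends_in_prob (\<lambda>d \<omega>. cross d i j \<omega> / sqrt (real d)) 0"
proof -
  have q: "Inl i \<in> I" "Inr j \<in> I" using assms by auto
  define qf where "qf a d = (\<Sum>k=1..d. \<Sum>l=1..d. \<mu> d k * \<mu> d l * acov a (lag k l))" for a d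
  have qf0: "0 \<le> qf a d" if "a \<in> I" for a d
  proof -
    have "0 \<le> (\<integral>\<omega>. (\<Sum>k=1..d. \<mu> d k * u a k \<omega>)\<^sup>2 \<partial>P)" by simp
    then show ?thesis unfolding linear_form_second_moment(2)[OF that, where d=d and t="\<mu> d"] qf_def .
  qed
  have tot: "(\<Sum>k=1..d. \<Sum>l=1..d. \<mu> d k * \<mu> d l * (g1 (lag k l) + g2 (lag k l))) = qf (Inl i) d + qf (Inr j) d" for d
    by (simp add: qf_def distrib_left sum.distrib)
  have qf_lim: "(\<lambda>d. qf a d / real d) \<longlonglongrightarrow> 0" if "a = Inl i \<or> a = Inr j" for a
  proof (rule tendsto_sandwich[OF _ _ tendsto_const mu_quad])
    show "\<forall>\<^sub>F d in sequentially. 0 \<le> qf a d / real d" using qf0 q that by auto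
    show "\<forall>\<^sub>F d in sequentially. qf a d / real d \<le> (\<Sum>k=1..d. \<Sum>l=1..d. \<mu> d k * \<mu> d l * (g1 (lag k l) + g2 (lag k l))) / real d"
      unfolding tot using qf0 q that by (intro always_eventually allI divide_right_mono) auto
  qed
  have part: "P.tends_in_prob (\<lambda>d \<omega>. (\<Sum>k=1..d. \<mu> d k * u a k \<omega>) / sqrt (real d)) 0" if a: "a = Inl i \<or> a = Inr j" for a
  proof (rule P.tends_in_prob_L2)
    have aI: "a \<in> I" using a q by auto
    show "(\<lambda>\<omega>. (\<Sum>k=1..d. \<mu> d k * u a k \<omega>) / sqrt (real d)) \<in> borel_measurable P" for d
      using aI by (intro borel_measurable_divide borel_measurable_sum borel_measurable_times u_rv) auto
    show "integrable P (\<lambda>\<omega>. ((\<Sum>k=1..d. \<mu> d k * u a k \<omega>) / sqrt (real d))\<^sup>2)" for d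
      using linear_form_second_moment(1)[OF aI, where d=d and t="\<mu> d"] by (simp add: power_divide)
    have "(\<integral>\<omega>. ((\<Sum>k=1..d. \<mu> d k * u a k \<omega>) / sqrt (real d))\<^sup>2 \<partial>P) = qf a d / real d" for d
      using linear_form_second_moment(2)[OF aI, where d=d and t="\<mu> d"] by (simp add: power_divide qf_def)
    then show "(\<lambda>d. \<integral>\<omega>. ((\<Sum>k=1..d. \<mu> d k * u a k \<omega>) / sqrt (real d))\<^sup>2 \<partial>P) \<longlonglongrightarrow> 0" using qf_lim[OF a] by simp
  qed
  have "P.tends_in_prob (\<lambda>d \<omega>. (\<Sum>k=1..d. \<mu> d k * u (Inr j) k \<omega>) / sqrt (real d) - (\<Sum>k=1..d. \<mu> d k * u (Inl i) k \<omega>) / sqrt (real d)) (0 - 0)"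
    by (intro P.tends_in_prob_diff part) auto
  moreover have "(\<Sum>k=1..d. \<mu> d k * u (Inr j) k \<omega>) / sqrt (real d) - (\<Sum>k=1..d. \<mu> d k * u (Inl i) k \<omega>) / sqrt (real d) = cross d i j \<omega> / sqrt (real d)" for d \<omega>
    unfolding cross_def noise_def diff_divide_distrib[symmetric] sum_subtractf[symmetric] by (simp add: algebra_simps)
  ultimately show ?thesis by simp
qed

lemma squared_norm_remainder:
  assumes "i \<in> {1..m}" "j \<in> {1..n}"
  shows "P.tends_in_prob (\<lambda>d \<omega>. (2 * cross d i j \<omega> + (\<Sum>k=1..d. (noise i j k \<omega>)\<^sup>2)) / real d) \<sigma>2"
proof -
  have "P.tends_in_prob (\<lambda>d \<omega>. (2 * (1 / sqrt (real d))) * (cross d i j \<omega> / sqrt (real d)) + (\<Sum>k=1..d. (noise i j k \<omega>)\<^sup>2) / real d) ((2 * 0) * 0 + \<sigma>2)"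
    by (intro P.tends_in_prob_add P.tends_in_prob_mult cross_vanishes noise_norm_average assms
        P.tends_in_prob_const tendsto_mult tendsto_const inverse_sqrt_tendsto)
  then show ?thesis by (simp add: add_divide_distrib)
qed

lemma remainder_tight:
  assumes q: "(i1, i2, j1, j2) \<in> quads m n"
  shows "P.tight_seq (\<lambda>d \<omega>. (cross d i1 j1 \<omega> + cross d i2 j2 \<omega> + (\<Sum>k=1..d. noise i1 j1 k \<omega> * noise i2 j2 k \<omega>)) / sqrt (real d))"
  unfolding add_divide_distrib using quadsD[OF q]
  by (intro P.tight_seq_add noise_inner_product_tight[OF q] P.tends_in_prob_imp_tight[OF cross_vanishes]) auto

end

section \<open>Limits of the rejection probabilities\<close>

text \<open>
  The standard normal distribution enters through its distribution function, which is continuous and strictly increasing: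
  continuity makes weak convergence pointwise, and strict monotonicity identifies the critical value and separates
  the limiting power from \<open>\<alpha>\<close> and from 1.
\<close>

interpretation std_normal: real_distribution std_normal_distribution
  by (rule real_dist_normal_dist)

lemma std_normal_cdf_continuous: "isCont (cdf std_normal_distribution) x"
proof -
  have "{x} \<in> null_sets std_normal_distribution"
    using AE_lborel_singleton[of x] by (subst null_sets_density_iff) (auto simp: frequently_def elim: eventually_mono)
  then have "measure std_normal_distribution {x} = 0" by (simp add: measure_def null_setsD1)
  then show ?thesis by (simp add: std_normal.isCont_cdf)
qed

lemma std_normal_cdf_strict_mono:
  assumes "a < b" shows "cdf std_normal_distribution a < cdf std_normal_distribution b"
proof -
  have "{a<..b} \<notin> null_sets std_normal_distribution"
  proof
    assume "{a<..b} \<in> null_sets std_normal_distribution"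
    then have "AE x\<in>{a<..b} in lborel. ennreal (std_normal_density x) = 0"
      by (subst (asm) null_sets_density_iff) auto
    then have "AE x in lborel. x \<notin> {a<..b}"
      by (rule eventually_mono) (metis ennreal_eq_0_iff normal_density_pos not_le zero_less_one)
    then have "{x \<in> space lborel. \<not> x \<notin> {a<..b}} \<in> null_sets lborel" by (intro AE_iff_null_sets[THEN iffD2] | simp)+
    moreover have "{x \<in> space lborel. \<not> x \<notin> {a<..b}} = {a<..b}" by auto
    ultimately have "emeasure lborel {a<..b} = 0" by (metis null_setsD1)
    then show False using assms by simp
  qed
  then have "emeasure std_normal_distribution {a<..b} \<noteq> 0" by (auto simp: null_sets_def)
  then have "0 < measure std_normal_distribution {a<..b}"
    by (simp add: std_normal.emeasure_eq_measure zero_less_measure_iff)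
  then show ?thesis using std_normal.cdf_diff_eq[OF assms] by simp
qed

lemma cdf_gauss_crit:
  assumes "0 < \<alpha>" "\<alpha> < 1"
  shows "cdf std_normal_distribution (gauss_crit \<alpha>) = 1 - \<alpha>"
proof -
  let ?F = "cdf std_normal_distribution"
  have "\<forall>\<^sub>F x in at_bot. ?F x < 1 - \<alpha>" by (rule order_tendstoD(2)[OF std_normal.cdf_lim_at_bot]) (use assms in simp)
  then obtain a where a: "?F a < 1 - \<alpha>" by (auto simp: eventually_at_bot_linorder)
  have "\<forall>\<^sub>F x in at_top. 1 - \<alpha> < ?F x" by (rule order_tendstoD(1)[OF std_normal.cdf_lim_at_top_prob]) (use assms in simp)
  then obtain b where b: "1 - \<alpha> < ?F b" by (auto simp: eventually_at_top_linorder)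
  have ab: "a \<le> b" using std_normal.cdf_nondecreasing[of b a] a b by force
  obtain z where z: "?F z = 1 - \<alpha>"
    using IVT[of ?F a "1 - \<alpha>" b] a b ab std_normal_cdf_continuous by auto
  have "{x. 1 - \<alpha> \<le> ?F x} = {z..}"
  proof safe
    fix x assume "1 - \<alpha> \<le> ?F x"
    then show "z \<le> x" using std_normal_cdf_strict_mono[of x z] z by force
  next
    fix x assume "z \<le> x"
    then show "1 - \<alpha> \<le> ?F x" using std_normal.cdf_nondecreasing[of z x] z by simp
  qed
  then show ?thesis unfolding gauss_crit_def quantile_def using z by simp
qed

context shifted_samples begin

abbreviation N :: real where "N \<equiv> real (card (quads m n))"

lemma quads_nonempty: "quads m n \<noteq> {}"
proof -
  have "(1, 2, 1, 2) \<in> quads m n" using mn by (auto simp: quads_def)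
  then show ?thesis by blast
qed

lemma N_pos: "0 < N" using quads_nonempty finite_quads by (simp add: card_gt_0_iff)

lemma CQ_stat_decomposition:
  "CQ_stat d \<omega> = shift_sq d + 1 / N * (\<Sum>(i1, i2, j1, j2)\<in>quads m n. cross d i1 j1 \<omega> + cross d i2 j2 \<omega>) + (\<Sum>k=1..d. Z k \<omega>)"
proof -
  have z: "(\<Sum>k=1..d. Z k \<omega>) = 1 / N * (\<Sum>(i1, i2, j1, j2)\<in>quads m n. \<Sum>k=1..d. noise i1 j1 k \<omega> * noise i2 j2 k \<omega>)"
  proof -
    have "Z k \<omega> = 1 / N * (\<Sum>(i1, i2, j1, j2)\<in>quads m n. noise i1 j1 k \<omega> * noise i2 j2 k \<omega>)" for k
      unfolding average_quads_eq_Z[symmetric] card_quads sum_quads noise_def ..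
    then have "(\<Sum>k=1..d. Z k \<omega>) = 1 / N * (\<Sum>k=1..d. \<Sum>(i1, i2, j1, j2)\<in>quads m n. noise i1 j1 k \<omega> * noise i2 j2 k \<omega>)"
      by (simp add: sum_distrib_left)
    also have "(\<Sum>k=1..d. \<Sum>(i1, i2, j1, j2)\<in>quads m n. noise i1 j1 k \<omega> * noise i2 j2 k \<omega>)
      = (\<Sum>(i1, i2, j1, j2)\<in>quads m n. \<Sum>k=1..d. noise i1 j1 k \<omega> * noise i2 j2 k \<omega>)"
      by (subst sum.swap) (simp add: split_def)
    finally show ?thesis .
  qed
  have "CQ_stat d \<omega> = 1 / N * (\<Sum>q\<in>quads m n. shift_sq d + (case q of (i1, i2, j1, j2) \<Rightarrow> cross d i1 j1 \<omega> + cross d i2 j2 \<omega>)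
     + (case q of (i1, i2, j1, j2) \<Rightarrow> \<Sum>k=1..d. noise i1 j1 k \<omega> * noise i2 j2 k \<omega>))"
    unfolding CQ_stat_def dotp_obs_diff by (simp add: split_def add.assoc)
  also have "\<dots> = shift_sq d + 1 / N * (\<Sum>(i1, i2, j1, j2)\<in>quads m n. cross d i1 j1 \<omega> + cross d i2 j2 \<omega>) + (\<Sum>k=1..d. Z k \<omega>)"
    unfolding z sum.distrib using N_pos by (simp add: distrib_left)
  finally show ?thesis .
qed

text \<open>
  The contribution of one quadruple to \<open>T_CQ / \<surd>d\<close>.
\<close>

definition CQ_term :: "nat \<times> nat \<times> nat \<times> nat \<Rightarrow> nat \<Rightarrow> (nat + nat \<Rightarrow> 'a) \<Rightarrow> real" where
  "CQ_term q d \<omega> = (case q of (i1, i2, j1, j2) \<Rightarrow> dotp d (obs_diff d i1 j1 \<omega>) (obs_diff d i2 j2 \<omega>) / sqrt (real d))"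

text \<open>
  The squared norm of a difference, divided by \<open>d\<close>.
\<close>

definition sq_ratio :: "nat \<Rightarrow> nat \<Rightarrow> nat \<Rightarrow> (nat + nat \<Rightarrow> 'a) \<Rightarrow> real" where
  "sq_ratio i j d \<omega> = shift_sq d / real d + (2 * cross d i j \<omega> + (\<Sum>k=1..d. (noise i j k \<omega>)\<^sup>2)) / real d"

text \<open>
  The contribution of one quadruple to \<open>d \<sigma>2 T_WMW / \<surd>d\<close>. The formula also covers a zero difference, where
  both the spatial sign and the quotient are zero.
\<close>

definition WMW_term :: "nat \<times> nat \<times> nat \<times> nat \<Rightarrow> nat \<Rightarrow> (nat + nat \<Rightarrow> 'a) \<Rightarrow> real" where
  "WMW_term q d \<omega> = (case q of (i1, i2, j1, j2) \<Rightarrow> \<sigma>2 / (sqrt (sq_ratio i1 j1 d \<omega>) * sqrt (sq_ratio i2 j2 d \<omega>)) * CQ_term q d \<omega>)"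

lemma L2_set_obs_diff_eq: "0 < d \<Longrightarrow> L2_set (obs_diff d i j \<omega>) {1..d} = sqrt (real d) * sqrt (sq_ratio i j d \<omega>)"
  unfolding L2_set_obs_diff sq_ratio_def by (simp add: real_sqrt_mult[symmetric] field_simps)

lemma CQ_stat_eq: "0 < d \<Longrightarrow> CQ_stat d \<omega> / sqrt (Gam d) = sqrt (real d) / sqrt (Gam d) * (1 / N * (\<Sum>q\<in>quads m n. CQ_term q d \<omega>))"
proof -
  assume d: "0 < d"
  have "(\<Sum>q\<in>quads m n. CQ_term q d \<omega>) = (\<Sum>(i1, i2, j1, j2)\<in>quads m n. dotp d (obs_diff d i1 j1 \<omega>) (obs_diff d i2 j2 \<omega>)) / sqrt (real d)"
    unfolding CQ_term_def sum_divide_distrib by (intro sum.cong) auto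
  then show ?thesis unfolding CQ_stat_def using d by simp
qed

lemma WMW_stat_eq: "0 < d \<Longrightarrow> real d * \<sigma>2 * WMW_stat d \<omega> / sqrt (Gam d) = sqrt (real d) / sqrt (Gam d) * (1 / N * (\<Sum>q\<in>quads m n. WMW_term q d \<omega>))"
proof -
  assume d: "0 < d"
  have aux: "s / (x * y) * (p / a) = a * a * s / a * (p / (a * x * (a * y)))" if "a \<noteq> 0" for s x y p a :: real
    using that by (cases "x = 0"; cases "y = 0") (simp_all add: field_simps)
  have rd: "real d * \<sigma>2 / sqrt (real d) = sqrt (real d) * sqrt (real d) * \<sigma>2 / sqrt (real d)" by simp
  have "WMW_term q d \<omega> = (case q of (i1, i2, j1, j2) \<Rightarrow> real d * \<sigma>2 / sqrt (real d) *
     dotp d (spatial_sign d (obs_diff d i1 j1 \<omega>)) (spatial_sign d (obs_diff d i2 j2 \<omega>)))" for q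
  proof -
    obtain i1 i2 j1 j2 where qq: "q = (i1, i2, j1, j2)" by (cases q)
    show ?thesis unfolding WMW_term_def CQ_term_def dotp_spatial_sign L2_set_obs_diff_eq[OF d] qq prod.case rd
      by (rule aux) (use d in simp)
  qed
  then have "(\<Sum>q\<in>quads m n. WMW_term q d \<omega>) = real d * \<sigma>2 / sqrt (real d) *
    (\<Sum>(i1, i2, j1, j2)\<in>quads m n. dotp d (spatial_sign d (obs_diff d i1 j1 \<omega>)) (spatial_sign d (obs_diff d i2 j2 \<omega>)))"
    unfolding sum_distrib_left by (intro sum.cong) auto
  then show ?thesis unfolding WMW_stat_def using d by (simp add: mult_ac)
qed

lemma Z_sum_cdf: "(\<lambda>d. P.prob {\<omega>\<in>space P. (\<Sum>k=1..d. Z k \<omega>) / sqrt (\<kappa> * real d) > x}) \<longlonglongrightarrow> 1 - cdf std_normal_distribution x"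
proof -
  have Zm: "Z k \<in> borel_measurable P" if "1 \<le> k" for k
    using mixing_sequence.Z_rv[OF Z_mixing_sequence that] .
  have m: "(\<lambda>\<omega>. (\<Sum>k=1..d. Z k \<omega>) / sqrt (\<kappa> * real d)) \<in> borel_measurable P" for d
    by (intro borel_measurable_divide borel_measurable_sum Zm) auto
  have "(\<lambda>d. cdf (distr P borel (\<lambda>\<omega>. (\<Sum>k=1..d. Z k \<omega>) / sqrt (\<kappa> * real d))) x) \<longlonglongrightarrow> cdf std_normal_distribution x"
    using Z_central_limit[OF \<kappa>_pos] std_normal_cdf_continuous unfolding weak_conv_m_def weak_conv_def by blast
  then have "(\<lambda>d. 1 - cdf (distr P borel (\<lambda>\<omega>. (\<Sum>k=1..d. Z k \<omega>) / sqrt (\<kappa> * real d))) x) \<longlonglongrightarrow> 1 - cdf std_normal_distribution x"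
    by (intro tendsto_intros)
  moreover have "1 - cdf (distr P borel (\<lambda>\<omega>. (\<Sum>k=1..d. Z k \<omega>) / sqrt (\<kappa> * real d))) x
      = P.prob {\<omega>\<in>space P. (\<Sum>k=1..d. Z k \<omega>) / sqrt (\<kappa> * real d) > x}" for d
  proof -
    let ?f = "\<lambda>\<omega>. (\<Sum>k=1..d. Z k \<omega>) / sqrt (\<kappa> * real d)"
    have "cdf (distr P borel ?f) x = P.prob {\<omega>\<in>space P. ?f \<omega> \<le> x}"
      unfolding cdf_def by (subst measure_distr[OF m]) (auto intro!: arg_cong[where f=P.prob])
    moreover have "P.prob {\<omega>\<in>space P. \<not> ?f \<omega> \<le> x} = 1 - P.prob {\<omega>\<in>space P. ?f \<omega> \<le> x}"
    proof -
      note [measurable] = m[of d]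
      show ?thesis by (intro P.prob_neg) measurable
    qed
    ultimately show ?thesis by (simp add: not_le)
  qed
  ultimately show ?thesis by simp
qed

text \<open>
  The statistic is compared with the noise part normalised by its asymptotic standard deviation; the replacement of
  \<open>\<Gamma>1\<close> by \<open>\<kappa> d\<close> costs a factor tending to 1, times a tight sequence.
\<close>

lemma CQ_stat_limit_finite:
  assumes lim: "(\<lambda>d. shift_sq d / sqrt (Gam d)) \<longlonglongrightarrow> l"
  shows "(\<lambda>d. P.prob {\<omega>\<in>space P. CQ_stat d \<omega> / sqrt (Gam d) > x}) \<longlonglongrightarrow> 1 - cdf std_normal_distribution (x - l)"
proof (rule P.slutsky[where A="\<lambda>d \<omega>. (\<Sum>k=1..d. Z k \<omega>) / sqrt (\<kappa> * real d)"])
  have Zm: "Z k \<in> borel_measurable P" if "1 \<le> k" for k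
    using mixing_sequence.Z_rv[OF Z_mixing_sequence that] .
  show "(\<lambda>\<omega>. (\<Sum>k=1..d. Z k \<omega>) / sqrt (\<kappa> * real d)) \<in> borel_measurable P" for d
    by (intro borel_measurable_divide borel_measurable_sum Zm) auto
  show "(\<lambda>\<omega>. CQ_stat d \<omega> / sqrt (Gam d)) \<in> borel_measurable P" for d
    by (intro borel_measurable_divide CQ_stat_rv) auto
  show "(\<lambda>d. P.prob {\<omega>\<in>space P. (\<Sum>k=1..d. Z k \<omega>) / sqrt (\<kappa> * real d) > x}) \<longlonglongrightarrow> 1 - cdf std_normal_distribution x" for x
    by (rule Z_sum_cdf)
  show "isCont (\<lambda>x. 1 - cdf std_normal_distribution x) (x - l)"
    by (intro continuous_intros std_normal_cdf_continuous)
  let ?L = "\<lambda>d \<omega>. 1 / N * (\<Sum>q\<in>quads m n. case q of (i1, i2, j1, j2) \<Rightarrow> cross d i1 j1 \<omega> / sqrt (real d) + cross d i2 j2 \<omega> / sqrt (real d))"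
  have L: "P.tends_in_prob ?L (1 / N * (\<Sum>q\<in>quads m n. 0))"
  proof (intro P.tends_in_prob_mult P.tends_in_prob_const tendsto_const P.tends_in_prob_sum finite_quads)
    fix q assume q: "q \<in> quads m n"
    obtain i1 i2 j1 j2 where qq: "q = (i1, i2, j1, j2)" by (cases q)
    have "P.tends_in_prob (\<lambda>d \<omega>. cross d i1 j1 \<omega> / sqrt (real d) + cross d i2 j2 \<omega> / sqrt (real d)) (0 + 0)"
      using quadsD q unfolding qq by (intro P.tends_in_prob_add cross_vanishes) auto
    then show "P.tends_in_prob (\<lambda>d \<omega>. case q of (i1, i2, j1, j2) \<Rightarrow> cross d i1 j1 \<omega> / sqrt (real d) + cross d i2 j2 \<omega> / sqrt (real d)) 0"
      unfolding qq by simp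
  qed
  have dif: "(\<lambda>d. sqrt (real d) / sqrt (Gam d) - 1 / sqrt \<kappa>) \<longlonglongrightarrow> 0"
    using tendsto_diff[OF sqrt_Gam_rate tendsto_const[of "1 / sqrt \<kappa>"]] by simp
  have "P.tends_in_prob (\<lambda>d \<omega>. shift_sq d / sqrt (Gam d) + sqrt (real d) / sqrt (Gam d) * ?L d \<omega>
     + (sqrt (real d) / sqrt (Gam d) - 1 / sqrt \<kappa>) * ((\<Sum>k=1..d. Z k \<omega>) / sqrt (real d)))
     (l + 1 / sqrt \<kappa> * (1 / N * (\<Sum>q\<in>quads m n. 0)) + 0)"
    by (intro P.tends_in_prob_add P.tends_in_prob_mult L P.tends_in_prob_const lim sqrt_Gam_rate
        P.tends_in_prob_mult_tight[OF P.tends_in_prob_const[OF dif] Z_sum_tight])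
  then have "P.tends_in_prob (\<lambda>d \<omega>. shift_sq d / sqrt (Gam d) + sqrt (real d) / sqrt (Gam d) * ?L d \<omega>
     + (sqrt (real d) / sqrt (Gam d) - 1 / sqrt \<kappa>) * ((\<Sum>k=1..d. Z k \<omega>) / sqrt (real d))) l" by simp
  then show "P.tends_in_prob (\<lambda>d \<omega>. CQ_stat d \<omega> / sqrt (Gam d) - (\<Sum>k=1..d. Z k \<omega>) / sqrt (\<kappa> * real d)) l"
  proof (rule P.tends_in_prob_cong)
    show "\<forall>\<^sub>F d in sequentially. \<forall>\<omega>\<in>space P. shift_sq d / sqrt (Gam d) + sqrt (real d) / sqrt (Gam d) * ?L d \<omega>
     + (sqrt (real d) / sqrt (Gam d) - 1 / sqrt \<kappa>) * ((\<Sum>k=1..d. Z k \<omega>) / sqrt (real d))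
     = CQ_stat d \<omega> / sqrt (Gam d) - (\<Sum>k=1..d. Z k \<omega>) / sqrt (\<kappa> * real d)"
      using Gam_pos
    proof (rule eventually_mono, intro ballI)
      fix d :: nat and \<omega> assume d: "0 < Gam d \<and> 0 < d"
      have alg: "x / G + a / G * (y / a) + (a / G - 1 / K) * (z / a) = (x + y + z) / G - z / (K * a)"
        if "G \<noteq> 0" "a \<noteq> 0" "K \<noteq> 0" for x y z a G K :: real
        using that by (simp add: field_simps)
      let ?l = "\<Sum>(i1, i2, j1, j2)\<in>quads m n. cross d i1 j1 \<omega> + cross d i2 j2 \<omega>"
      have L: "?L d \<omega> = 1 / N * ?l / sqrt (real d)"
        unfolding times_divide_eq_right[symmetric] sum_divide_distrib by (intro arg_cong2[where f="(*)"] sum.cong refl) (auto simp: add_divide_distrib)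
      show "shift_sq d / sqrt (Gam d) + sqrt (real d) / sqrt (Gam d) * ?L d \<omega>
       + (sqrt (real d) / sqrt (Gam d) - 1 / sqrt \<kappa>) * ((\<Sum>k=1..d. Z k \<omega>) / sqrt (real d))
       = CQ_stat d \<omega> / sqrt (Gam d) - (\<Sum>k=1..d. Z k \<omega>) / sqrt (\<kappa> * real d)"
        unfolding L CQ_stat_decomposition real_sqrt_mult by (rule alg) (use d \<kappa>_pos in auto)
    qed
  qed
qed

text \<open>
  A finite limit forces \<open>\<parallel>\<mu>\<parallel>\<^sup>2 = O(\<surd>d)\<close>, which is negligible in the norms. Each summand then differs
  from its counterpart by a factor tending to 1, and the counterpart is tight.
\<close>

lemma WMW_stat_limit_finite:
  assumes lim: "(\<lambda>d. shift_sq d / sqrt (Gam d)) \<longlonglongrightarrow> l"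
  shows "(\<lambda>d. P.prob {\<omega>\<in>space P. real d * \<sigma>2 * WMW_stat d \<omega> / sqrt (Gam d) > x}) \<longlonglongrightarrow> 1 - cdf std_normal_distribution (x - l)"
proof -
  have s: "(\<lambda>d. shift_sq d / sqrt (real d)) \<longlonglongrightarrow> l * sqrt \<kappa>"
  proof (rule Lim_transform_eventually)
    have "(\<lambda>d. shift_sq d / sqrt (Gam d) * sqrt (Gam d / real d)) \<longlonglongrightarrow> l * sqrt \<kappa>"
      by (intro tendsto_mult lim tendsto_real_sqrt Gam_rate)
    then show "(\<lambda>d. shift_sq d / sqrt (Gam d) * sqrt (Gam d / real d)) \<longlonglongrightarrow> l * sqrt \<kappa>" .
    show "\<forall>\<^sub>F d in sequentially. shift_sq d / sqrt (Gam d) * sqrt (Gam d / real d) = shift_sq d / sqrt (real d)"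
      using Gam_pos by (rule eventually_mono) (simp add: real_sqrt_divide)
  qed
  have t: "(\<lambda>d. shift_sq d / real d) \<longlonglongrightarrow> 0"
  proof -
    have "(\<lambda>d. 1 / sqrt (real d) * (shift_sq d / sqrt (real d))) \<longlonglongrightarrow> 0 * (l * sqrt \<kappa>)"
      by (intro tendsto_mult inverse_sqrt_tendsto s)
    then show ?thesis by simp
  qed
  have Xlim: "P.tends_in_prob (sq_ratio i j) \<sigma>2" if "i \<in> {1..m}" "j \<in> {1..n}" for i j
    using P.tends_in_prob_add[OF P.tends_in_prob_const[OF t] squared_norm_remainder[OF that]]
    unfolding sq_ratio_def[abs_def] by simp
  have AB: "P.tends_in_prob (\<lambda>d \<omega>. WMW_term q d \<omega> - CQ_term q d \<omega>) 0" if q: "q \<in> quads m n" for q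
  proof -
    obtain i1 i2 j1 j2 where qq: "q = (i1, i2, j1, j2)" by (cases q)
    have ij: "i1 \<in> {1..m}" "i2 \<in> {1..m}" "j1 \<in> {1..n}" "j2 \<in> {1..n}" using quadsD q unfolding qq by auto
    have "P.tends_in_prob (\<lambda>d \<omega>. \<sigma>2 / (sqrt (sq_ratio i1 j1 d \<omega>) * sqrt (sq_ratio i2 j2 d \<omega>))) (\<sigma>2 / (sqrt \<sigma>2 * sqrt \<sigma>2))"
      by (rule P.tends_in_prob_continuous2[where f="\<lambda>x y. \<sigma>2 / (sqrt x * sqrt y)"])
         (intro Xlim ij isCont_inverse_sqrt_product \<sigma>2_pos)+
    from P.tends_in_prob_diff[OF this P.tends_in_prob_const[OF tendsto_const[of 1]]]
    have th: "P.tends_in_prob (\<lambda>d \<omega>. \<sigma>2 / (sqrt (sq_ratio i1 j1 d \<omega>) * sqrt (sq_ratio i2 j2 d \<omega>)) - 1) 0" using \<sigma>2_pos by simp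
    have "CQ_term q d \<omega> = shift_sq d / sqrt (real d) + (cross d i1 j1 \<omega> + cross d i2 j2 \<omega> + (\<Sum>k=1..d. noise i1 j1 k \<omega> * noise i2 j2 k \<omega>)) / sqrt (real d)" for d \<omega>
      unfolding CQ_term_def qq by (simp add: dotp_obs_diff add_divide_distrib)
    then have "P.tight_seq (CQ_term q)"
      using P.tight_seq_add[OF P.tends_in_prob_imp_tight[OF P.tends_in_prob_const[OF s]] remainder_tight[OF q[unfolded qq]]]
      by (simp add: P.tight_seq_def)
    from P.tends_in_prob_mult_tight[OF th this] show ?thesis unfolding WMW_term_def qq by (simp add: left_diff_distrib)
  qed
  have "P.tends_in_prob (\<lambda>d \<omega>. sqrt (real d) / sqrt (Gam d) * (1 / N * (\<Sum>q\<in>quads m n. WMW_term q d \<omega> - CQ_term q d \<omega>))) (1 / sqrt \<kappa> * (1 / N * (\<Sum>q\<in>quads m n. 0)))"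
    by (intro P.tends_in_prob_mult P.tends_in_prob_const sqrt_Gam_rate tendsto_const P.tends_in_prob_sum finite_quads AB)
  then have "P.tends_in_prob (\<lambda>d \<omega>. sqrt (real d) / sqrt (Gam d) * (1 / N * (\<Sum>q\<in>quads m n. WMW_term q d \<omega> - CQ_term q d \<omega>))) 0" by simp
  then have dif: "P.tends_in_prob (\<lambda>d \<omega>. real d * \<sigma>2 * WMW_stat d \<omega> / sqrt (Gam d) - CQ_stat d \<omega> / sqrt (Gam d)) 0"
  proof (rule P.tends_in_prob_cong)
    show "\<forall>\<^sub>F d in sequentially. \<forall>\<omega>\<in>space P. sqrt (real d) / sqrt (Gam d) * (1 / N * (\<Sum>q\<in>quads m n. WMW_term q d \<omega> - CQ_term q d \<omega>))
       = real d * \<sigma>2 * WMW_stat d \<omega> / sqrt (Gam d) - CQ_stat d \<omega> / sqrt (Gam d)"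
      using eventually_gt_at_top[of 0]
      by (rule eventually_mono) (intro ballI, simp only: WMW_stat_eq CQ_stat_eq sum_subtractf right_diff_distrib)
  qed
  have "(\<lambda>d. P.prob {\<omega>\<in>space P. real d * \<sigma>2 * WMW_stat d \<omega> / sqrt (Gam d) > x}) \<longlonglongrightarrow> 1 - cdf std_normal_distribution (x - 0 - l)"
  proof (rule P.slutsky[where A="\<lambda>d \<omega>. CQ_stat d \<omega> / sqrt (Gam d)" and G="\<lambda>x. 1 - cdf std_normal_distribution (x - l)"])
    show "(\<lambda>\<omega>. CQ_stat d \<omega> / sqrt (Gam d)) \<in> borel_measurable P" for d
      by (intro borel_measurable_divide CQ_stat_rv) auto
    show "(\<lambda>\<omega>. real d * \<sigma>2 * WMW_stat d \<omega> / sqrt (Gam d)) \<in> borel_measurable P" for d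
      by (intro borel_measurable_divide borel_measurable_times WMW_stat_rv) auto
    show "isCont (\<lambda>x. 1 - cdf std_normal_distribution (x - l)) (x - 0)"
      by (intro continuous_intros isCont_o2[OF _ std_normal_cdf_continuous])
  qed (intro CQ_stat_limit_finite lim dif)+
  then show ?thesis by simp
qed

lemma CQ_term_infinite:
  assumes s: "filterlim (\<lambda>d. shift_sq d / sqrt (real d)) at_top sequentially" and q: "q \<in> quads m n" and \<eta>: "0 < \<eta>"
  shows "P.likely \<eta> (\<lambda>d \<omega>. shift_sq d / sqrt (real d) / 2 \<le> CQ_term q d \<omega>)"
proof -
  obtain i1 i2 j1 j2 where qq: "q = (i1, i2, j1, j2)" by (cases q)
  obtain L where L: "P.likely \<eta> (\<lambda>d \<omega>. \<bar>(cross d i1 j1 \<omega> + cross d i2 j2 \<omega> + (\<Sum>k=1..d. noise i1 j1 k \<omega> * noise i2 j2 k \<omega>)) / sqrt (real d)\<bar> \<le> L)"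
    using remainder_tight[OF q[unfolded qq]] \<eta> unfolding P.tight_seq_def by blast
  then show ?thesis
  proof (rule P.likely_mono)
    have "\<forall>\<^sub>F d in sequentially. 2 * L \<le> shift_sq d / sqrt (real d)" using s unfolding filterlim_at_top by blast
    then show "\<forall>\<^sub>F d in sequentially. \<forall>\<omega>\<in>space P. \<bar>(cross d i1 j1 \<omega> + cross d i2 j2 \<omega> + (\<Sum>k=1..d. noise i1 j1 k \<omega> * noise i2 j2 k \<omega>)) / sqrt (real d)\<bar> \<le> L \<longrightarrow>
       shift_sq d / sqrt (real d) / 2 \<le> CQ_term q d \<omega>"
    proof (rule eventually_mono, intro ballI impI)
      fix d \<omega> assume a: "2 * L \<le> shift_sq d / sqrt (real d)"
        "\<bar>(cross d i1 j1 \<omega> + cross d i2 j2 \<omega> + (\<Sum>k=1..d. noise i1 j1 k \<omega> * noise i2 j2 k \<omega>)) / sqrt (real d)\<bar> \<le> L"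
      have "CQ_term q d \<omega> = shift_sq d / sqrt (real d) + (cross d i1 j1 \<omega> + cross d i2 j2 \<omega> + (\<Sum>k=1..d. noise i1 j1 k \<omega> * noise i2 j2 k \<omega>)) / sqrt (real d)"
        unfolding CQ_term_def qq by (simp add: dotp_obs_diff add_divide_distrib)
      moreover have "s / 2 \<le> x" if "x = s + R" "2 * L \<le> s" "\<bar>R\<bar> \<le> L" for s R x :: real
        using that by linarith
      ultimately show "shift_sq d / sqrt (real d) / 2 \<le> CQ_term q d \<omega>" using a by blast
    qed
  qed
qed

text \<open>
  In terms of \<open>s = \<parallel>\<mu>\<parallel>\<^sup>2 / \<surd>d\<close> the scalar product is at least \<open>s / 2\<close> after division by \<open>\<surd>d\<close>, while the norms are
  bounded by \<open>s / \<surd>d + \<sigma>2 + 1\<close>; the quotient tends to infinity whatever the growth of \<open>s\<close>.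
\<close>

lemma WMW_term_infinite:
  assumes s: "filterlim (\<lambda>d. shift_sq d / sqrt (real d)) at_top sequentially" and q: "q \<in> quads m n"
  shows "P.tends_to_infinity_in_prob (WMW_term q)"
proof -
  obtain i1 i2 j1 j2 where qq: "q = (i1, i2, j1, j2)" by (cases q)
  have ij: "i1 \<in> {1..m}" "i2 \<in> {1..m}" "j1 \<in> {1..n}" "j2 \<in> {1..n}" using quadsD q unfolding qq by auto
  let ?s = "\<lambda>d. shift_sq d / sqrt (real d)"
  let ?K = "\<sigma>2 + 1"
  \<comment> \<open>A lower bound of the order of the smaller one of the signal and the root of the dimension.\<close>
  define r where "r d = \<sigma>2 / 2 * inverse (1 / sqrt (real d) + ?K * inverse (?s d))" for d
  have rlim: "filterlim r at_top sequentially"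
  proof -
    have z: "(\<lambda>d. 1 / sqrt (real d) + ?K * inverse (?s d)) \<longlonglongrightarrow> 0 + ?K * 0"
      by (intro tendsto_intros inverse_sqrt_tendsto tendsto_inverse_0_at_top s)
    have p: "\<forall>\<^sub>F d in sequentially. 0 < 1 / sqrt (real d) + ?K * inverse (?s d)"
    proof -
      have "\<forall>\<^sub>F d in sequentially. 0 < ?s d" using s unfolding filterlim_at_top_dense by blast
      then show ?thesis using eventually_gt_at_top[of 0]
        by eventually_elim (intro add_pos_pos mult_pos_pos positive_imp_inverse_positive, use \<sigma>2_pos in simp_all)
    qed
    have "filterlim (\<lambda>d. inverse (1 / sqrt (real d) + ?K * inverse (?s d))) at_top sequentially"
      by (rule filterlim_inverse_at_top[OF _ p]) (use z in simp)
    then show ?thesis unfolding r_def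
      by (rule filterlim_tendsto_pos_mult_at_top[OF tendsto_const, rotated]) (use \<sigma>2_pos in simp)
  qed
  show ?thesis
  proof (rule P.tends_to_infinityI[OF rlim])
    fix \<eta> :: real assume \<eta>: "0 < \<eta>"
    let ?R = "\<lambda>i j d \<omega>. (2 * cross d i j \<omega> + (\<Sum>k=1..d. (noise i j k \<omega>)\<^sup>2)) / real d"
    have "P.likely (\<eta>/3 + (\<eta>/3 + \<eta>/3)) (\<lambda>d \<omega>. ?s d / 2 \<le> CQ_term q d \<omega> \<and> \<bar>?R i1 j1 d \<omega> - \<sigma>2\<bar> < 1 \<and> \<bar>?R i2 j2 d \<omega> - \<sigma>2\<bar> < 1)"
      using \<eta> by (intro P.likely_conj CQ_term_infinite[OF s q] P.tends_in_probD[OF squared_norm_remainder] ij) auto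
    then have "P.likely (\<eta>/3 + (\<eta>/3 + \<eta>/3)) (\<lambda>d \<omega>. r d \<le> WMW_term q d \<omega>)"
    proof (rule P.likely_mono)
      have "\<forall>\<^sub>F d in sequentially. 0 < ?s d" using s unfolding filterlim_at_top_dense by blast
      then show "\<forall>\<^sub>F d in sequentially. \<forall>\<omega>\<in>space P. ?s d / 2 \<le> CQ_term q d \<omega> \<and> \<bar>?R i1 j1 d \<omega> - \<sigma>2\<bar> < 1 \<and> \<bar>?R i2 j2 d \<omega> - \<sigma>2\<bar> < 1
         \<longrightarrow> r d \<le> WMW_term q d \<omega>"
        using eventually_gt_at_top[of 0]
      proof (eventually_elim, intro ballI impI, elim conjE)
        fix d :: nat and \<omega>
        assume sp: "0 < ?s d" and d: "0 < d" and Aq: "?s d / 2 \<le> CQ_term q d \<omega>"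
          and R: "\<bar>?R i1 j1 d \<omega> - \<sigma>2\<bar> < 1" "\<bar>?R i2 j2 d \<omega> - \<sigma>2\<bar> < 1"
        let ?x = "sq_ratio i1 j1 d \<omega>" and ?y = "sq_ratio i2 j2 d \<omega>"
        have x: "?x \<le> shift_sq d / real d + ?K" "?y \<le> shift_sq d / real d + ?K" unfolding sq_ratio_def using R by linarith+
        have L2: "L2_set v {1..d} = 0 \<Longrightarrow> dotp d v w = 0" "L2_set w {1..d} = 0 \<Longrightarrow> dotp d v w = 0" for v w
          by (auto simp: L2_set_eq_0_iff dotp_def)
        \<comment> \<open>A positive inner product forces both differences to be nonzero.\<close>
        have dot: "dotp d (obs_diff d i1 j1 \<omega>) (obs_diff d i2 j2 \<omega>) \<noteq> 0" using Aq sp unfolding CQ_term_def qq by auto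
        have nn: "0 \<le> L2_set (obs_diff d i j \<omega>) {1..d}" for i j by (rule L2_set_nonneg)
        have pos: "0 < sqrt ?x" "0 < sqrt ?y"
        proof -
          have "L2_set (obs_diff d i1 j1 \<omega>) {1..d} \<noteq> 0" "L2_set (obs_diff d i2 j2 \<omega>) {1..d} \<noteq> 0" using L2 dot by blast+
          then have "0 < sqrt (real d) * sqrt ?x" "0 < sqrt (real d) * sqrt ?y"
            using nn[of i1 j1] nn[of i2 j2] unfolding L2_set_obs_diff_eq[OF d] by linarith+
          then show "0 < sqrt ?x" "0 < sqrt ?y" using d by (auto simp: zero_less_mult_iff)
        qed
        have "sqrt ?x * sqrt ?y \<le> sqrt (shift_sq d / real d + ?K) * sqrt (shift_sq d / real d + ?K)"
          using x pos by (intro mult_mono real_sqrt_le_mono) auto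
        also have "\<dots> = shift_sq d / real d + ?K" using shift_sq_nonneg \<sigma>2_pos d by simp
        finally have le: "sqrt ?x * sqrt ?y \<le> shift_sq d / real d + ?K" .
        have pp: "0 < sqrt ?x * sqrt ?y" using pos by simp
        have "r d = \<sigma>2 / (shift_sq d / real d + ?K) * (?s d / 2)"
        proof -
          have e: "1 / sqrt (real d) + ?K * inverse (?s d) = (shift_sq d / real d + ?K) / ?s d"
          proof -
            have "shift_sq d / real d = ?s d * (1 / sqrt (real d))" by simp
            moreover have "a + K * inverse s = (s * a + K) / s" if "0 < s" for a K s :: real
              using that by (simp add: field_simps)
            ultimately show ?thesis using sp by metis
          qed
          show ?thesis unfolding r_def e by (simp add: field_simps)
        qed
        also have "\<dots> \<le> \<sigma>2 / (sqrt ?x * sqrt ?y) * CQ_term q d \<omega>"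
        proof (rule mult_mono[OF _ Aq])
          show "\<sigma>2 / (shift_sq d / real d + ?K) \<le> \<sigma>2 / (sqrt ?x * sqrt ?y)"
            by (rule divide_left_mono[OF le less_imp_le[OF \<sigma>2_pos] mult_pos_pos[OF less_le_trans[OF pp le] pp]])
          show "0 \<le> \<sigma>2 / (sqrt ?x * sqrt ?y)" using \<sigma>2_pos pp by (intro divide_nonneg_nonneg) simp_all
          show "0 \<le> ?s d / 2" using sp by simp
        qed
        finally show "r d \<le> WMW_term q d \<omega>" unfolding WMW_term_def qq by simp
      qed
    qed
    then show "P.likely \<eta> (\<lambda>d \<omega>. r d \<le> WMW_term q d \<omega>)" by simp
  qed
qed

lemma limits_infinite:
  assumes lim: "filterlim (\<lambda>d. shift_sq d / sqrt (Gam d)) at_top sequentially"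
  shows "(\<lambda>d. P.prob {\<omega>\<in>space P. CQ_stat d \<omega> / sqrt (Gam d) > x}) \<longlonglongrightarrow> 1"
    and "(\<lambda>d. P.prob {\<omega>\<in>space P. real d * \<sigma>2 * WMW_stat d \<omega> / sqrt (Gam d) > x}) \<longlonglongrightarrow> 1"
proof -
  have s: "filterlim (\<lambda>d. shift_sq d / sqrt (real d)) at_top sequentially"
  proof (rule filterlim_mono_eventually[OF _ order_refl order_refl])
    have sq: "(\<lambda>d. sqrt (Gam d / real d)) \<longlonglongrightarrow> sqrt \<kappa>" by (intro tendsto_real_sqrt Gam_rate)
    show "filterlim (\<lambda>d. sqrt (Gam d / real d) * (shift_sq d / sqrt (Gam d))) at_top sequentially"
      by (rule filterlim_tendsto_pos_mult_at_top[OF sq _ lim]) (use \<kappa>_pos in simp)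
    show "\<forall>\<^sub>F d in sequentially. sqrt (Gam d / real d) * (shift_sq d / sqrt (Gam d)) = shift_sq d / sqrt (real d)"
      using Gam_pos by (rule eventually_mono) (simp add: real_sqrt_divide)
  qed
  have scale: "P.tends_to_infinity_in_prob T"
    if Y: "\<And>q. q \<in> quads m n \<Longrightarrow> P.tends_to_infinity_in_prob (Y q)"
      and T: "\<And>d \<omega>. 0 < d \<Longrightarrow> T d \<omega> = sqrt (real d) / sqrt (Gam d) * (1 / N * (\<Sum>q\<in>quads m n. Y q d \<omega>))" for Y T
  proof -
    have "P.tends_to_infinity_in_prob (\<lambda>d \<omega>. sqrt (real d) / sqrt (Gam d) * (1 / N * (\<Sum>q\<in>quads m n. Y q d \<omega>)))"
      by (rule P.tends_to_infinity_scaled[OF P.tends_to_infinity_average[OF finite_quads quads_nonempty Y] sqrt_Gam_rate])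
         (use \<kappa>_pos in auto)
    then show ?thesis unfolding P.tends_to_infinity_in_prob_def
      by (blast intro: P.likely_mono eventually_mono[OF eventually_gt_at_top[of 0]] T[THEN sym, THEN subst])
  qed
  have Ainf: "P.tends_to_infinity_in_prob (CQ_term q)" if "q \<in> quads m n" for q
  proof (rule P.tends_to_infinityI)
    show "filterlim (\<lambda>d. shift_sq d / sqrt (real d) / 2) at_top sequentially"
      using filterlim_tendsto_pos_mult_at_top[OF tendsto_const[of "1/2"] _ s] by (simp add: mult.commute)
  qed (rule CQ_term_infinite[OF s that])
  show "(\<lambda>d. P.prob {\<omega>\<in>space P. CQ_stat d \<omega> / sqrt (Gam d) > x}) \<longlonglongrightarrow> 1"
  proof (rule P.tends_to_infinity_prob)
    show "P.tends_to_infinity_in_prob (\<lambda>d \<omega>. CQ_stat d \<omega> / sqrt (Gam d))" by (rule scale[OF Ainf CQ_stat_eq])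
  qed (intro borel_measurable_divide CQ_stat_rv borel_measurable_const)
  show "(\<lambda>d. P.prob {\<omega>\<in>space P. real d * \<sigma>2 * WMW_stat d \<omega> / sqrt (Gam d) > x}) \<longlonglongrightarrow> 1"
  proof (rule P.tends_to_infinity_prob)
    show "P.tends_to_infinity_in_prob (\<lambda>d \<omega>. real d * \<sigma>2 * WMW_stat d \<omega> / sqrt (Gam d))" by (rule scale[OF WMW_term_infinite[OF s] WMW_stat_eq])
  qed (intro borel_measurable_divide borel_measurable_times WMW_stat_rv borel_measurable_const)
qed

end

section \<open>Transfer to arbitrary samples and conclusion\<close>

lemma T_CQ_cong:
  assumes "\<And>i k. i \<in> {1..m} \<Longrightarrow> k \<in> {1..d} \<Longrightarrow> x i k = x' i k" "\<And>j k. j \<in> {1..n} \<Longrightarrow> k \<in> {1..d} \<Longrightarrow> y j k = y' j k"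
  shows "T_CQ d m n x y = T_CQ d m n x' y'"
  unfolding T_CQ_def dotp_def by (intro arg_cong2[where f="(*)"] refl sum.cong) (use assms in auto)

lemma T_WMW_cong:
  assumes "\<And>i k. i \<in> {1..m} \<Longrightarrow> k \<in> {1..d} \<Longrightarrow> x i k = x' i k" "\<And>j k. j \<in> {1..n} \<Longrightarrow> k \<in> {1..d} \<Longrightarrow> y j k = y' j k"
  shows "T_WMW d m n x y = T_WMW d m n x' y'"
proof -
  have L: "L2_set (\<lambda>k. y j k - x i k) {1..d} = L2_set (\<lambda>k. y' j k - x' i k) {1..d}" if "i \<in> {1..m}" "j \<in> {1..n}" for i j
    by (intro L2_set_cong) (use assms that in auto)
  show ?thesis
    unfolding T_WMW_def dotp_def spatial_sign_def by (intro arg_cong2[where f="(*)"] arg_cong2[where f="(/)"] refl sum.cong L) (use assms in auto)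
qed

context
  fixes I :: "(nat + nat) set" and d m n :: nat
  assumes I: "I = {1..m} <+> {1..n}"
begin

abbreviation (input) "PB \<equiv> PiM I (\<lambda>_. PiM {1..d} (\<lambda>_. borel :: real measure))"

lemma entry_rv: "a \<in> I \<Longrightarrow> k \<in> {1..d} \<Longrightarrow> (\<lambda>h. h a k) \<in> borel_measurable PB"
  by (rule measurable_compose[OF measurable_component_singleton[of a I] measurable_component_singleton[of k "{1..d}"]])

lemma T_CQ_rv: "(\<lambda>h. T_CQ d m n (\<lambda>i. h (Inl i)) (\<lambda>j. h (Inr j))) \<in> borel_measurable PB"
  unfolding T_CQ_def dotp_def
  by (intro borel_measurable_times borel_measurable_const borel_measurable_sum borel_measurable_diff entry_rv) (auto simp: I)

lemma T_WMW_rv: "(\<lambda>h. T_WMW d m n (\<lambda>i. h (Inl i)) (\<lambda>j. h (Inr j))) \<in> borel_measurable PB"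
  unfolding T_WMW_def dotp_def spatial_sign_def L2_set_def
  by (intro borel_measurable_times borel_measurable_const borel_measurable_sum borel_measurable_diff borel_measurable_divide
      borel_measurable_power measurable_compose[OF _ borel_measurable_sqrt] entry_rv) (auto simp: I)

end

context two_samples begin

text \<open>
  By independence the joint law of the given samples is the product of their marginals, which is also the joint law of the coordinates
  of the product space shifted by the means. Hence events that depend on the first \<open>d\<close> entries only have the same probability.
\<close>

lemma sample_law_transfer:
  fixes Q :: "'b measure" and X Y :: "nat \<Rightarrow> 'b \<Rightarrow> nat \<Rightarrow> real" and \<mu>1 \<mu>2 :: "nat \<Rightarrow> real"
    and G :: "(nat + nat \<Rightarrow> nat \<Rightarrow> real) \<Rightarrow> real"
  assumes Q: "prob_space Q"
    and ind: "prob_space.indep_vars Q (\<lambda>_. PiM {1..d} (\<lambda>_. borel)) (case_sum X Y) ({1..m} <+> {1..n})"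
    and X: "\<And>i. i \<in> {1..m} \<Longrightarrow> distr Q (PiM {1..d} (\<lambda>_. borel)) (X i)
        = distr M (PiM {1..d} (\<lambda>_. borel)) (\<lambda>\<omega>. \<lambda>k\<in>{1..d}. \<mu>1 k + V k \<omega>)"
    and Y: "\<And>j. j \<in> {1..n} \<Longrightarrow> distr Q (PiM {1..d} (\<lambda>_. borel)) (Y j)
        = distr M (PiM {1..d} (\<lambda>_. borel)) (\<lambda>\<omega>. \<lambda>k\<in>{1..d}. \<mu>2 k + W k \<omega>)"
    and G: "G \<in> borel_measurable (PiM I (\<lambda>_. PiM {1..d} (\<lambda>_. borel)))"
    and cong: "\<And>h h'. (\<And>a k. a \<in> I \<Longrightarrow> k \<in> {1..d} \<Longrightarrow> h a k = h' a k) \<Longrightarrow> G h = G h'"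
  shows "measure Q {\<omega>\<in>space Q. G (\<lambda>a. case_sum X Y a \<omega>) > z}
    = P.prob {\<omega>\<in>space P. G (\<lambda>a k. case_sum (\<lambda>_. \<mu>1) (\<lambda>_. \<mu>2) a k + u a k \<omega>) > z}"
proof -
  interpret Q: prob_space Q by (rule Q)
  let ?B = "PiM {1..d} (\<lambda>_. borel :: real measure)"
  let ?s = "\<lambda>a. case_sum (\<lambda>_. \<mu>1) (\<lambda>_. \<mu>2) a :: nat \<Rightarrow> real"
  define JQ where "JQ = (\<lambda>\<omega>. \<lambda>a\<in>I. case_sum X Y a \<omega>)"
  define JP where "JP = (\<lambda>\<omega>. \<lambda>a\<in>I. \<lambda>k\<in>{1..d}. ?s a k + U a k (\<omega> a))"
  have Ine: "I \<noteq> {}" using mn by (auto simp: I_def)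
  have XY: "case_sum X Y a \<in> measurable Q ?B" if "a \<in> I" for a
    using ind that unfolding Q.indep_vars_def I_def by blast
  have JQm: "JQ \<in> measurable Q (PiM I (\<lambda>_. ?B))" unfolding JQ_def by (intro measurable_restrict XY)
  have Um: "(\<lambda>x. \<lambda>k\<in>{1..d}. ?s a k + U a k x) \<in> measurable M ?B" if "a \<in> I" for a
    using that by (intro measurable_restrict borel_measurable_add borel_measurable_const U_rv) auto
  have JPm: "JP \<in> measurable P (PiM I (\<lambda>_. ?B))" unfolding JP_def by (intro measurable_restrict component_rv Um)
  have "distr Q (PiM I (\<lambda>_. ?B)) JQ = PiM I (\<lambda>a. distr Q ?B (case_sum X Y a))"
    unfolding JQ_def using Q.indep_vars_iff_distr_eq_PiM'[OF Ine, where M'="\<lambda>_. ?B" and X="case_sum X Y"] XY ind by (simp add: I_def)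
  also have "\<dots> = PiM I (\<lambda>a. distr M ?B (\<lambda>x. \<lambda>k\<in>{1..d}. ?s a k + U a k x))"
    by (intro PiM_cong refl) (use X Y in \<open>auto simp: I_def U_def\<close>)
  also have "\<dots> = distr P (PiM I (\<lambda>_. ?B)) JP"
    unfolding JP_def by (rule distr_PiM_coordinatewise[OF finI prob_M Um, symmetric])
  finally have law: "distr Q (PiM I (\<lambda>_. ?B)) JQ = distr P (PiM I (\<lambda>_. ?B)) JP" .
  have S: "{h \<in> space (PiM I (\<lambda>_. ?B)). G h > z} \<in> sets (PiM I (\<lambda>_. ?B))" using G by measurable
  have "measure Q {\<omega>\<in>space Q. G (\<lambda>a. case_sum X Y a \<omega>) > z} = measure (distr Q (PiM I (\<lambda>_. ?B)) JQ) {h \<in> space (PiM I (\<lambda>_. ?B)). G h > z}"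
  proof -
    have "G (\<lambda>a. case_sum X Y a \<omega>) = G (JQ \<omega>)" for \<omega> by (rule cong) (simp add: JQ_def)
    then show ?thesis unfolding measure_distr[OF JQm S]
      using measurable_space[OF JQm] by (intro arg_cong[where f="measure Q"]) auto
  qed
  also have "\<dots> = P.prob {\<omega>\<in>space P. G (\<lambda>a k. ?s a k + u a k \<omega>) > z}"
  proof -
    have "G (\<lambda>a k. ?s a k + u a k \<omega>) = G (JP \<omega>)" for \<omega> by (rule cong) (simp add: JP_def u_def)
    then show ?thesis unfolding law measure_distr[OF JPm S]
      using measurable_space[OF JPm] by (intro arg_cong[where f=P.prob]) auto
  qed
  finally show ?thesis .
qed

end

context stationary_mixing begin

lemma disp_shifted: "1 \<le> k \<Longrightarrow> 1 \<le> l \<Longrightarrow> disp M (\<lambda>k \<omega>. t k + V k \<omega>) k l = \<gamma> (lag k l)"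
  unfolding disp_def cov_def using autocov[of k l] mean[of k] mean[of l] moment1[of k] moment1[of l]
  by (simp add: prob_space)

end

lemma trace_product:
  assumes "\<And>k l. 1 \<le> k \<Longrightarrow> 1 \<le> l \<Longrightarrow> A k l = a (lag k l)" "\<And>k l. 1 \<le> k \<Longrightarrow> 1 \<le> l \<Longrightarrow> B k l = b (lag k l)"
  shows "mat_trace d (mat_mul d A B) = (\<Sum>k=1..d. \<Sum>l=1..d. a (lag k l) * b (lag k l))"
  unfolding mat_trace_def mat_mul_def by (intro sum.cong refl) (use assms in \<open>auto simp: lag_commute\<close>)

theorem theorem2p2:
  fixes M :: "'a measure" and V W :: "nat \<Rightarrow> 'a \<Rightarrow> real"
    and N :: "nat \<Rightarrow> 'b measure" and X Y :: "nat \<Rightarrow> nat \<Rightarrow> 'b \<Rightarrow> nat \<Rightarrow> real"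
    and \<mu>1 \<mu>2 \<mu> :: "nat \<Rightarrow> nat \<Rightarrow> real"
    and \<Sigma>1 \<Sigma>2 :: "nat \<Rightarrow> nat \<Rightarrow> nat \<Rightarrow> real" and \<Gamma>1 :: "nat \<Rightarrow> real"
    and m n :: nat and \<epsilon> \<alpha> \<sigma>1_sq \<sigma>2_sq :: real and c :: ereal
  defines "\<sigma>1_sq \<equiv> prob_space.variance M (V 1)"
    and "\<sigma>2_sq \<equiv> prob_space.variance M (W 1)"
    and "\<mu> \<equiv> \<lambda>d k. \<mu>2 d k - \<mu>1 d k"
    and "\<Sigma>1 \<equiv> \<lambda>d. disp M (\<lambda>k \<omega>. \<mu>1 d k + V k \<omega>)"
    and "\<Sigma>2 \<equiv> \<lambda>d. disp M (\<lambda>k \<omega>. \<mu>2 d k + W k \<omega>)"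
    and "\<Gamma>1 \<equiv> \<lambda>d. Gamma1 d m n (\<Sigma>1 d) (\<Sigma>2 d)"
  assumes prob: "prob_space M"
    and V_rv: "\<And>k. 1 \<le> k \<Longrightarrow> V k \<in> borel_measurable M"
    and W_rv: "\<And>k. 1 \<le> k \<Longrightarrow> W k \<in> borel_measurable M"
    and VW_indep: "prob_space.indep_var M
          (PiM {1..} (\<lambda>_. borel)) (\<lambda>\<omega>. \<lambda>k\<in>{1..}. V k \<omega>)
          (PiM {1..} (\<lambda>_. borel)) (\<lambda>\<omega>. \<lambda>k\<in>{1..}. W k \<omega>)"
    and V_mean: "\<And>k. 1 \<le> k \<Longrightarrow> integrable M (V k) \<and> prob_space.expectation M (V k) = 0"
    and W_mean: "\<And>k. 1 \<le> k \<Longrightarrow> integrable M (W k) \<and> prob_space.expectation M (W k) = 0"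
    and V_stat: "strictly_stationary M V" and W_stat: "strictly_stationary M W"
    and V_mix: "rho_mixing M V" and W_mix: "rho_mixing M W"
    and V_moment: "integrable M (\<lambda>\<omega>. V 1 \<omega> ^ 4)" and W_moment: "integrable M (\<lambda>\<omega>. W 1 \<omega> ^ 4)"
    and V_var: "\<sigma>1_sq > 0" and W_var: "\<sigma>2_sq > 0"
    and V_rho: "summable (\<lambda>k. rho_coeff M V (2 ^ Suc k))"
    and W_rho: "summable (\<lambda>k. rho_coeff M W (2 ^ Suc k))"
    and sample_prob: "\<And>d. 1 \<le> d \<Longrightarrow> prob_space (N d)"
    and sample_indep: "\<And>d. 1 \<le> d \<Longrightarrow>
          prob_space.indep_vars (N d) (\<lambda>_. PiM {1..d} (\<lambda>_. borel)) (case_sum (X d) (Y d))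
            ({1..m} <+> {1..n})"
    and X_distr: "\<And>d i. 1 \<le> d \<Longrightarrow> i \<in> {1..m} \<Longrightarrow>
          distr (N d) (PiM {1..d} (\<lambda>_. borel)) (X d i) =
          distr M (PiM {1..d} (\<lambda>_. borel)) (\<lambda>\<omega>. \<lambda>k\<in>{1..d}. \<mu>1 d k + V k \<omega>)"
    and Y_distr: "\<And>d j. 1 \<le> d \<Longrightarrow> j \<in> {1..n} \<Longrightarrow>
          distr (N d) (PiM {1..d} (\<lambda>_. borel)) (Y d j) =
          distr M (PiM {1..d} (\<lambda>_. borel)) (\<lambda>\<omega>. \<lambda>k\<in>{1..d}. \<mu>2 d k + W k \<omega>)"
    and eps: "\<epsilon> > 0"
    and mu_growth: "(\<lambda>d. (L2_set (\<mu> d) {1..d})\<^sup>2 / real d powr (1/2 + \<epsilon>)) \<longlonglongrightarrow> 0"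
    and mu_quad: "(\<lambda>d. dotp d (\<mu> d) (mat_vec d (mat_add (\<Sigma>1 d) (\<Sigma>2 d)) (\<mu> d)))
          \<in> o(\<lambda>d. mat_trace d (mat_add (mat_mul d (\<Sigma>1 d) (\<Sigma>1 d)) (mat_mul d (\<Sigma>2 d) (\<Sigma>2 d))))"
    and mu_limit: "(\<lambda>d. ereal ((L2_set (\<mu> d) {1..d})\<^sup>2 / sqrt (\<Gamma>1 d))) \<longlonglongrightarrow> c"
    and c_range: "0 \<le> c"
    and alpha: "0 < \<alpha>" "\<alpha> < 1"
    and mn: "2 \<le> m" "2 \<le> n"
  shows "\<exists>\<beta>.
      (\<lambda>d. power_WMW (N d) d m n (X d) (Y d) \<sigma>1_sq \<sigma>2_sq (\<Gamma>1 d) \<alpha>) \<longlonglongrightarrow> \<beta> \<and>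
      (\<lambda>d. power_CQ (N d) d m n (X d) (Y d) (\<Gamma>1 d) \<alpha>) \<longlonglongrightarrow> \<beta> \<and>
      (c = 0 \<longrightarrow> \<beta> = \<alpha>) \<and>
      (c = \<infinity> \<longrightarrow> \<beta> = 1) \<and>
      (0 < c \<and> c < \<infinity> \<longrightarrow> \<alpha> < \<beta> \<and> \<beta> < 1)"
proof -
  interpret M: prob_space M by (rule prob)
  have sV: "stationary_mixing M V"
    by (intro stationary_mixing.intro stationary_mixing_axioms.intro) (use assms in \<open>auto simp: M.prob_space_axioms\<close>)
  have sW: "stationary_mixing M W"
    by (intro stationary_mixing.intro stationary_mixing_axioms.intro) (use assms in \<open>auto simp: M.prob_space_axioms\<close>)
  let ?g1 = "stationary_mixing.\<gamma> M V" and ?g2 = "stationary_mixing.\<gamma> M W"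
  have var1: "\<sigma>1_sq = ?g1 0" and var2: "\<sigma>2_sq = ?g2 0"
    using V_mean[of 1] W_mean[of 1]
    by (simp_all add: \<sigma>1_sq_def \<sigma>2_sq_def stationary_mixing.\<gamma>_def[OF sV] stationary_mixing.\<gamma>_def[OF sW] power2_eq_square)
  have two: "two_samples M V W m n"
    by (intro two_samples.intro sV sW) (use V_var W_var var1 var2 mn in auto)
  interpret T: two_samples M V W m n by (rule two)
  have S1: "\<Sigma>1 d k l = ?g1 (lag k l)" if "1 \<le> k" "1 \<le> l" for d k l
    unfolding \<Sigma>1_def by (rule stationary_mixing.disp_shifted[OF sV that])
  have S2: "\<Sigma>2 d k l = ?g2 (lag k l)" if "1 \<le> k" "1 \<le> l" for d k l
    unfolding \<Sigma>2_def by (rule stationary_mixing.disp_shifted[OF sW that])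
  have tp: "mat_trace d (mat_mul d (\<Sigma>1 d) (\<Sigma>1 d)) = (\<Sum>k=1..d. \<Sum>l=1..d. ?g1 (lag k l) * ?g1 (lag k l))"
    "mat_trace d (mat_mul d (\<Sigma>2 d) (\<Sigma>2 d)) = (\<Sum>k=1..d. \<Sum>l=1..d. ?g2 (lag k l) * ?g2 (lag k l))"
    "mat_trace d (mat_mul d (\<Sigma>1 d) (\<Sigma>2 d)) = (\<Sum>k=1..d. \<Sum>l=1..d. ?g1 (lag k l) * ?g2 (lag k l))" for d
    by (rule trace_product; rule S1 S2; assumption)+
  have Gam: "\<Gamma>1 d = T.Gam d" for d
    unfolding \<Gamma>1_def Gamma1_def T.Gam_def T.cov_Z_eq tp
    by (simp add: sum.distrib sum_distrib_left sum_divide_distrib)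
  have quad: "dotp d (\<mu> d) (mat_vec d (mat_add (\<Sigma>1 d) (\<Sigma>2 d)) (\<mu> d))
     = (\<Sum>k=1..d. \<Sum>l=1..d. \<mu> d k * \<mu> d l * (?g1 (lag k l) + ?g2 (lag k l)))" for d
    unfolding dotp_def mat_vec_def mat_add_def sum_distrib_left by (intro sum.cong refl) (simp add: S1 S2)
  have tr: "mat_trace d (mat_add (mat_mul d (\<Sigma>1 d) (\<Sigma>1 d)) (mat_mul d (\<Sigma>2 d) (\<Sigma>2 d)))
     = (\<Sum>k=1..d. \<Sum>l=1..d. ?g1 (lag k l) * ?g1 (lag k l)) + (\<Sum>k=1..d. \<Sum>l=1..d. ?g2 (lag k l) * ?g2 (lag k l))" for d
  proof -
    have "mat_trace d (mat_add A B) = mat_trace d A + mat_trace d B" for A B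
      by (simp add: mat_trace_def mat_add_def sum.distrib)
    then show ?thesis by (simp only: tp)
  qed
  have "(\<lambda>d. mat_trace d (mat_add (mat_mul d (\<Sigma>1 d) (\<Sigma>1 d)) (mat_mul d (\<Sigma>2 d) (\<Sigma>2 d)))) \<in> O(\<lambda>d. real d)"
  proof (rule bigoI_tendsto)
    have "summable (\<lambda>k. \<bar>?g1 k * ?g1 k\<bar>)" "summable (\<lambda>k. \<bar>?g2 k * ?g2 k\<bar>)"
      using stationary_mixing.autocov_square_summable[OF sV] stationary_mixing.autocov_square_summable[OF sW]
      by (simp_all add: power2_eq_square)
    then show "(\<lambda>d. mat_trace d (mat_add (mat_mul d (\<Sigma>1 d) (\<Sigma>1 d)) (mat_mul d (\<Sigma>2 d) (\<Sigma>2 d))) / real d)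
      \<longlonglongrightarrow> (?g1 0 * ?g1 0 + 2 * (\<Sum>k. ?g1 (Suc k) * ?g1 (Suc k))) + (?g2 0 * ?g2 0 + 2 * (\<Sum>k. ?g2 (Suc k) * ?g2 (Suc k)))"
      unfolding tr add_divide_distrib by (intro tendsto_add toeplitz_mean)
    show "\<forall>\<^sub>F d in sequentially. real d \<noteq> 0" using eventually_gt_at_top[of 0] by (rule eventually_mono) simp
  qed
  from smalloD_tendsto[OF landau_o.small_big_trans[OF mu_quad this]]
  have "(\<lambda>d. (\<Sum>k=1..d. \<Sum>l=1..d. \<mu> d k * \<mu> d l * (?g1 (lag k l) + ?g2 (lag k l))) / real d) \<longlonglongrightarrow> 0"
    unfolding quad .
  then interpret S: shifted_samples M V W m n \<mu>
    by unfold_locales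
  have shift_sq: "(L2_set (\<mu> d) {1..d})\<^sup>2 = S.shift_sq d" for d
    unfolding L2_set_def S.shift_sq_def by (simp add: sum_nonneg)
  have \<sigma>2: "\<sigma>1_sq + \<sigma>2_sq = T.\<sigma>2" unfolding T.\<sigma>2_def var1 var2 ..
  let ?z = "gauss_crit \<alpha>"
  let ?h = "\<lambda>d a k \<omega>. case_sum (\<lambda>_. \<mu>1 d) (\<lambda>_. \<mu>2 d) a k + T.u a k \<omega>"
  have Dk: "S.obs_diff d i j \<omega> k = (\<mu>2 d k - \<mu>1 d k) + (T.u (Inr j) k \<omega> - T.u (Inl i) k \<omega>)" for d i j \<omega> k
    unfolding S.obs_diff_def T.noise_def unfolding \<mu>_def ..
  have CQ_stat: "T_CQ d m n (\<lambda>i k. ?h d (Inl i) k \<omega>) (\<lambda>j k. ?h d (Inr j) k \<omega>) = S.CQ_stat d \<omega>" for d \<omega>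
  proof -
    have "dotp d (\<lambda>k. ?h d (Inl i1) k \<omega> - ?h d (Inr j1) k \<omega>) (\<lambda>k. ?h d (Inl i2) k \<omega> - ?h d (Inr j2) k \<omega>)
       = dotp d (S.obs_diff d i1 j1 \<omega>) (S.obs_diff d i2 j2 \<omega>)" for i1 i2 j1 j2
      unfolding dotp_def Dk by (intro sum.cong refl) (simp add: algebra_simps)
    then show ?thesis unfolding T_CQ_def S.CQ_stat_def card_quads sum_quads by simp
  qed
  have WMW_stat: "T_WMW d m n (\<lambda>i k. ?h d (Inl i) k \<omega>) (\<lambda>j k. ?h d (Inr j) k \<omega>) = S.WMW_stat d \<omega>" for d \<omega>
  proof -
    have "(\<lambda>k. ?h d (Inr j) k \<omega> - ?h d (Inl i) k \<omega>) = S.obs_diff d i j \<omega>" for i j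
      by (auto simp: Dk)
    then show ?thesis unfolding T_WMW_def S.WMW_stat_def card_quads sum_quads by simp
  qed
  have power_CQ_eq: "power_CQ (N d) d m n (X d) (Y d) (\<Gamma>1 d) \<alpha> = T.P.prob {\<omega>\<in>space T.P. S.CQ_stat d \<omega> / sqrt (T.Gam d) > ?z}"
    if d: "1 \<le> d" for d
  proof -
    let ?G = "\<lambda>h. T_CQ d m n (\<lambda>i. h (Inl i)) (\<lambda>j. h (Inr j)) / sqrt (T.Gam d)"
    have "measure (N d) {\<omega>\<in>space (N d). ?G (\<lambda>a. case_sum (X d) (Y d) a \<omega>) > ?z} = T.P.prob {\<omega>\<in>space T.P. ?G (\<lambda>a k. ?h d a k \<omega>) > ?z}"
    proof (rule T.sample_law_transfer[OF sample_prob[OF d] sample_indep[OF d] X_distr[OF d] Y_distr[OF d]])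
      show "?G \<in> borel_measurable (PiM T.I (\<lambda>_. PiM {1..d} (\<lambda>_. borel)))"
        by (intro borel_measurable_divide T_CQ_rv T.I_def borel_measurable_const)
      show "?G h = ?G h'" if "\<And>a k. a \<in> T.I \<Longrightarrow> k \<in> {1..d} \<Longrightarrow> h a k = h' a k" for h h'
        by (intro arg_cong2[where f="(/)"] T_CQ_cong refl) (use that in auto)
    qed
    then show ?thesis unfolding power_CQ_def Gam CQ_stat by simp
  qed
  have power_WMW_eq: "power_WMW (N d) d m n (X d) (Y d) \<sigma>1_sq \<sigma>2_sq (\<Gamma>1 d) \<alpha>
      = T.P.prob {\<omega>\<in>space T.P. real d * T.\<sigma>2 * S.WMW_stat d \<omega> / sqrt (T.Gam d) > ?z}"
    if d: "1 \<le> d" for d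
  proof -
    let ?G = "\<lambda>h. real d * T.\<sigma>2 * T_WMW d m n (\<lambda>i. h (Inl i)) (\<lambda>j. h (Inr j)) / sqrt (T.Gam d)"
    have "measure (N d) {\<omega>\<in>space (N d). ?G (\<lambda>a. case_sum (X d) (Y d) a \<omega>) > ?z} = T.P.prob {\<omega>\<in>space T.P. ?G (\<lambda>a k. ?h d a k \<omega>) > ?z}"
    proof (rule T.sample_law_transfer[OF sample_prob[OF d] sample_indep[OF d] X_distr[OF d] Y_distr[OF d]])
      show "?G \<in> borel_measurable (PiM T.I (\<lambda>_. PiM {1..d} (\<lambda>_. borel)))"
        by (intro borel_measurable_divide borel_measurable_times T_WMW_rv T.I_def borel_measurable_const)
      show "?G h = ?G h'" if "\<And>a k. a \<in> T.I \<Longrightarrow> k \<in> {1..d} \<Longrightarrow> h a k = h' a k" for h h'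
        by (intro arg_cong2[where f="(/)"] arg_cong2[where f="(*)"] T_WMW_cong refl) (use that in auto)
    qed
    then show ?thesis unfolding power_WMW_def Gam WMW_stat \<sigma>2 by simp
  qed
  have main: "?thesis"
    if TCl: "(\<lambda>d. T.P.prob {\<omega>\<in>space T.P. S.CQ_stat d \<omega> / sqrt (T.Gam d) > ?z}) \<longlonglongrightarrow> \<beta>"
      and TWl: "(\<lambda>d. T.P.prob {\<omega>\<in>space T.P. real d * T.\<sigma>2 * S.WMW_stat d \<omega> / sqrt (T.Gam d) > ?z}) \<longlonglongrightarrow> \<beta>"
      and \<beta>: "c = 0 \<longrightarrow> \<beta> = \<alpha>" "c = \<infinity> \<longrightarrow> \<beta> = 1" "0 < c \<and> c < \<infinity> \<longrightarrow> \<alpha> < \<beta> \<and> \<beta> < 1" for \<beta>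
  proof (intro exI[of _ \<beta>] conjI \<beta>)
    show "(\<lambda>d. power_WMW (N d) d m n (X d) (Y d) \<sigma>1_sq \<sigma>2_sq (\<Gamma>1 d) \<alpha>) \<longlonglongrightarrow> \<beta>"
      by (rule Lim_transform_eventually[OF TWl]) (use eventually_ge_at_top[of 1] in \<open>rule eventually_mono, simp add: power_WMW_eq\<close>)
    show "(\<lambda>d. power_CQ (N d) d m n (X d) (Y d) (\<Gamma>1 d) \<alpha>) \<longlonglongrightarrow> \<beta>"
      by (rule Lim_transform_eventually[OF TCl]) (use eventually_ge_at_top[of 1] in \<open>rule eventually_mono, simp add: power_CQ_eq\<close>)
  qed
  have lim: "(\<lambda>d. ereal (S.shift_sq d / sqrt (T.Gam d))) \<longlonglongrightarrow> c" using mu_limit unfolding shift_sq Gam .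
  show ?thesis
  proof (cases c)
    case (real l)
    then have l: "(\<lambda>d. S.shift_sq d / sqrt (T.Gam d)) \<longlonglongrightarrow> l" using lim by simp
    let ?F = "cdf std_normal_distribution"
    have crit: "?F ?z = 1 - \<alpha>" by (rule cdf_gauss_crit[OF alpha])
    have pos: "0 < ?F y" for y
      using std_normal_cdf_strict_mono[of "y - 1" y] std_normal.cdf_nonneg[of "y - 1"] by simp
    show ?thesis
    proof (rule main[OF S.CQ_stat_limit_finite[OF l] S.WMW_stat_limit_finite[OF l]])
      show "c = 0 \<longrightarrow> 1 - ?F (?z - l) = \<alpha>" using real crit by (auto simp: zero_ereal_def)
      show "c = \<infinity> \<longrightarrow> 1 - ?F (?z - l) = 1" using real by simp
      show "0 < c \<and> c < \<infinity> \<longrightarrow> \<alpha> < 1 - ?F (?z - l) \<and> 1 - ?F (?z - l) < 1"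
        using real crit pos[of "?z - l"] std_normal_cdf_strict_mono[of "?z - l" ?z] by auto
    qed
  next
    case PInf
    then have inf: "filterlim (\<lambda>d. S.shift_sq d / sqrt (T.Gam d)) at_top sequentially"
      using lim by (simp add: tendsto_PInfty_eq_at_top)
    show ?thesis
      by (rule main[OF S.limits_infinite(1)[OF inf] S.limits_infinite(2)[OF inf]]) (use PInf in auto)
  next
    case MInf
    then show ?thesis using c_range by simp
  qed
qed

end
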